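(* Let $A=[\mathbf{a}_1,\dots,\mathbf{a}_n]\in\mathbb{Z}^{m\times n}$ have no free bouquet, let $I_A\subset S=K[x_1,\dots,x_n]$ be a stable positively graded toric ideal, and let $A_B=[\mathbf{a}_{B_1},\dots,\mathbf{a}_{B_s}]$ with $I_{A_B}\subset R=K[y_1,\dots,y_s]$, where $B_1,\dots,B_s$ are the bouquets of $A$. Regard $S$ as an $R$-algebra via the $K$-algebra homomorphism $\phi:R\to S$, $\phi(y_i)=\mathbf{x}^{\mathbf{c}_{B_i}}$ for $i=1,\dots,s$. If $\mathbb{F}_{\bullet}$ denotes the minimal $\mathbb{N}A_B$-graded free resolution of $R/I_{A_B}$ over $R$, then $\mathbb{F}_{\bullet}\otimes_R S$ is a minimal $\mathbb{N}A$-graded free resolution of $S/I_A$ over $S$.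
   Context: $K$ is a field. For $A=[\mathbf{a}_1,\dots,\mathbf{a}_n]\in\mathbb{Z}^{m\times n}$ let $\operatorname{Ker}_{\mathbb{Z}}(A)=\{\mathbf{u}\in\mathbb{Z}^n:A\mathbf{u}=\mathbf{0}\}$. For an integer vector write $\mathbf{u}=\mathbf{u}^+-\mathbf{u}^-$ with $\mathbf{u}^{\pm}$ nonnegative of disjoint support. The toric ideal of $A$ is $I_A=(\mathbf{x}^{\mathbf{u}^+}-\mathbf{x}^{\mathbf{u}^-}:\mathbf{u}\in\operatorname{Ker}_{\mathbb{Z}}(A))\subset K[x_1,\dots,x_n]$. It is positively graded if $\operatorname{Ker}_{\mathbb{Z}}(A)\cap\mathbb{N}^n=\{\mathbf{0}\}$. $\mathbb{N}A$ is the semigroup generated by the columns of $A$; the $\mathbb{N}A$-grading on $S$ is $\deg(x_j)=\mathbf{a}_j$, and the $\mathbb{N}A_B$-grading on $R$ is $\deg(y_i)=\mathbf{a}_{B_i}$. Gale transform: let $r=\operatorname{rank}A$, fix a basis $G_1,\dots,G_{n-r}$ of the lattice $\operatorname{Ker}_{\mathbb{Z}}(A)$, and let $G(\mathbf{a}_i)\in\mathbb{Z}^{n-r}$ be the $i$-th row of the matrix with columns $G_1,\dots,G_{n-r}$. Bouquets: a co-vector of $A$ is a vector $(\mathbf{v}\cdot\mathbf{a}_1,\dots,\mathbf{v}\cdot\mathbf{a}_n)$ with $\mathbf{v}\in\mathbb{Z}^m$; a co-circuit is a nonzero co-vector of minimal support. $\mathbf{a}_i$ is free if $\{i\}$ is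 the support of a co-circuit (equivalently $G(\mathbf{a}_i)=\mathbf{0}$); $A$ has no free bouquet if no $\mathbf{a}_i$ is free. The bouquet graph $G_A$ has vertices $\mathbf{a}_1,\dots,\mathbf{a}_n$ (distinguished by their indices), and $\{\mathbf{a}_i,\mathbf{a}_j\}$, $i\neq j$, is an edge if there is a co-vector with support $\{i,j\}$. When there are no free vectors such a co-vector is a co-circuit; the edge is in $E_A^+$ if its two nonzero coordinates have distinct signs and in $E_A^-$ if they have the same sign. The bouquets of $A$ are the connected components of $G_A$. A (non-free) bouquet is mixed if it contains an edge of $E_A^-$, and non-mixed if it is an isolated vertex or all its edges are in $E_A^+$. $I_A$ is stable if all bouquets of $A$ are non-mixed. Vectors $\mathbf{c}_B$, $\mathbf{a}_B$ of a bouquet $B$: choose a coordinate $j$ with $G(\mathbf{a}_i)_j\neq0$ for all $\mathbf{a}_i\in B$ (these Gale vectors are nonzero and pairwise proportional), let $g_j=\gcd(G(\mathbf{a}_i)_j:\mathbf{a}_i\in B)$, let $i_0$ be the smallest index with $\mathbf{a}_{i_0}\in B$, let $\varepsilon$ be the sign of $G(\mathbf{a}_{i_0})_j$, and let $\mathbf{c}_B\in\mathbb{Z}^n$ have $i$-th coordinate $\varepsilon G(\mathbf{a}_i)_j/g_j$ if $\mathbf{a}_i\in B$ and $0$ otherwise (independent of $j$). Set $\mathbf{a}_B=\sum_{i=1}^n(\mathbf{c}_B)_i\mathbf{a}_i$. When $B$ is non-mixed all nonzero coordinates of $\mathbf{c}_B$ are positive, so $\mathbf{x}^{\mathbf{c}_B}$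 is a monomial of $S$. *)

theory Defs
  imports
    "HOL-Analysis.Cartesian_Space"
    "HOL-Algebra.Free_Abelian_Groups"
    "HOL-Algebra.Generated_Groups"
    "HOL-Algebra.QuotRing"
    "HOL-Algebra.Module"
begin

section \<open>Graded modules and minimal graded free resolutions\<close>

text \<open>
  A grading by a set of degrees \<open>\<Gamma>\<close> is given by its homogeneous components;
  the components at degrees outside \<open>\<Gamma>\<close> are irrelevant.
\<close>

definition graded_module ::
    "'r ring \<Rightarrow> 'g::comm_monoid_add set \<Rightarrow> ('g \<Rightarrow> 'r set) \<Rightarrow> ('r, 'a) module \<Rightarrow> ('g \<Rightarrow> 'a set) \<Rightarrow> bool"
  where "graded_module R \<Gamma> Rg M Mg \<longleftrightarrow>
    Module.module R M \<and>
    (\<forall>d\<in>\<Gamma>. additive_subgroup (Mg d) M) \<and>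
    (\<forall>x\<in>carrier M. \<exists>!f. (\<forall>d\<in>\<Gamma>. f d \<in> Mg d) \<and> (\<forall>d. d \<notin> \<Gamma> \<longrightarrow> f d = \<zero>\<^bsub>M\<^esub>) \<and>
        finite {d. f d \<noteq> \<zero>\<^bsub>M\<^esub>} \<and> x = (\<Oplus>\<^bsub>M\<^esub>d\<in>{d. f d \<noteq> \<zero>\<^bsub>M\<^esub>}. f d)) \<and>
    (\<forall>c\<in>\<Gamma>. \<forall>d\<in>\<Gamma>. \<forall>a\<in>Rg c. \<forall>x\<in>Mg d. a \<odot>\<^bsub>M\<^esub> x \<in> Mg (c + d))"

definition module_basis :: "'r ring \<Rightarrow> ('r, 'a) module \<Rightarrow> 'a set \<Rightarrow> bool"
  where "module_basis R M E \<longleftrightarrow>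
    finite E \<and> E \<subseteq> carrier M \<and>
    (\<forall>x\<in>carrier M. \<exists>!a. a \<in> E \<rightarrow>\<^sub>E carrier R \<and> x = (\<Oplus>\<^bsub>M\<^esub>e\<in>E. a e \<odot>\<^bsub>M\<^esub> e))"

text \<open>Finitely generated graded free: a finite direct sum of shifts \<open>R(-d)\<close> with \<open>d \<in> \<Gamma>\<close>.\<close>

definition graded_free_module ::
    "'r ring \<Rightarrow> 'g::comm_monoid_add set \<Rightarrow> ('g \<Rightarrow> 'r set) \<Rightarrow> ('r, 'a) module \<Rightarrow> ('g \<Rightarrow> 'a set) \<Rightarrow> bool"
  where "graded_free_module R \<Gamma> Rg M Mg \<longleftrightarrow>
    graded_module R \<Gamma> Rg M Mg \<and> (\<exists>E. E \<subseteq> (\<Union>d\<in>\<Gamma>. Mg d) \<and> module_basis R M E)"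

definition graded_hom ::
    "'r ring \<Rightarrow> 'g set \<Rightarrow> ('r, 'a) module \<Rightarrow> ('g \<Rightarrow> 'a set) \<Rightarrow> ('r, 'b) module \<Rightarrow> ('g \<Rightarrow> 'b set)
      \<Rightarrow> ('a \<Rightarrow> 'b) \<Rightarrow> bool"
  where "graded_hom R \<Gamma> M Mg N Ng f \<longleftrightarrow>
    f \<in> carrier M \<rightarrow> carrier N \<and>
    (\<forall>x\<in>carrier M. \<forall>y\<in>carrier M. f (x \<oplus>\<^bsub>M\<^esub> y) = f x \<oplus>\<^bsub>N\<^esub> f y) \<and>
    (\<forall>a\<in>carrier R. \<forall>x\<in>carrier M. f (a \<odot>\<^bsub>M\<^esub> x) = a \<odot>\<^bsub>N\<^esub> f x) \<and>
    (\<forall>d\<in>\<Gamma>. f ` Mg d \<subseteq> Ng d)"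

definition ideal_times_module :: "'r set \<Rightarrow> ('r, 'a) module \<Rightarrow> 'a set"
  where "ideal_times_module I M =
    generate (add_monoid M) {a \<odot>\<^bsub>M\<^esub> x | a x. a \<in> I \<and> x \<in> carrier M}"

text \<open>
  \<open>\<dots> \<rightarrow> F 2 \<rightarrow> F 1 \<rightarrow> F 0 \<rightarrow> M \<rightarrow> 0\<close> with differentials \<open>D i : F (i + 1) \<rightarrow> F i\<close>,
  where \<open>\<mm>\<close> is the graded maximal ideal of \<open>R\<close>.
\<close>

definition minimal_graded_free_resolution ::
    "'r ring \<Rightarrow> 'r set \<Rightarrow> 'g::comm_monoid_add set \<Rightarrow> ('g \<Rightarrow> 'r set)
      \<Rightarrow> (nat \<Rightarrow> ('r, 'a) module) \<Rightarrow> (nat \<Rightarrow> 'g \<Rightarrow> 'a set) \<Rightarrow> (nat \<Rightarrow> 'a \<Rightarrow> 'a)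
      \<Rightarrow> ('r, 'b) module \<Rightarrow> ('g \<Rightarrow> 'b set) \<Rightarrow> bool"
  where "minimal_graded_free_resolution R \<mm> \<Gamma> Rg F Fg D M Mg \<longleftrightarrow>
    graded_module R \<Gamma> Rg M Mg \<and>
    (\<forall>i. graded_free_module R \<Gamma> Rg (F i) (Fg i)) \<and>
    (\<forall>i. graded_hom R \<Gamma> (F (Suc i)) (Fg (Suc i)) (F i) (Fg i) (D i)) \<and>
    (\<forall>i. D (Suc i) ` carrier (F (Suc (Suc i))) = {x \<in> carrier (F (Suc i)). D i x = \<zero>\<^bsub>F i\<^esub>}) \<and>
    (\<exists>\<pi>. graded_hom R \<Gamma> (F 0) (Fg 0) M Mg \<pi> \<and> \<pi> ` carrier (F 0) = carrier M \<and>
        D 0 ` carrier (F (Suc 0)) = {x \<in> carrier (F 0). \<pi> x = \<zero>\<^bsub>M\<^esub>}) \<and>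
    (\<forall>i. D i ` carrier (F (Suc i)) \<subseteq> ideal_times_module \<mm> (F i))"

text \<open>
  \<open>R/I\<close> as an \<open>R\<close>-module. A module record extends a ring record; here and below the unused
  fields \<open>mult\<close> and \<open>one\<close> are left unspecified.
\<close>

definition quotient_module :: "'r ring \<Rightarrow> 'r set \<Rightarrow> ('r, 'r set) module"
  where "quotient_module R I =
    \<lparr>carrier = a_rcosets\<^bsub>R\<^esub> I, mult = undefined, one = undefined, zero = I, add = set_add R,
     smult = (\<lambda>a X. \<Union>x\<in>X. I +>\<^bsub>R\<^esub> (a \<otimes>\<^bsub>R\<^esub> x))\<rparr>"


section \<open>The functor \<open>_ \<otimes>\<^sub>R S\<close>\<close>

text \<open>
  For \<open>\<phi> : R \<rightarrow> S\<close> and an \<open>R\<close>-module \<open>M\<close>, the group \<open>M \<otimes>\<^sub>R S\<close> is the free abelian group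
  on \<open>M \<times> S\<close> modulo the subgroup generated by the usual relations; \<open>S\<close> acts on the second factor.
\<close>

definition tensor_relations ::
    "'r ring \<Rightarrow> 's ring \<Rightarrow> ('r \<Rightarrow> 's) \<Rightarrow> ('r, 'a) module \<Rightarrow> ('a \<times> 's \<Rightarrow>\<^sub>0 int) set"
  where "tensor_relations R S \<phi> M = generate (free_Abelian_group (carrier M \<times> carrier S))
    ({frag_of (x \<oplus>\<^bsub>M\<^esub> y, s) - frag_of (x, s) - frag_of (y, s) | x y s.
        x \<in> carrier M \<and> y \<in> carrier M \<and> s \<in> carrier S} \<union>
     {frag_of (x, s \<oplus>\<^bsub>S\<^esub> t) - frag_of (x, s) - frag_of (x, t) | x s t.
        x \<in> carrier M \<and> s \<in> carrier S \<and> t \<in> carrier S} \<union>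
     {frag_of (r \<odot>\<^bsub>M\<^esub> x, s) - frag_of (x, \<phi> r \<otimes>\<^bsub>S\<^esub> s) | r x s.
        r \<in> carrier R \<and> x \<in> carrier M \<and> s \<in> carrier S})"

definition tensor_class ::
    "'r ring \<Rightarrow> 's ring \<Rightarrow> ('r \<Rightarrow> 's) \<Rightarrow> ('r, 'a) module \<Rightarrow> ('a \<times> 's \<Rightarrow>\<^sub>0 int) \<Rightarrow> ('a \<times> 's \<Rightarrow>\<^sub>0 int) set"
  where "tensor_class R S \<phi> M z =
    tensor_relations R S \<phi> M #>\<^bsub>free_Abelian_group (carrier M \<times> carrier S)\<^esub> z"

definition tensor_module ::
    "'r ring \<Rightarrow> 's ring \<Rightarrow> ('r \<Rightarrow> 's) \<Rightarrow> ('r, 'a) module \<Rightarrow> ('s, ('a \<times> 's \<Rightarrow>\<^sub>0 int) set) module"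
  where "tensor_module R S \<phi> M =
    (let Q = free_Abelian_group (carrier M \<times> carrier S) Mod tensor_relations R S \<phi> M in
     \<lparr>carrier = carrier Q, mult = undefined, one = undefined,
      zero = \<one>\<^bsub>Q\<^esub>, add = (\<otimes>\<^bsub>Q\<^esub>),
      smult = (\<lambda>s X. \<Union>z\<in>X. tensor_class R S \<phi> M
                  (frag_extend (\<lambda>(x, t). frag_of (x, s \<otimes>\<^bsub>S\<^esub> t)) z))\<rparr>)"

text \<open>The map \<open>f \<otimes> S : M \<otimes>\<^sub>R S \<rightarrow> N \<otimes>\<^sub>R S\<close>; only the target \<open>N\<close> enters the formula.\<close>

definition tensor_map ::
    "'r ring \<Rightarrow> 's ring \<Rightarrow> ('r \<Rightarrow> 's) \<Rightarrow> ('r, 'b) module \<Rightarrow> ('a \<Rightarrow> 'b)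
      \<Rightarrow> ('a \<times> 's \<Rightarrow>\<^sub>0 int) set \<Rightarrow> ('b \<times> 's \<Rightarrow>\<^sub>0 int) set"
  where "tensor_map R S \<phi> N f X =
    (\<Union>z\<in>X. tensor_class R S \<phi> N (frag_extend (\<lambda>(x, t). frag_of (f x, t)) z))"

text \<open>
  \<open>(M \<otimes>\<^sub>R S)\<^sub>e\<close> is spanned by the \<open>x \<otimes> s\<close> with \<open>x\<close>, \<open>s\<close> homogeneous and
  \<open>deg x + deg s = e\<close>.
\<close>

definition tensor_grading ::
    "'r ring \<Rightarrow> 's ring \<Rightarrow> ('r \<Rightarrow> 's) \<Rightarrow> ('r, 'a) module
      \<Rightarrow> 'g::comm_monoid_add set \<Rightarrow> ('g \<Rightarrow> 'a set) \<Rightarrow> 'g set \<Rightarrow> ('g \<Rightarrow> 's set)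
      \<Rightarrow> 'g \<Rightarrow> ('a \<times> 's \<Rightarrow>\<^sub>0 int) set set"
  where "tensor_grading R S \<phi> M \<Gamma> Mg \<Delta> Sg e =
    generate (add_monoid (tensor_module R S \<phi> M))
      {tensor_class R S \<phi> M (frag_of (x, s)) | x s c d.
         c \<in> \<Gamma> \<and> x \<in> Mg c \<and> d \<in> \<Delta> \<and> s \<in> Sg d \<and> c + d = e}"


section \<open>Polynomial rings\<close>

text \<open>
  \<open>K[x\<^sub>i : i \<in> 'v]\<close> is the type of finitely supported functions from exponents
  \<open>'v \<Rightarrow>\<^sub>0 nat\<close> to \<open>K\<close>, with the convolution product.
\<close>

type_synonym ('v, 'k) mpoly = "('v \<Rightarrow>\<^sub>0 nat) \<Rightarrow>\<^sub>0 'k"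

definition mpoly_ring :: "('v, 'k::field) mpoly ring"
  where "mpoly_ring = \<lparr>carrier = UNIV, mult = (*), one = 1, zero = 0, add = (+)\<rparr>"

definition monomial :: "('v \<Rightarrow>\<^sub>0 nat) \<Rightarrow> ('v, 'k::field) mpoly"
  where "monomial e = Poly_Mapping.single e 1"

definition mpoly_const :: "'k::field \<Rightarrow> ('v, 'k) mpoly"
  where "mpoly_const c = Poly_Mapping.single 0 c"

definition irrelevant_ideal :: "('v, 'k::field) mpoly set"
  where "irrelevant_ideal = Idl\<^bsub>mpoly_ring\<^esub> (range (\<lambda>i. monomial (Poly_Mapping.single i 1)))"

text \<open>The \<open>K\<close>-algebra homomorphism sending the \<open>i\<close>-th variable to \<open>g i\<close>.\<close>

definition substitution ::
    "('v \<Rightarrow> ('w, 'k::field) mpoly) \<Rightarrow> ('v, 'k) mpoly \<Rightarrow> ('w, 'k) mpoly"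
  where "substitution g p = (\<Sum>e\<in>Poly_Mapping.keys p.
    mpoly_const (Poly_Mapping.lookup p e) * (\<Prod>i\<in>Poly_Mapping.keys e. g i ^ Poly_Mapping.lookup e i))"


section \<open>Toric ideals\<close>

definition integer_kernel :: "int^'n^'m \<Rightarrow> (int^'n) set"
  where "integer_kernel A = {u. A *v u = 0}"

text \<open>
  The exponent \<open>u\<^sup>+\<close>; since \<open>nat\<close> truncates, \<open>u\<^sup>-\<close> is \<open>pos_part (- u)\<close>, and \<open>pos_part u\<close> is
  \<open>u\<close> itself when \<open>u\<close> is nonnegative.
\<close>

definition pos_part :: "int^'n \<Rightarrow> ('n::finite \<Rightarrow>\<^sub>0 nat)"
  where "pos_part u = Abs_poly_mapping (\<lambda>i. nat (u $ i))"

definition toric_ideal :: "int^'n^'m \<Rightarrow> ('n::finite, 'k::field) mpoly set"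
  where "toric_ideal A = Idl\<^bsub>mpoly_ring\<^esub>
    {monomial (pos_part u) - monomial (pos_part (- u)) | u. u \<in> integer_kernel A}"

definition positively_graded :: "int^'n^'m \<Rightarrow> bool"
  where "positively_graded A \<longleftrightarrow> integer_kernel A \<inter> {u. \<forall>i. 0 \<le> u $ i} = {0}"

definition exp_degree :: "int^'n^'m \<Rightarrow> ('n::finite \<Rightarrow>\<^sub>0 nat) \<Rightarrow> int^'m"
  where "exp_degree A e = (\<Sum>j\<in>UNIV. int (Poly_Mapping.lookup e j) *s column j A)"

definition semigroup_NA :: "int^'n^'m \<Rightarrow> (int^'m) set"
  where "semigroup_NA A = {\<Sum>j\<in>UNIV. int (k j) *s column j A | k :: 'n::finite \<Rightarrow> nat. True}"

definition mpoly_grading :: "int^'n^'m \<Rightarrow> int^'m \<Rightarrow> ('n::finite, 'k::field) mpoly set"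
  where "mpoly_grading A d = {p. \<forall>e\<in>Poly_Mapping.keys p. exp_degree A e = d}"

text \<open>\<open>F\<close> is a minimal \<open>\<nat>A\<close>-graded free resolution of \<open>K[x]/I\<^sub>A\<close> over \<open>K[x]\<close>.\<close>

definition toric_minimal_resolution ::
    "int^'n^'m \<Rightarrow> (nat \<Rightarrow> (('n::finite, 'k::field) mpoly, 'a) module)
      \<Rightarrow> (nat \<Rightarrow> int^'m \<Rightarrow> 'a set) \<Rightarrow> (nat \<Rightarrow> 'a \<Rightarrow> 'a) \<Rightarrow> bool"
  where "toric_minimal_resolution A F Fg D \<longleftrightarrow>
    minimal_graded_free_resolution mpoly_ring irrelevant_ideal
      (semigroup_NA A) (mpoly_grading A) F Fg D
      (quotient_module mpoly_ring (toric_ideal A))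
      (\<lambda>d. (\<lambda>p. toric_ideal A +>\<^bsub>mpoly_ring\<^esub> p) ` mpoly_grading A d)"


section \<open>Gale transforms\<close>

definition kernel_rank :: "int^'n^'m \<Rightarrow> nat"
  where "kernel_rank A =
    CARD('n) - rank ((\<chi> k i. rat_of_int (A $ k $ i)) :: rat^'n^'m)"

text \<open>
  A lattice basis \<open>G 0, \<dots>, G (n - r - 1)\<close> of the integer kernel. The Gale vector
  of \<open>a\<^sub>i\<close> has \<open>j\<close>-th coordinate \<open>G j $ i\<close>.
\<close>

definition gale_basis :: "int^'n^'m \<Rightarrow> (nat \<Rightarrow> int^'n) \<Rightarrow> bool"
  where "gale_basis A G \<longleftrightarrow>
    (\<forall>j<kernel_rank A. G j \<in> integer_kernel A) \<and>
    (\<forall>u\<in>integer_kernel A. \<exists>!c :: nat \<Rightarrow> int.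
        (\<forall>j\<ge>kernel_rank A. c j = 0) \<and> u = (\<Sum>j<kernel_rank A. c j *s G j))"


section \<open>Bouquets\<close>

definition vsupport :: "int^'n \<Rightarrow> 'n set"
  where "vsupport w = {i. w $ i \<noteq> 0}"

definition covector :: "int^'n^'m \<Rightarrow> int^'n \<Rightarrow> bool"
  where "covector A w \<longleftrightarrow> (\<exists>v. w = v v* A)"

definition cocircuit :: "int^'n^'m \<Rightarrow> int^'n \<Rightarrow> bool"
  where "cocircuit A w \<longleftrightarrow> covector A w \<and> w \<noteq> 0 \<and>
    (\<forall>w'. covector A w' \<and> w' \<noteq> 0 \<longrightarrow> \<not> vsupport w' \<subset> vsupport w)"

definition free_index :: "int^'n^'m \<Rightarrow> 'n \<Rightarrow> bool"
  where "free_index A i \<longleftrightarrow> (\<exists>w. cocircuit A w \<and> vsupport w = {i})"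

definition no_free_bouquet :: "int^'n^'m \<Rightarrow> bool"
  where "no_free_bouquet A \<longleftrightarrow> (\<forall>i. \<not> free_index A i)"

definition bouquet_edge :: "int^'n^'m \<Rightarrow> 'n \<Rightarrow> 'n \<Rightarrow> bool"
  where "bouquet_edge A i j \<longleftrightarrow> i \<noteq> j \<and> (\<exists>w. covector A w \<and> vsupport w = {i, j})"

definition bouquet_edge_plus :: "int^'n^'m \<Rightarrow> 'n \<Rightarrow> 'n \<Rightarrow> bool"
  where "bouquet_edge_plus A i j \<longleftrightarrow> i \<noteq> j \<and>
    (\<exists>w. covector A w \<and> vsupport w = {i, j} \<and> sgn (w $ i) \<noteq> sgn (w $ j))"

definition bouquets :: "int^'n^'m \<Rightarrow> 'n set set"
  where "bouquets A = UNIV // {(i, j). bouquet_edge A i j}\<^sup>*"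

definition non_mixed :: "int^'n^'m \<Rightarrow> 'n set \<Rightarrow> bool"
  where "non_mixed A C \<longleftrightarrow>
    (\<exists>i. C = {i}) \<or> (\<forall>i\<in>C. \<forall>j\<in>C. bouquet_edge A i j \<longrightarrow> bouquet_edge_plus A i j)"

definition stable_toric :: "int^'n^'m \<Rightarrow> bool"
  where "stable_toric A \<longleftrightarrow> (\<forall>C\<in>bouquets A. non_mixed A C)"

definition bouquet_cvec ::
    "int^('n::{finite,linorder})^'m \<Rightarrow> (nat \<Rightarrow> int^('n::{finite,linorder})) \<Rightarrow> 'n set \<Rightarrow> int^('n::{finite,linorder})"
  where "bouquet_cvec A G C =
    (let j = (SOME j. j < kernel_rank A \<and> (\<forall>i\<in>C. G j $ i \<noteq> 0)) in
     \<chi> i. if i \<in> C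
         then sgn (G j $ Min C) * G j $ i div (GCD i\<in>C. G j $ i) else 0)"

definition bouquet_avec ::
    "int^('n::{finite,linorder})^'m \<Rightarrow> (nat \<Rightarrow> int^('n::{finite,linorder})) \<Rightarrow> 'n set \<Rightarrow> int^'m"
  where "bouquet_avec A G C = (\<Sum>i\<in>UNIV. (bouquet_cvec A G C $ i) *s column i A)"

text \<open>In the following, \<open>B\<close> enumerates the bouquets of \<open>A\<close> by the finite type \<open>'s\<close>.\<close>

definition bouquet_matrix ::
    "int^('n::{finite,linorder})^'m \<Rightarrow> (nat \<Rightarrow> int^('n::{finite,linorder})) \<Rightarrow> ('s \<Rightarrow> 'n set) \<Rightarrow> int^'s^'m"
  where "bouquet_matrix A G B = (\<chi> k b. bouquet_avec A G (B b) $ k)"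

definition bouquet_hom ::
    "int^('n::{finite,linorder})^'m \<Rightarrow> (nat \<Rightarrow> int^('n::{finite,linorder})) \<Rightarrow> ('s \<Rightarrow> 'n set)
      \<Rightarrow> ('s, 'k::field) mpoly \<Rightarrow> ('n, 'k) mpoly"
  where "bouquet_hom A G B = substitution (\<lambda>b. monomial (pos_part (bouquet_cvec A G (B b))))"

end

theory Submission
  imports Defs
begin

text \<open>
  Why the theorem is true. Write \<open>R = K[y]\<close> and \<open>S = K[x]\<close>. Since no column is free and all
  bouquets are non-mixed, each vector in the integer kernel of \<open>A\<close> restricts on a bouquet \<open>b\<close> to an
  integer multiple of \<open>c\<^sub>b\<close>, and the entries of \<open>c\<^sub>b\<close> on \<open>b\<close> are positive (\<open>bouquet_cvec\<close>).
  So there are a surjection \<open>\<beta>\<close> from the columns to the bouquets and positive weights \<open>w\<close> such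
  that \<open>\<phi>\<close> sends the monomial with exponent \<open>e\<close> to the monomial with exponent
  \<open>i \<mapsto> e (\<beta> i) * w i\<close>, and such that the same recipe maps the kernel of \<open>A\<^sub>B\<close> onto the
  kernel of \<open>A\<close>. Everything else uses only \<open>\<beta>\<close> and \<open>w\<close>.

  \<^item> \<open>S\<close> is free over \<open>R\<close>. Dividing exponents with remainder, bouquet by bouquet, writes each
    monomial of \<open>S\<close> uniquely as \<open>\<phi> y\<^sup>q * x\<^sup>r\<close> with \<open>r\<close> reduced: for each \<open>b\<close> some
    \<open>i\<close> with \<open>\<beta> i = b\<close> has \<open>r i < w i\<close> (\<open>dual_basis_pullback\<close>). Taking the coefficient of
    \<open>x\<^sup>r\<close> gives \<open>R\<close>-linear maps from \<open>S\<close> to \<open>R\<close>, hence natural maps from \<open>M \<otimes> S\<close> to \<open>M\<close>,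
    and these reduce the exactness of a tensored sequence to the exactness of the original one
    (\<open>tensor_exact\<close>).

  \<^item> The binomials of \<open>I\<^sub>A\<close> are the images of those of the toric ideal of \<open>A\<^sub>B\<close>, because the kernels
    correspond and the exponents \<open>c\<^sub>b\<close> are nonnegative with disjoint supports
    (\<open>toric_ideal_pullback\<close>). Hence \<open>(R / I) \<otimes> S\<close> is \<open>S / I\<^sub>A\<close> for the toric ideal \<open>I\<close> of
    \<open>A\<^sub>B\<close> (\<open>quotient_base_change\<close>), so the tensored complex still resolves the right module.

  \<^item> A homogeneous basis \<open>E\<close> of a free module yields the basis of all \<open>e \<otimes> 1\<close> (\<open>tensor_basis\<close>).
    As \<open>\<phi>\<close> preserves degrees, coordinates with respect to it show that the decomposition into
    homogeneous components is unique (\<open>graded_free_module_tensor\<close>).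

  \<^item> Minimality passes to the tensored complex since \<open>\<phi>\<close> maps each variable to a nonconstant
    monomial (\<open>pullback_irrelevant_ideal\<close>, \<open>tmap_ideal_times\<close>).
\<close>

section \<open>Additive and linear maps\<close>

definition linear_map :: "'r ring \<Rightarrow> ('r, 'a) module \<Rightarrow> ('r, 'b) module \<Rightarrow> ('a \<Rightarrow> 'b) \<Rightarrow> bool"
  where "linear_map R M N f \<longleftrightarrow> f \<in> carrier M \<rightarrow> carrier N \<and>
    (\<forall>x\<in>carrier M. \<forall>y\<in>carrier M. f (x \<oplus>\<^bsub>M\<^esub> y) = f x \<oplus>\<^bsub>N\<^esub> f y) \<and>
    (\<forall>a\<in>carrier R. \<forall>x\<in>carrier M. f (a \<odot>\<^bsub>M\<^esub> x) = a \<odot>\<^bsub>N\<^esub> f x)"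

lemma additive_zero:
  assumes G: "abelian_group G" and H: "abelian_group H"
    and h: "h \<in> carrier G \<rightarrow> carrier H"
    and add: "\<And>x y. x \<in> carrier G \<Longrightarrow> y \<in> carrier G \<Longrightarrow> h (x \<oplus>\<^bsub>G\<^esub> y) = h x \<oplus>\<^bsub>H\<^esub> h y"
  shows "h \<zero>\<^bsub>G\<^esub> = \<zero>\<^bsub>H\<^esub>"
proof -
  interpret G: abelian_group G by fact
  interpret H: abelian_group H by fact
  have "h \<zero>\<^bsub>G\<^esub> \<in> carrier H" using h by auto
  then show ?thesis using add[of "\<zero>\<^bsub>G\<^esub>" "\<zero>\<^bsub>G\<^esub>"] by (simp add: H.add.l_cancel_one')
qed

lemma additive_finsum:
  assumes G: "abelian_group G" and H: "abelian_group H"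
    and h: "h \<in> carrier G \<rightarrow> carrier H"
    and add: "\<And>x y. x \<in> carrier G \<Longrightarrow> y \<in> carrier G \<Longrightarrow> h (x \<oplus>\<^bsub>G\<^esub> y) = h x \<oplus>\<^bsub>H\<^esub> h y"
    and f: "f \<in> J \<rightarrow> carrier G"
  shows "h (\<Oplus>\<^bsub>G\<^esub>j\<in>J. f j) = (\<Oplus>\<^bsub>H\<^esub>j\<in>J. h (f j))"
proof -
  interpret G: abelian_group G by fact
  interpret H: abelian_group H by fact
  have hc: "h x \<in> carrier H" if "x \<in> carrier G" for x using h that by auto
  show ?thesis
    using f
  proof (induction J rule: infinite_finite_induct)
    case (insert j J)
    then have "f j \<in> carrier G" "f \<in> J \<rightarrow> carrier G" by auto
    then show ?case using insert by (simp add: add hc Pi_def)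
  qed (simp_all add: additive_zero[OF G H h add])
qed

lemma linear_map_zero:
  assumes "Module.module R M" "Module.module R N" "linear_map R M N f"
  shows "f \<zero>\<^bsub>M\<^esub> = \<zero>\<^bsub>N\<^esub>"
  using assms by (intro additive_zero[of M N]) (simp_all add: linear_map_def Module.module_def)

section \<open>The universal property of the tensor product\<close>

definition pure_tensor ::
    "'r ring \<Rightarrow> 's ring \<Rightarrow> ('r \<Rightarrow> 's) \<Rightarrow> ('r, 'a) module \<Rightarrow> 'a \<Rightarrow> 's \<Rightarrow> ('a \<times> 's \<Rightarrow>\<^sub>0 int) set"
  where "pure_tensor R S \<phi> M x s = tensor_class R S \<phi> M (frag_of (x, s))"

locale tensor_product = Module.module R M + S: cring S
  for R :: "'r ring" and M :: "('r, 'a) module" and S :: "'s ring" +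
  fixes \<phi> :: "'r \<Rightarrow> 's"
  assumes hom: "\<phi> \<in> ring_hom R S"
begin

abbreviation "free \<equiv> free_Abelian_group (carrier M \<times> carrier S)"
abbreviation "rel \<equiv> tensor_relations R S \<phi> M"
abbreviation "cls \<equiv> tensor_class R S \<phi> M"
abbreviation "T \<equiv> tensor_module R S \<phi> M"
abbreviation "pure \<equiv> pure_tensor R S \<phi> M"

lemma \<phi>_closed [simp, intro]: "r \<in> carrier R \<Longrightarrow> \<phi> r \<in> carrier S"
  using hom by (simp add: ring_hom_closed)

lemma keys_diff_closed: "Poly_Mapping.keys a \<subseteq> X \<Longrightarrow> Poly_Mapping.keys b \<subseteq> X \<Longrightarrow> Poly_Mapping.keys (a - b) \<subseteq> X"
  using keys_diff[of a b] by blast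

lemma keys_add_closed: "Poly_Mapping.keys a \<subseteq> X \<Longrightarrow> Poly_Mapping.keys b \<subseteq> X \<Longrightarrow> Poly_Mapping.keys (a + b) \<subseteq> X"
  using keys_add[of a b] by blast

lemma rel_subgroup: "subgroup rel free"
  unfolding tensor_relations_def
proof (rule group.generate_is_subgroup, simp, rule subsetI, elim UnE CollectE exE conjE)
qed (simp_all add: keys_diff_closed)

lemma rel_normal: "rel \<lhd> free"
  using comm_group.normal_iff_subgroup[OF abelian_free_Abelian_group] rel_subgroup by blast

lemma rel_minimal:
  assumes "subgroup H free"
    and "\<And>x y s. x \<in> carrier M \<Longrightarrow> y \<in> carrier M \<Longrightarrow> s \<in> carrier S \<Longrightarrow>
          frag_of (x \<oplus>\<^bsub>M\<^esub> y, s) - frag_of (x, s) - frag_of (y, s) \<in> H"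
    and "\<And>x s t. x \<in> carrier M \<Longrightarrow> s \<in> carrier S \<Longrightarrow> t \<in> carrier S \<Longrightarrow>
          frag_of (x, s \<oplus>\<^bsub>S\<^esub> t) - frag_of (x, s) - frag_of (x, t) \<in> H"
    and "\<And>r x s. r \<in> carrier R \<Longrightarrow> x \<in> carrier M \<Longrightarrow> s \<in> carrier S \<Longrightarrow>
          frag_of (r \<odot>\<^bsub>M\<^esub> x, s) - frag_of (x, \<phi> r \<otimes>\<^bsub>S\<^esub> s) \<in> H"
  shows "rel \<subseteq> H"
  unfolding tensor_relations_def
  by (rule group.generate_subgroup_incl) (use assms in auto)

lemma rel_incl:
  shows "x \<in> carrier M \<Longrightarrow> y \<in> carrier M \<Longrightarrow> s \<in> carrier S \<Longrightarrow>
          frag_of (x \<oplus>\<^bsub>M\<^esub> y, s) - frag_of (x, s) - frag_of (y, s) \<in> rel"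
    and "x \<in> carrier M \<Longrightarrow> s \<in> carrier S \<Longrightarrow> t \<in> carrier S \<Longrightarrow>
          frag_of (x, s \<oplus>\<^bsub>S\<^esub> t) - frag_of (x, s) - frag_of (x, t) \<in> rel"
    and "r \<in> carrier R \<Longrightarrow> x \<in> carrier M \<Longrightarrow> s \<in> carrier S \<Longrightarrow>
          frag_of (r \<odot>\<^bsub>M\<^esub> x, s) - frag_of (x, \<phi> r \<otimes>\<^bsub>S\<^esub> s) \<in> rel"
  unfolding tensor_relations_def by (blast intro: generate.incl)+

lemma rel_carrier: "n \<in> rel \<Longrightarrow> n \<in> carrier free"
  using rel_subgroup subgroup.subset by blast

lemma rel_uminus: "n \<in> rel \<Longrightarrow> - n \<in> rel"
  using subgroup.m_inv_closed[OF rel_subgroup, of n] rel_carrier[of n] by simp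

lemma cls_eqI:
  assumes "z - z' \<in> rel"
  shows "cls z = cls z'"
proof -
  have sub: "cls a \<subseteq> cls b" if "a - b \<in> rel" for a b
  proof
    fix c assume "c \<in> cls a"
    then obtain n where n: "n \<in> rel" "c = n + a" by (auto simp: tensor_class_def r_coset_def)
    have "n + (a - b) \<in> rel"
      using subgroup.m_closed[OF rel_subgroup n(1) that] by simp
    moreover have "c = (n + (a - b)) + b" by (simp add: n(2))
    ultimately show "c \<in> cls b" unfolding tensor_class_def r_coset_def mult_free_Abelian_group by blast
  qed
  have "z' - z \<in> rel" using rel_uminus[OF assms] by simp
  then show ?thesis using sub assms by blast
qed

text \<open>The operations on the tensor module are unions over all representatives of a class; such a
  union collapses as soon as its terms do not depend on the representative.\<close>

lemma cls_cong_UN: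
  assumes "\<And>n. n \<in> rel \<Longrightarrow> C (n + z) = C z"
  shows "(\<Union>z'\<in>cls z. C z') = C z"
proof -
  have "0 \<in> rel" using subgroup.one_closed[OF rel_subgroup] by simp
  then have "z \<in> cls z" by (force simp: tensor_class_def r_coset_def)
  then show ?thesis using assms by (auto simp: tensor_class_def r_coset_def)
qed

text \<open>The additive monoid of a module record keeps the scalar multiplication as an extra field, so it is
  not literally the quotient group; the group structures are compared selector by selector.\<close>

lemma carrier_add_monoid_T: "carrier (add_monoid T) = carrier (free Mod rel)"
  and mult_add_monoid_T: "mult (add_monoid T) = mult (free Mod rel)"
  and one_add_monoid_T: "one (add_monoid T) = one (free Mod rel)"
  by (simp_all add: tensor_module_def Let_def)

lemma hom_T: "hom (add_monoid T) G = hom (free Mod rel) G"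
  unfolding hom_def carrier_add_monoid_T mult_add_monoid_T ..

lemma comm_group_T: "comm_group (add_monoid T)"
  using comm_group.abelian_FactGroup[OF abelian_free_Abelian_group rel_subgroup]
  unfolding comm_group_def group_def group_axioms_def comm_monoid_def comm_monoid_axioms_def
    Group.monoid_def Units_def carrier_add_monoid_T mult_add_monoid_T one_add_monoid_T .

lemma abelian_group_T: "abelian_group T"
  by (rule comm_group_abelian_groupI[OF comm_group_T])

sublocale T: abelian_group T
  by (rule abelian_group_T)

lemma carrier_T: "carrier T = cls ` carrier free"
  by (simp add: tensor_module_def Let_def carrier_FactGroup tensor_class_def)

lemma cls_closed: "z \<in> carrier free \<Longrightarrow> cls z \<in> carrier T"
  by (simp add: carrier_T)

lemma cls_add: "z \<in> carrier free \<Longrightarrow> z' \<in> carrier free \<Longrightarrow> cls (z + z') = cls z \<oplus>\<^bsub>T\<^esub> cls z'"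
  using normal.rcos_sum[OF rel_normal, of z z']
  by (simp add: tensor_module_def Let_def tensor_class_def FactGroup_def)

lemma cls_minus:
  assumes "z \<in> carrier free" "z' \<in> carrier free"
  shows "cls (z - z') = cls z \<ominus>\<^bsub>T\<^esub> cls z'"
proof -
  have d: "z - z' \<in> carrier free" using assms by (simp add: keys_diff_closed)
  have "cls z = cls (z - z') \<oplus>\<^bsub>T\<^esub> cls z'"
    using cls_add[OF d assms(2)] by simp
  then show ?thesis
    using cls_closed[OF d] cls_closed[OF assms(2)]
    by (simp add: T.minus_eq T.a_assoc T.r_neg)
qed

lemma cls_0: "cls 0 = \<zero>\<^bsub>T\<^esub>"
  using cls_minus[of 0 0] cls_closed[of 0] by (simp add: T.r_neg T.minus_eq)

lemma pure_closed [simp, intro]: "x \<in> carrier M \<Longrightarrow> s \<in> carrier S \<Longrightarrow> pure x s \<in> carrier T"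
  by (simp add: pure_tensor_def cls_closed)

lemma pure_add_left:
  assumes "x \<in> carrier M" "y \<in> carrier M" "s \<in> carrier S"
  shows "pure (x \<oplus>\<^bsub>M\<^esub> y) s = pure x s \<oplus>\<^bsub>T\<^esub> pure y s"
proof -
  have "pure (x \<oplus>\<^bsub>M\<^esub> y) s = cls (frag_of (x, s) + frag_of (y, s))"
    unfolding pure_tensor_def using rel_incl(1)[OF assms] by (intro cls_eqI) (simp add: diff_diff_eq)
  then show ?thesis using assms by (simp add: cls_add pure_tensor_def)
qed

lemma pure_add_right:
  assumes "x \<in> carrier M" "s \<in> carrier S" "t \<in> carrier S"
  shows "pure x (s \<oplus>\<^bsub>S\<^esub> t) = pure x s \<oplus>\<^bsub>T\<^esub> pure x t"
proof -
  have "pure x (s \<oplus>\<^bsub>S\<^esub> t) = cls (frag_of (x, s) + frag_of (x, t))"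
    unfolding pure_tensor_def using rel_incl(2)[OF assms] by (intro cls_eqI) (simp add: diff_diff_eq)
  then show ?thesis using assms by (simp add: cls_add pure_tensor_def)
qed

lemma pure_smult:
  assumes "r \<in> carrier R" "x \<in> carrier M" "s \<in> carrier S"
  shows "pure (r \<odot>\<^bsub>M\<^esub> x) s = pure x (\<phi> r \<otimes>\<^bsub>S\<^esub> s)"
  unfolding pure_tensor_def using rel_incl(3)[OF assms] by (rule cls_eqI)

lemma pure_zero_left [simp]:
  assumes "s \<in> carrier S"
  shows "pure \<zero>\<^bsub>M\<^esub> s = \<zero>\<^bsub>T\<^esub>"
  using pure_add_left[of "\<zero>\<^bsub>M\<^esub>" "\<zero>\<^bsub>M\<^esub>" s] assms by (simp add: T.add.l_cancel_one')

lemma pure_zero_right [simp]: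
  assumes "x \<in> carrier M"
  shows "pure x \<zero>\<^bsub>S\<^esub> = \<zero>\<^bsub>T\<^esub>"
  using pure_add_right[of x "\<zero>\<^bsub>S\<^esub>" "\<zero>\<^bsub>S\<^esub>"] assms by (simp add: T.add.l_cancel_one')

lemma pure_uminus:
  assumes "x \<in> carrier M" "s \<in> carrier S"
  shows "\<ominus>\<^bsub>T\<^esub> pure x s = pure x (\<ominus>\<^bsub>S\<^esub> s)"
  using pure_add_right[of x "\<ominus>\<^bsub>S\<^esub> s" s] assms by (intro T.minus_equality) (simp_all add: S.l_neg)

text \<open>A formal integer combination of pairs is a difference of sums of pairs, and
  \<open>- (x \<otimes> s) = x \<otimes> (- s)\<close>. So sums of pure tensors already exhaust the tensor product, and
  additive statements need to be checked on pure tensors only.\<close>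

lemma tensor_induct [consumes 1, case_names pure add]:
  assumes "z \<in> carrier T"
    and pure: "\<And>x s. x \<in> carrier M \<Longrightarrow> s \<in> carrier S \<Longrightarrow> P (pure x s)"
    and add: "\<And>a b. a \<in> carrier T \<Longrightarrow> b \<in> carrier T \<Longrightarrow> P a \<Longrightarrow> P b \<Longrightarrow> P (a \<oplus>\<^bsub>T\<^esub> b)"
  shows "P z"
proof -
  obtain c where c: "Poly_Mapping.keys c \<subseteq> carrier M \<times> carrier S" "z = cls c"
    using assms(1) by (auto simp: carrier_T)
  have "P (cls c) \<and> P (\<ominus>\<^bsub>T\<^esub> cls c)"
  proof (rule free_Abelian_group_induct[OF c(1)])
    have [simp]: "\<ominus>\<^bsub>T\<^esub> \<zero>\<^bsub>T\<^esub> = \<zero>\<^bsub>T\<^esub>" by (rule T.minus_equality) simp_all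
    show "P (cls 0) \<and> P (\<ominus>\<^bsub>T\<^esub> cls 0)" using pure[of "\<zero>\<^bsub>M\<^esub>" "\<zero>\<^bsub>S\<^esub>"] by (simp add: cls_0)
  next
    fix x y
    assume xy: "Poly_Mapping.keys x \<subseteq> carrier M \<times> carrier S" "Poly_Mapping.keys y \<subseteq> carrier M \<times> carrier S"
      "P (cls x) \<and> P (\<ominus>\<^bsub>T\<^esub> cls x)" "P (cls y) \<and> P (\<ominus>\<^bsub>T\<^esub> cls y)"
    have [simp]: "cls x \<in> carrier T" "cls y \<in> carrier T" using xy by (simp_all add: cls_closed)
    have "P (cls x \<oplus>\<^bsub>T\<^esub> \<ominus>\<^bsub>T\<^esub> cls y)" "P (\<ominus>\<^bsub>T\<^esub> cls x \<oplus>\<^bsub>T\<^esub> cls y)"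
      using xy by (auto intro!: add)
    then show "P (cls (x - y)) \<and> P (\<ominus>\<^bsub>T\<^esub> cls (x - y))"
      using xy by (simp add: cls_minus T.minus_eq T.minus_add)
  next
    fix a assume "a \<in> carrier M \<times> carrier S"
    then obtain x s where a: "a = (x, s)" "x \<in> carrier M" "s \<in> carrier S" by auto
    have "cls (frag_of a) = pure x s" by (simp add: pure_tensor_def a)
    then show "P (cls (frag_of a)) \<and> P (\<ominus>\<^bsub>T\<^esub> cls (frag_of a))"
      using pure a by (simp add: pure_uminus)
  qed
  then show ?thesis using c by simp
qed

text \<open>The universal property. A biadditive balanced map extends to the free abelian group, and the
  extension kills the relations.\<close>

lemma tensor_lift:
  assumes G: "comm_group G"
    and f: "\<And>x s. x \<in> carrier M \<Longrightarrow> s \<in> carrier S \<Longrightarrow> f x s \<in> carrier G"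
    and fl: "\<And>x y s. x \<in> carrier M \<Longrightarrow> y \<in> carrier M \<Longrightarrow> s \<in> carrier S \<Longrightarrow> f (x \<oplus>\<^bsub>M\<^esub> y) s = f x s \<otimes>\<^bsub>G\<^esub> f y s"
    and fr: "\<And>x s t. x \<in> carrier M \<Longrightarrow> s \<in> carrier S \<Longrightarrow> t \<in> carrier S \<Longrightarrow> f x (s \<oplus>\<^bsub>S\<^esub> t) = f x s \<otimes>\<^bsub>G\<^esub> f x t"
    and fb: "\<And>r x s. r \<in> carrier R \<Longrightarrow> x \<in> carrier M \<Longrightarrow> s \<in> carrier S \<Longrightarrow> f (r \<odot>\<^bsub>M\<^esub> x) s = f x (\<phi> r \<otimes>\<^bsub>S\<^esub> s)"
  obtains h where "h \<in> hom (add_monoid T) G"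
    and "\<And>x s. x \<in> carrier M \<Longrightarrow> s \<in> carrier S \<Longrightarrow> h (pure x s) = f x s"
proof -
  interpret G: comm_group G by fact
  obtain k where k: "k \<in> hom free G"
    and k': "\<And>x. x \<in> carrier M \<times> carrier S \<Longrightarrow> k (frag_of x) = case_prod f x"
    using G.free_Abelian_group_universal[of "case_prod f" "carrier M \<times> carrier S"] f by (metis (no_types, lifting) SigmaE image_subsetI case_prod_conv)
  interpret k: group_hom free G k
    by (simp add: group_hom_def group_hom_axioms_def k G.is_group)
  have sub: "subgroup (kernel free G k) free" by (rule k.subgroup_kernel)
  have kd: "k (a - b) = k a \<otimes>\<^bsub>G\<^esub> inv\<^bsub>G\<^esub> k b" if "a \<in> carrier free" "b \<in> carrier free" for a b
    using k.hom_mult[OF that(1) k.G.inv_closed[OF that(2)]] k.hom_inv[OF that(2)] that by simp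
  have kernelI: "a - b - c \<in> kernel free G k"
    if "a \<in> carrier free" "b \<in> carrier free" "c \<in> carrier free" "k a = k b \<otimes>\<^bsub>G\<^esub> k c" for a b c
  proof -
    have d: "a - b \<in> carrier free" using that by (simp add: keys_diff_closed)
    have "k b \<in> carrier G" "k c \<in> carrier G" using that k.hom_closed by blast+
    then have "k b \<otimes>\<^bsub>G\<^esub> k c \<otimes>\<^bsub>G\<^esub> inv\<^bsub>G\<^esub> k b \<otimes>\<^bsub>G\<^esub> inv\<^bsub>G\<^esub> k c = \<one>\<^bsub>G\<^esub>"
      by (simp add: G.m_comm[of "k b" "k c"] G.m_assoc G.r_inv)
    then show ?thesis using that d by (simp add: kernel_def kd keys_diff_closed)
  qed
  have "rel \<subseteq> kernel free G k"
  proof (rule rel_minimal[OF sub])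
    show "frag_of (r \<odot>\<^bsub>M\<^esub> x, s) - frag_of (x, \<phi> r \<otimes>\<^bsub>S\<^esub> s) \<in> kernel free G k"
      if "r \<in> carrier R" "x \<in> carrier M" "s \<in> carrier S" for r x s
      using that by (simp add: kernel_def kd k' keys_diff_closed fb f G.r_inv)
  qed (auto intro!: kernelI simp: k' fl fr)
  then obtain g where "g \<in> hom (free Mod rel) G" "\<And>x. x \<in> carrier free \<Longrightarrow> g (rel #>\<^bsub>free\<^esub> x) = k x"
    using k.FactGroup_universal_kernel[OF rel_normal] by blast
  then show ?thesis
    by (intro that[of g]) (simp_all add: hom_T pure_tensor_def tensor_class_def k')
qed

end

text \<open>One computation serves both operations that are defined on representatives: multiplication by a
  scalar (\<open>f\<close> the identity, \<open>k\<close> the multiplication) and the map induced by a homomorphism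
  (\<open>k\<close> the identity).\<close>

lemma induced_class:
  assumes M: "tensor_product R M S \<phi>" and N: "tensor_product R N S \<phi>"
    and f: "linear_map R M N f"
    and k: "k \<in> carrier S \<rightarrow> carrier S"
    and k_add: "\<And>s t. s \<in> carrier S \<Longrightarrow> t \<in> carrier S \<Longrightarrow> k (s \<oplus>\<^bsub>S\<^esub> t) = k s \<oplus>\<^bsub>S\<^esub> k t"
    and k_hom: "\<And>r s. r \<in> carrier R \<Longrightarrow> s \<in> carrier S \<Longrightarrow> k (\<phi> r \<otimes>\<^bsub>S\<^esub> s) = \<phi> r \<otimes>\<^bsub>S\<^esub> k s"
    and z: "z \<in> carrier (free_Abelian_group (carrier M \<times> carrier S))"
  defines "h \<equiv> frag_extend (\<lambda>(x, t). frag_of (f x, k t))"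
  shows "(\<Union>z'\<in>tensor_class R S \<phi> M z. tensor_class R S \<phi> N (h z')) = tensor_class R S \<phi> N (h z)"
    and "h z \<in> carrier (free_Abelian_group (carrier N \<times> carrier S))"
proof -
  interpret M: tensor_product R M S \<phi> by fact
  interpret N: tensor_product R N S \<phi> by fact
  have fc: "f x \<in> carrier N" if "x \<in> carrier M" for x using f that by (auto simp: linear_map_def)
  have kc: "k s \<in> carrier S" if "s \<in> carrier S" for s using k that by auto
  have h_of: "h (frag_of (x, s)) = frag_of (f x, k s)" for x s by (simp add: h_def)
  have h_diff: "h (a - b) = h a - h b" for a b by (simp add: h_def frag_extend_diff)
  have h_add: "h (a + b) = h a + h b" for a b by (simp add: h_def frag_extend_add)
  have h_closed: "h c \<in> carrier N.free" if "c \<in> carrier M.free" for c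
    using that unfolding carrier_free_Abelian_group_iff h_def
    by (intro order_trans[OF keys_frag_extend]) (auto simp: fc kc)
  show "h z \<in> carrier N.free" using z by (rule h_closed)
  have "M.rel \<subseteq> {c \<in> carrier M.free. h c \<in> N.rel}"
  proof (rule M.rel_minimal)
    show "subgroup {c \<in> carrier M.free. h c \<in> N.rel} M.free"
    proof (rule group.subgroupI)
      show "inv\<^bsub>M.free\<^esub> a \<in> {c \<in> carrier M.free. h c \<in> N.rel}" if "a \<in> {c \<in> carrier M.free. h c \<in> N.rel}" for a
        using that N.rel_uminus h_diff[of 0 a] by (simp add: h_def)
      show "a \<otimes>\<^bsub>M.free\<^esub> b \<in> {c \<in> carrier M.free. h c \<in> N.rel}"
        if "a \<in> {c \<in> carrier M.free. h c \<in> N.rel}" "b \<in> {c \<in> carrier M.free. h c \<in> N.rel}" for a b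
        using that subgroup.m_closed[OF N.rel_subgroup, of "h a" "h b"] by (simp add: h_add M.keys_add_closed)
      have "0 \<in> N.rel" using subgroup.one_closed[OF N.rel_subgroup] by simp
      then show "{c \<in> carrier M.free. h c \<in> N.rel} \<noteq> {}" using h_diff[of 0 0] by (auto intro!: exI[of _ 0])
    qed auto
  qed (use f in \<open>simp_all add: linear_map_def M.keys_diff_closed h_of h_diff k_add k_hom fc kc N.rel_incl\<close>)
  then have "h n \<in> N.rel" if "n \<in> M.rel" for n using that by blast
  then show "(\<Union>z'\<in>M.cls z. N.cls (h z')) = N.cls (h z)"
    by (intro M.cls_cong_UN N.cls_eqI) (simp add: h_add)
qed

lemma linear_map_id: "linear_map R M M (\<lambda>x. x)"
  by (simp add: linear_map_def)

context tensor_product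
begin

lemma smult_cls:
  assumes "s \<in> carrier S" "z \<in> carrier free"
  shows "s \<odot>\<^bsub>T\<^esub> cls z = cls (frag_extend (\<lambda>(x, t). frag_of (x, s \<otimes>\<^bsub>S\<^esub> t)) z)"
    and "frag_extend (\<lambda>(x, t). frag_of (x, s \<otimes>\<^bsub>S\<^esub> t)) z \<in> carrier free"
  using induced_class[OF tensor_product_axioms tensor_product_axioms linear_map_id, of "\<lambda>t. s \<otimes>\<^bsub>S\<^esub> t" z] assms
  by (simp_all add: tensor_module_def Let_def S.r_distr S.m_lcomm)

lemma smult_pure:
  assumes "s \<in> carrier S" "x \<in> carrier M" "t \<in> carrier S"
  shows "s \<odot>\<^bsub>T\<^esub> pure x t = pure x (s \<otimes>\<^bsub>S\<^esub> t)"
  using smult_cls(1)[of s "frag_of (x, t)"] assms by (simp add: pure_tensor_def)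

lemma module_T: "Module.module S T"
proof -
  have closed: "s \<odot>\<^bsub>T\<^esub> z \<in> carrier T" if "s \<in> carrier S" "z \<in> carrier T" for s z
    using that smult_cls[of s] by (auto simp: carrier_T)
  have r_distr: "s \<odot>\<^bsub>T\<^esub> (a \<oplus>\<^bsub>T\<^esub> b) = s \<odot>\<^bsub>T\<^esub> a \<oplus>\<^bsub>T\<^esub> s \<odot>\<^bsub>T\<^esub> b"
    if s: "s \<in> carrier S" and ab: "a \<in> carrier T" "b \<in> carrier T" for s a b
  proof -
    obtain x y where xy: "x \<in> carrier free" "a = cls x" "y \<in> carrier free" "b = cls y"
      using ab by (auto simp: carrier_T)
    have "x + y \<in> carrier free" using xy by (simp add: keys_add_closed)
    note smult_cls(1)[OF s this]
    also have "cls (frag_extend (\<lambda>(x, t). frag_of (x, s \<otimes>\<^bsub>S\<^esub> t)) (x + y)) = s \<odot>\<^bsub>T\<^esub> cls x \<oplus>\<^bsub>T\<^esub> s \<odot>\<^bsub>T\<^esub> cls y"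
      using smult_cls[OF s] xy by (simp add: frag_extend_add cls_add)
    finally show ?thesis using xy cls_add by simp
  qed
  show ?thesis
  proof (rule moduleI)
    fix a b x assume ab: "a \<in> carrier S" "b \<in> carrier S" and x: "x \<in> carrier T"
    show "(a \<oplus>\<^bsub>S\<^esub> b) \<odot>\<^bsub>T\<^esub> x = a \<odot>\<^bsub>T\<^esub> x \<oplus>\<^bsub>T\<^esub> b \<odot>\<^bsub>T\<^esub> x"
      using x
    proof (induction x rule: tensor_induct)
      case (pure x s)
      then show ?case using ab by (simp add: smult_pure S.l_distr pure_add_right)
    next
      case (add u v)
      then show ?case using ab by (simp add: r_distr closed T.a_ac)
    qed
    show "(a \<otimes>\<^bsub>S\<^esub> b) \<odot>\<^bsub>T\<^esub> x = a \<odot>\<^bsub>T\<^esub> (b \<odot>\<^bsub>T\<^esub> x)"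
      using x
    proof (induction x rule: tensor_induct)
      case (pure x s)
      then show ?case using ab by (simp add: smult_pure S.m_assoc)
    next
      case (add u v)
      then show ?case using ab by (simp add: r_distr closed)
    qed
  next
    show "\<one>\<^bsub>S\<^esub> \<odot>\<^bsub>T\<^esub> x = x" if "x \<in> carrier T" for x
      using that by (induction x rule: tensor_induct) (simp_all add: smult_pure r_distr)
  qed (use closed r_distr T.abelian_group_axioms S.is_cring in auto)
qed

sublocale T: Module.module S T
  by (rule module_T)

end

locale tensor_linear_map = M: tensor_product R M S \<phi> + N: tensor_product R N S \<phi>
  for R :: "'r ring" and M :: "('r, 'a) module" and N :: "('r, 'b) module" and S :: "'s ring" and \<phi> +
  fixes f :: "'a \<Rightarrow> 'b"
  assumes linear: "linear_map R M N f"
begin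

abbreviation "tmap \<equiv> tensor_map R S \<phi> N f"

lemma f_closed [simp, intro]: "x \<in> carrier M \<Longrightarrow> f x \<in> carrier N"
  using linear by (auto simp: linear_map_def)

lemma tmap_cls:
  assumes "z \<in> carrier M.free"
  shows "tmap (M.cls z) = N.cls (frag_extend (\<lambda>(x, t). frag_of (f x, t)) z)"
    and "frag_extend (\<lambda>(x, t). frag_of (f x, t)) z \<in> carrier N.free"
  using induced_class[OF M.tensor_product_axioms N.tensor_product_axioms linear, of "\<lambda>t. t" z] assms
  by (simp_all add: tensor_map_def)

lemma tmap_pure:
  "x \<in> carrier M \<Longrightarrow> s \<in> carrier S \<Longrightarrow> tmap (M.pure x s) = N.pure (f x) s"
  using tmap_cls[of "frag_of (x, s)"] by (simp add: pure_tensor_def)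

lemma tmap_closed [simp, intro]: "z \<in> carrier M.T \<Longrightarrow> tmap z \<in> carrier N.T"
  using tmap_cls by (auto simp: M.carrier_T N.cls_closed)

lemma tmap_add:
  assumes "a \<in> carrier M.T" "b \<in> carrier M.T"
  shows "tmap (a \<oplus>\<^bsub>M.T\<^esub> b) = tmap a \<oplus>\<^bsub>N.T\<^esub> tmap b"
proof -
  obtain x y where xy: "x \<in> carrier M.free" "a = M.cls x" "y \<in> carrier M.free" "b = M.cls y"
    using assms by (auto simp: M.carrier_T)
  have "x + y \<in> carrier M.free" using xy by (simp add: M.keys_add_closed)
  then have "tmap (M.cls (x + y)) = tmap (M.cls x) \<oplus>\<^bsub>N.T\<^esub> tmap (M.cls y)"
    using tmap_cls xy by (simp add: frag_extend_add N.cls_add)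
  then show ?thesis using xy M.cls_add by simp
qed

lemma tmap_linear: "linear_map S M.T N.T tmap"
  unfolding linear_map_def
proof (intro conjI ballI)
  show "tmap (s \<odot>\<^bsub>M.T\<^esub> z) = s \<odot>\<^bsub>N.T\<^esub> tmap z" if s: "s \<in> carrier S" and "z \<in> carrier M.T" for s z
    using that(2)
  proof (induction z rule: M.tensor_induct)
    case (pure x t)
    then show ?case using s by (simp add: M.smult_pure N.smult_pure tmap_pure)
  next
    case (add a b)
    then show ?case using s by (simp add: M.T.smult_r_distr N.T.smult_r_distr tmap_add)
  qed
qed (use tmap_add in auto)

end

section \<open>Dual bases and flatness\<close>

text \<open>The data of the dual basis lemma for projective modules. Exactness of tensored sequences is read
  off from the coefficient maps \<open>co t\<close>, so freeness of \<open>S\<close> over \<open>R\<close> enters in this form.\<close>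

locale dual_basis = R: cring R + S: cring S
  for R :: "'r ring" and S :: "'s ring" +
  fixes \<phi> :: "'r \<Rightarrow> 's" and I :: "'t set" and b :: "'t \<Rightarrow> 's" and co :: "'t \<Rightarrow> 's \<Rightarrow> 'r"
  assumes hom: "\<phi> \<in> ring_hom R S"
    and b_closed: "t \<in> I \<Longrightarrow> b t \<in> carrier S"
    and co_closed: "t \<in> I \<Longrightarrow> s \<in> carrier S \<Longrightarrow> co t s \<in> carrier R"
    and co_add: "t \<in> I \<Longrightarrow> s \<in> carrier S \<Longrightarrow> s' \<in> carrier S \<Longrightarrow> co t (s \<oplus>\<^bsub>S\<^esub> s') = co t s \<oplus>\<^bsub>R\<^esub> co t s'"
    and co_hom: "t \<in> I \<Longrightarrow> r \<in> carrier R \<Longrightarrow> s \<in> carrier S \<Longrightarrow> co t (\<phi> r \<otimes>\<^bsub>S\<^esub> s) = r \<otimes>\<^bsub>R\<^esub> co t s"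
    and co_finite: "s \<in> carrier S \<Longrightarrow> finite {t \<in> I. co t s \<noteq> \<zero>\<^bsub>R\<^esub>}"
    and expansion: "s \<in> carrier S \<Longrightarrow> s = (\<Oplus>\<^bsub>S\<^esub>t\<in>{t \<in> I. co t s \<noteq> \<zero>\<^bsub>R\<^esub>}. \<phi> (co t s) \<otimes>\<^bsub>S\<^esub> b t)"
begin

lemma tensor_product: "Module.module R M \<Longrightarrow> tensor_product R M S \<phi>"
  by (simp add: tensor_product_def tensor_product_axioms_def hom S.is_cring)

text \<open>The maps \<open>x \<otimes> s \<mapsto> co t s \<odot> x\<close> from \<open>M \<otimes> S\<close> to \<open>M\<close>: they are well defined by the
  universal property because \<open>co t\<close> is \<open>R\<close>-linear.\<close>

lemma coefficient_maps:
  assumes "Module.module R M"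
  obtains \<kappa> where "\<And>t. t \<in> I \<Longrightarrow> \<kappa> t \<in> hom (add_monoid (tensor_module R S \<phi> M)) (add_monoid M)"
    and "\<And>t x s. t \<in> I \<Longrightarrow> x \<in> carrier M \<Longrightarrow> s \<in> carrier S \<Longrightarrow> \<kappa> t (pure_tensor R S \<phi> M x s) = co t s \<odot>\<^bsub>M\<^esub> x"
proof -
  interpret M: tensor_product R M S \<phi> using assms by (rule tensor_product)
  have "\<exists>h. h \<in> hom (add_monoid M.T) (add_monoid M) \<and>
      (\<forall>x\<in>carrier M. \<forall>s\<in>carrier S. h (M.pure x s) = co t s \<odot>\<^bsub>M\<^esub> x)" if t: "t \<in> I" for t
  proof (rule M.tensor_lift[of "add_monoid M" "\<lambda>x s. co t s \<odot>\<^bsub>M\<^esub> x"])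
    show "comm_group (add_monoid M)" by (rule M.a_comm_group)
    show "co t s \<odot>\<^bsub>M\<^esub> (r \<odot>\<^bsub>M\<^esub> x) = co t (\<phi> r \<otimes>\<^bsub>S\<^esub> s) \<odot>\<^bsub>M\<^esub> x"
      if "r \<in> carrier R" "x \<in> carrier M" "s \<in> carrier S" for r x s
      using that t by (simp add: co_hom co_closed M.smult_assoc1[symmetric] R.m_comm)
  qed (use t in \<open>auto simp: co_closed co_add M.smult_r_distr M.smult_l_distr\<close>)
  then obtain \<kappa> where "\<forall>t\<in>I. \<kappa> t \<in> hom (add_monoid M.T) (add_monoid M) \<and>
      (\<forall>x\<in>carrier M. \<forall>s\<in>carrier S. \<kappa> t (M.pure x s) = co t s \<odot>\<^bsub>M\<^esub> x)"
    by metis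
  then show ?thesis using that by blast
qed

text \<open>Induction over sums of pure tensors. The supports of the summands differ, so the induction runs
  over the stronger statement that the expansion holds for every sufficiently large finite index
  set.\<close>

lemma tensor_expansion:
  assumes M: "Module.module R M"
    and \<kappa>: "\<And>t. t \<in> I \<Longrightarrow> \<kappa> t \<in> hom (add_monoid (tensor_module R S \<phi> M)) (add_monoid M)"
    and \<kappa>_pure: "\<And>t x s. t \<in> I \<Longrightarrow> x \<in> carrier M \<Longrightarrow> s \<in> carrier S \<Longrightarrow> \<kappa> t (pure_tensor R S \<phi> M x s) = co t s \<odot>\<^bsub>M\<^esub> x"
    and z: "z \<in> carrier (tensor_module R S \<phi> M)"
  obtains J where "finite J" "J \<subseteq> I"
    and "z = (\<Oplus>\<^bsub>tensor_module R S \<phi> M\<^esub>t\<in>J. pure_tensor R S \<phi> M (\<kappa> t z) (b t))"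
proof -
  interpret M: tensor_product R M S \<phi> using M by (rule tensor_product)
  have \<kappa>_closed: "\<kappa> t z \<in> carrier M" if "t \<in> I" "z \<in> carrier M.T" for t z
    using \<kappa>[OF that(1)] that(2) by (auto simp: hom_def)
  have \<kappa>_add: "\<kappa> t (u \<oplus>\<^bsub>M.T\<^esub> v) = \<kappa> t u \<oplus>\<^bsub>M\<^esub> \<kappa> t v" if "t \<in> I" "u \<in> carrier M.T" "v \<in> carrier M.T" for t u v
    using \<kappa>[OF that(1)] that by (auto simp: hom_def)
  have "\<exists>J. finite J \<and> J \<subseteq> I \<and> (\<forall>J'. finite J' \<and> J \<subseteq> J' \<and> J' \<subseteq> I \<longrightarrow>
      z = (\<Oplus>\<^bsub>M.T\<^esub>t\<in>J'. M.pure (\<kappa> t z) (b t)))"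
    using z
  proof (induction z rule: M.tensor_induct)
    case (pure x s)
    show ?case
    proof (intro exI[of _ "{t \<in> I. co t s \<noteq> \<zero>\<^bsub>R\<^esub>}"] conjI allI impI)
      fix J' assume J': "finite J' \<and> {t \<in> I. co t s \<noteq> \<zero>\<^bsub>R\<^esub>} \<subseteq> J' \<and> J' \<subseteq> I"
      have zero: "\<phi> \<zero>\<^bsub>R\<^esub> = \<zero>\<^bsub>S\<^esub>"
        using hom by (rule ring_hom_zero) (simp_all add: R.ring_axioms S.ring_axioms)
      have s: "s = (\<Oplus>\<^bsub>S\<^esub>t\<in>J'. \<phi> (co t s) \<otimes>\<^bsub>S\<^esub> b t)"
        by (subst expansion[OF pure(2)], rule S.add.finprod_mono_neutral_cong_left) (use J' pure in \<open>auto simp: zero b_closed co_closed subset_iff\<close>)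
      have "M.pure x s = M.pure x (\<Oplus>\<^bsub>S\<^esub>t\<in>J'. \<phi> (co t s) \<otimes>\<^bsub>S\<^esub> b t)" using s by simp
      also have "\<dots> = (\<Oplus>\<^bsub>M.T\<^esub>t\<in>J'. M.pure x (\<phi> (co t s) \<otimes>\<^bsub>S\<^esub> b t))"
        by (rule additive_finsum[OF S.abelian_group_axioms M.abelian_group_T])
          (use J' pure in \<open>auto simp: M.pure_add_right b_closed co_closed subset_iff\<close>)
      also have "\<dots> = (\<Oplus>\<^bsub>M.T\<^esub>t\<in>J'. M.pure (\<kappa> t (M.pure x s)) (b t))"
        by (rule M.T.finsum_cong') (use J' pure in \<open>auto simp: \<kappa>_pure M.pure_smult b_closed co_closed subset_iff\<close>)
      finally show "M.pure x s = (\<Oplus>\<^bsub>M.T\<^esub>t\<in>J'. M.pure (\<kappa> t (M.pure x s)) (b t))" .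
    qed (use co_finite pure in auto)
  next
    case (add u v)
    from add(3) obtain J1 where J1: "finite J1" "J1 \<subseteq> I"
      "\<forall>J'. finite J' \<and> J1 \<subseteq> J' \<and> J' \<subseteq> I \<longrightarrow> u = (\<Oplus>\<^bsub>M.T\<^esub>t\<in>J'. M.pure (\<kappa> t u) (b t))"
      by (elim exE conjE)
    from add(4) obtain J2 where J2: "finite J2" "J2 \<subseteq> I"
      "\<forall>J'. finite J' \<and> J2 \<subseteq> J' \<and> J' \<subseteq> I \<longrightarrow> v = (\<Oplus>\<^bsub>M.T\<^esub>t\<in>J'. M.pure (\<kappa> t v) (b t))"
      by (elim exE conjE)
    show ?case
    proof (intro exI[of _ "J1 \<union> J2"] conjI allI impI)
      fix J' assume J': "finite J' \<and> J1 \<union> J2 \<subseteq> J' \<and> J' \<subseteq> I"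
      have "u \<oplus>\<^bsub>M.T\<^esub> v = (\<Oplus>\<^bsub>M.T\<^esub>t\<in>J'. M.pure (\<kappa> t u) (b t)) \<oplus>\<^bsub>M.T\<^esub> (\<Oplus>\<^bsub>M.T\<^esub>t\<in>J'. M.pure (\<kappa> t v) (b t))"
        using J1(3)[rule_format, of J'] J2(3)[rule_format, of J'] J' by simp
      also have "\<dots> = (\<Oplus>\<^bsub>M.T\<^esub>t\<in>J'. M.pure (\<kappa> t u) (b t) \<oplus>\<^bsub>M.T\<^esub> M.pure (\<kappa> t v) (b t))"
        by (rule M.T.finsum_addf[symmetric]) (use J' add in \<open>auto simp: \<kappa>_closed b_closed subset_iff\<close>)
      also have "\<dots> = (\<Oplus>\<^bsub>M.T\<^esub>t\<in>J'. M.pure (\<kappa> t (u \<oplus>\<^bsub>M.T\<^esub> v)) (b t))"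
        by (rule M.T.finsum_cong') (use J' add in \<open>auto simp: \<kappa>_add \<kappa>_closed M.pure_add_left b_closed subset_iff\<close>)
      finally show "u \<oplus>\<^bsub>M.T\<^esub> v = (\<Oplus>\<^bsub>M.T\<^esub>t\<in>J'. M.pure (\<kappa> t (u \<oplus>\<^bsub>M.T\<^esub> v)) (b t))" .
    qed (use J1(1,2) J2(1,2) in auto)
  qed
  then obtain J where J: "finite J" "J \<subseteq> I"
    "\<forall>J'. finite J' \<and> J \<subseteq> J' \<and> J' \<subseteq> I \<longrightarrow> z = (\<Oplus>\<^bsub>M.T\<^esub>t\<in>J'. M.pure (\<kappa> t z) (b t))"
    by (elim exE conjE)
  show ?thesis
    by (rule that[OF J(1,2) J(3)[rule_format]]) (use J(1,2) in simp)
qed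

lemma tensor_linear_map:
  "Module.module R M \<Longrightarrow> Module.module R N \<Longrightarrow> linear_map R M N f \<Longrightarrow> tensor_linear_map R M N S \<phi> f"
  by (simp add: tensor_linear_map_def tensor_linear_map_axioms_def tensor_product)

text \<open>Flatness of \<open>S\<close>. The coefficient maps are natural in the module: if \<open>g \<otimes> S\<close> kills \<open>z\<close>, then \<open>g\<close>
  kills every coefficient of \<open>z\<close>. Lifting the coefficients one by one through \<open>f\<close> lifts \<open>z\<close>.\<close>

theorem tensor_exact:
  assumes M: "Module.module R M" and N: "Module.module R N" and P: "Module.module R P"
    and f: "linear_map R M N f" and g: "linear_map R N P g"
    and exact: "f ` carrier M = {x \<in> carrier N. g x = \<zero>\<^bsub>P\<^esub>}"
  shows "tensor_map R S \<phi> N f ` carrier (tensor_module R S \<phi> M) =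
    {z \<in> carrier (tensor_module R S \<phi> N). tensor_map R S \<phi> P g z = \<zero>\<^bsub>tensor_module R S \<phi> P\<^esub>}"
proof -
  interpret F: tensor_linear_map R M N S \<phi> f using M N f by (rule tensor_linear_map)
  interpret G: tensor_linear_map R N P S \<phi> g using N P g by (rule tensor_linear_map)
  have gf: "g (f x) = \<zero>\<^bsub>P\<^esub>" if "x \<in> carrier M" for x using exact that by blast
  show ?thesis
  proof (intro equalityI subsetI)
    fix w assume "w \<in> F.tmap ` carrier F.M.T"
    then obtain z where z: "z \<in> carrier F.M.T" "w = F.tmap z" by blast
    have "G.tmap (F.tmap z) = \<zero>\<^bsub>G.N.T\<^esub>"
      using z(1) by (induction z rule: F.M.tensor_induct)
        (simp_all add: F.tmap_pure G.tmap_pure F.tmap_add G.tmap_add gf)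
    then show "w \<in> {z \<in> carrier F.N.T. G.tmap z = \<zero>\<^bsub>G.N.T\<^esub>}" using z by auto
  next
    fix z assume "z \<in> {z \<in> carrier F.N.T. G.tmap z = \<zero>\<^bsub>G.N.T\<^esub>}"
    then have z: "z \<in> carrier F.N.T" and gz: "G.tmap z = \<zero>\<^bsub>G.N.T\<^esub>" by auto
    obtain \<kappa> where \<kappa>: "\<And>t. t \<in> I \<Longrightarrow> \<kappa> t \<in> hom (add_monoid F.N.T) (add_monoid N)"
      and \<kappa>_pure: "\<And>t x s. t \<in> I \<Longrightarrow> x \<in> carrier N \<Longrightarrow> s \<in> carrier S \<Longrightarrow> \<kappa> t (F.N.pure x s) = co t s \<odot>\<^bsub>N\<^esub> x"
      using coefficient_maps[OF N] by blast
    obtain \<mu> where \<mu>: "\<And>t. t \<in> I \<Longrightarrow> \<mu> t \<in> hom (add_monoid G.N.T) (add_monoid P)"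
      and \<mu>_pure: "\<And>t x s. t \<in> I \<Longrightarrow> x \<in> carrier P \<Longrightarrow> s \<in> carrier S \<Longrightarrow> \<mu> t (G.N.pure x s) = co t s \<odot>\<^bsub>P\<^esub> x"
      using coefficient_maps[OF P] by blast
    have natural: "\<mu> t (G.tmap z) = g (\<kappa> t z) \<and> \<kappa> t z \<in> carrier N" if t: "t \<in> I" "z \<in> carrier F.N.T" for t z
      using t(2)
    proof (induction z rule: F.N.tensor_induct)
      case (pure x s)
      then show ?case using t(1) g
        by (simp add: \<kappa>_pure \<mu>_pure G.tmap_pure co_closed linear_map_def)
    next
      case (add u v)
      then show ?case using \<kappa>[OF t(1)] \<mu>[OF t(1)] g
        by (simp add: hom_def G.tmap_add linear_map_def)
    qed
    obtain J where J: "finite J" "J \<subseteq> I" and zJ: "z = (\<Oplus>\<^bsub>F.N.T\<^esub>t\<in>J. F.N.pure (\<kappa> t z) (b t))"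
      by (rule tensor_expansion[OF N \<kappa> \<kappa>_pure z])
    have "\<exists>m\<in>carrier M. f m = \<kappa> t z" if t: "t \<in> I" for t
    proof -
      have "\<mu> t \<zero>\<^bsub>G.N.T\<^esub> = \<zero>\<^bsub>P\<^esub>"
        using \<mu>[OF t] by (intro additive_zero[OF G.N.abelian_group_T G.N.abelian_group_axioms]) (auto simp: hom_def)
      then have "\<kappa> t z \<in> {x \<in> carrier N. g x = \<zero>\<^bsub>P\<^esub>}" using natural[OF t z] gz by auto
      then show ?thesis using exact by (metis (no_types, lifting) imageE)
    qed
    then obtain m where m: "\<And>t. t \<in> I \<Longrightarrow> m t \<in> carrier M \<and> f (m t) = \<kappa> t z" by metis
    have "z = (\<Oplus>\<^bsub>F.N.T\<^esub>t\<in>J. F.tmap (F.M.pure (m t) (b t)))"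
      by (subst zJ, rule F.N.T.finsum_cong') (use m J in \<open>auto simp: F.tmap_pure b_closed subset_iff\<close>)
    also have "\<dots> = F.tmap (\<Oplus>\<^bsub>F.M.T\<^esub>t\<in>J. F.M.pure (m t) (b t))"
      by (rule additive_finsum[symmetric, OF F.M.abelian_group_T F.N.abelian_group_T])
        (use m J in \<open>auto simp: F.tmap_add b_closed subset_iff\<close>)
    finally show "z \<in> F.tmap ` carrier F.M.T"
      using m J by (auto simp: b_closed subset_iff intro!: F.M.T.finsum_closed)
  qed
qed

end

lemma (in tensor_linear_map) tmap_surj:
  assumes "f ` carrier M = carrier N"
  shows "tmap ` carrier M.T = carrier N.T"
proof (intro equalityI subsetI)
  fix z assume "z \<in> carrier N.T"
  then show "z \<in> tmap ` carrier M.T"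
  proof (induction z rule: N.tensor_induct)
    case (pure y s)
    then obtain x where "x \<in> carrier M" "y = f x" using assms by blast
    then have "N.pure y s = tmap (M.pure x s)" "M.pure x s \<in> carrier M.T"
      using pure by (simp_all add: tmap_pure M.pure_closed)
    then show ?case by blast
  next
    case (add a b)
    then obtain u v where "u \<in> carrier M.T" "a = tmap u" "v \<in> carrier M.T" "b = tmap v" by blast
    then have "a \<oplus>\<^bsub>N.T\<^esub> b = tmap (u \<oplus>\<^bsub>M.T\<^esub> v)" "u \<oplus>\<^bsub>M.T\<^esub> v \<in> carrier M.T"
      by (simp_all add: tmap_add)
    then show ?case by blast
  qed
qed auto

text \<open>Scalars from \<open>\<mm>\<close> move across the tensor sign: \<open>(a \<odot> y) \<otimes> s = \<phi> a \<odot> (y \<otimes> s)\<close>. This carries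
  the minimality of a resolution over to its base change.\<close>

lemma (in tensor_linear_map) tmap_ideal_times:
  assumes m: "\<mm> \<subseteq> carrier R" "\<phi> ` \<mm> \<subseteq> \<nn>" "\<nn> \<subseteq> carrier S"
    and f: "f ` carrier M \<subseteq> ideal_times_module \<mm> N"
  shows "tmap ` carrier M.T \<subseteq> ideal_times_module \<nn> N.T"
proof
  have sub: "subgroup (ideal_times_module \<nn> N.T) (add_monoid N.T)"
    unfolding ideal_times_module_def
    using m by (intro group.generate_is_subgroup N.T.a_group) auto
  have pure_in: "N.pure y s \<in> ideal_times_module \<nn> N.T"
    if "y \<in> ideal_times_module \<mm> N" and s: "s \<in> carrier S" for y s
  proof -
    have "subgroup {y \<in> carrier N. N.pure y s \<in> ideal_times_module \<nn> N.T} (add_monoid N)"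
    proof (rule group.subgroupI)
      show "group (add_monoid N)" by (rule N.a_group)
      show "{y \<in> carrier N. N.pure y s \<in> ideal_times_module \<nn> N.T} \<noteq> {}"
        using subgroup.one_closed[OF sub] s by (auto intro!: exI[of _ "\<zero>\<^bsub>N\<^esub>"])
      show "a \<otimes>\<^bsub>add_monoid N\<^esub> b \<in> {y \<in> carrier N. N.pure y s \<in> ideal_times_module \<nn> N.T}"
        if "a \<in> {y \<in> carrier N. N.pure y s \<in> ideal_times_module \<nn> N.T}"
          "b \<in> {y \<in> carrier N. N.pure y s \<in> ideal_times_module \<nn> N.T}" for a b
        using that s subgroup.m_closed[OF sub] by (simp add: N.pure_add_left)
      show "inv\<^bsub>add_monoid N\<^esub> a \<in> {y \<in> carrier N. N.pure y s \<in> ideal_times_module \<nn> N.T}"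
        if "a \<in> {y \<in> carrier N. N.pure y s \<in> ideal_times_module \<nn> N.T}" for a
      proof -
        have a: "a \<in> carrier N" using that by simp
        have "N.pure (\<ominus>\<^bsub>N\<^esub> a) s = \<ominus>\<^bsub>N.T\<^esub> N.pure a s"
          using N.pure_add_left[of "\<ominus>\<^bsub>N\<^esub> a" a s] a s
          by (intro N.T.minus_equality[symmetric]) (simp_all add: N.M.l_neg)
        then show ?thesis
          using that subgroup.m_inv_closed[OF sub, of "N.pure a s"] by (simp add: a_inv_def[symmetric])
      qed
    qed auto
    then have "ideal_times_module \<mm> N \<subseteq> {y \<in> carrier N. N.pure y s \<in> ideal_times_module \<nn> N.T}"
      unfolding ideal_times_module_def[of \<mm>]
    proof (rule group.generate_subgroup_incl[OF N.a_group, rotated])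
      show "{a \<odot>\<^bsub>N\<^esub> x |a x. a \<in> \<mm> \<and> x \<in> carrier N} \<subseteq> {y \<in> carrier N. N.pure y s \<in> ideal_times_module \<nn> N.T}"
      proof clarify
        fix a x assume ax: "a \<in> \<mm>" "x \<in> carrier N"
        then have a: "a \<in> carrier R" "\<phi> a \<in> \<nn>" using m by auto
        have "N.pure (a \<odot>\<^bsub>N\<^esub> x) s = \<phi> a \<odot>\<^bsub>N.T\<^esub> N.pure x s"
          using ax a s by (simp add: N.pure_smult N.smult_pure)
        also have "\<dots> \<in> ideal_times_module \<nn> N.T"
          unfolding ideal_times_module_def using a ax s by (blast intro: generate.incl N.pure_closed)
        finally show "a \<odot>\<^bsub>N\<^esub> x \<in> carrier N \<and> N.pure (a \<odot>\<^bsub>N\<^esub> x) s \<in> ideal_times_module \<nn> N.T"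
          using a ax by simp
      qed
    qed
    then show ?thesis using that by blast
  qed
  fix w assume "w \<in> tmap ` carrier M.T"
  then obtain z where "z \<in> carrier M.T" "w = tmap z" by blast
  moreover from this(1) have "tmap z \<in> ideal_times_module \<nn> N.T"
  proof (induction z rule: M.tensor_induct)
    case (pure x s)
    then show ?case using assms(4) by (auto simp: tmap_pure intro!: pure_in)
  next
    case (add a b)
    then show ?case using subgroup.m_closed[OF sub] by (simp add: tmap_add)
  qed
  ultimately show "w \<in> ideal_times_module \<nn> N.T" by simp
qed

section \<open>Quotient modules\<close>

lemma quotient_module_simps:
  "carrier (quotient_module R I) = a_rcosets\<^bsub>R\<^esub> I"
  "zero (quotient_module R I) = I"
  "add (quotient_module R I) = set_add R"
  by (simp_all add: quotient_module_def)

locale quotient_by_ideal = ideal I R for I :: "'r set" and R :: "'r ring" (structure)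
begin

abbreviation "quot \<equiv> quotient_module R I"

lemma carrier_quotient_module: "carrier quot = (+>) I ` carrier R"
  by (auto simp: quotient_module_simps A_RCOSETS_defs a_r_coset_def)

lemma quotient_module_coset_eq_iff: "a \<in> carrier R \<Longrightarrow> b \<in> carrier R \<Longrightarrow> I +> a = I +> b \<longleftrightarrow> a \<ominus> b \<in> I"
  using quotient_eq_iff_same_a_r_cos[OF is_ideal] by blast

lemma coset_closed [simp, intro]: "a \<in> carrier R \<Longrightarrow> I +> a \<in> carrier quot"
  by (simp add: carrier_quotient_module)

lemma coset_add: "a \<in> carrier R \<Longrightarrow> b \<in> carrier R \<Longrightarrow> (I +> a) \<oplus>\<^bsub>quot\<^esub> (I +> b) = I +> (a \<oplus> b)"
  by (simp add: quotient_module_simps a_rcos_sum)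

lemma coset_smult:
  assumes "a \<in> carrier R" "x \<in> carrier R"
  shows "a \<odot>\<^bsub>quot\<^esub> (I +> x) = I +> (a \<otimes> x)"
proof -
  have "I +> (a \<otimes> x') = I +> (a \<otimes> x)" if x': "x' \<in> I +> x" for x'
  proof -
    obtain h where h: "h \<in> I" "x' = h \<oplus> x" using x' by (auto simp: a_r_coset_def r_coset_def)
    have hc: "h \<in> carrier R" using h(1) by (rule a_Hcarr)
    then have "a \<otimes> x' \<ominus> a \<otimes> x = a \<otimes> h" using assms h(2) by (simp only:) algebra
    moreover have "a \<otimes> h \<in> I" using h assms by (simp add: I_l_closed)
    ultimately show ?thesis
      using assms hc h(2) by (simp add: quotient_module_coset_eq_iff)
  qed
  moreover have "x \<in> I +> x" using assms by (simp add: a_rcos_self)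
  ultimately have "(\<Union>x'\<in>I +> x. I +> (a \<otimes> x')) = I +> (a \<otimes> x)" by blast
  then show ?thesis by (simp add: quotient_module_def)
qed

lemma coset_zero: "a \<in> carrier R \<Longrightarrow> I +> a = \<zero>\<^bsub>quot\<^esub> \<longleftrightarrow> a \<in> I"
  using a_rcos_const[of a] a_rcos_self[of a] by (auto simp: quotient_module_simps)

lemma module_quotient_module:
  assumes "cring R"
  shows "Module.module R quot"
proof -
  interpret cring R by fact
  show ?thesis
  proof (rule moduleI)
    have eq: "carrier (add_monoid (R Quot I)) = carrier (add_monoid quot)"
      "mult (add_monoid (R Quot I)) = mult (add_monoid quot)" "one (add_monoid (R Quot I)) = one (add_monoid quot)"
      by (simp_all add: FactRing_def quotient_module_simps)
    have "comm_group (add_monoid quot)"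
      using abelian_group.a_comm_group[OF ring.is_abelian_group[OF quotient_is_ring]]
      unfolding comm_group_def group_def group_axioms_def comm_monoid_def comm_monoid_axioms_def
        Group.monoid_def Units_def eq .
    then show "abelian_group quot" by (rule comm_group_abelian_groupI)
  qed (auto simp: carrier_quotient_module coset_smult coset_add l_distr r_distr m_assoc is_cring)
qed

end

text \<open>Every tensor in \<open>(R / I) \<otimes> S\<close> has the form \<open>(1 + I) \<otimes> s\<close>, and the \<open>s\<close> for which this tensor
  vanishes form an ideal containing \<open>\<phi>(I)\<close>. Hence the evident map onto \<open>S / \<phi>(I) S\<close> is injective.\<close>

theorem quotient_base_change:
  assumes R: "cring R" and S: "cring S" and hom: "\<phi> \<in> ring_hom R S" and I: "ideal I R"
  defines "J \<equiv> Idl\<^bsub>S\<^esub> (\<phi> ` I)"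
  obtains \<theta> where "linear_map S (tensor_module R S \<phi> (quotient_module R I)) (quotient_module S J) \<theta>"
    and "\<theta> ` carrier (tensor_module R S \<phi> (quotient_module R I)) = carrier (quotient_module S J)"
    and "\<And>z. z \<in> carrier (tensor_module R S \<phi> (quotient_module R I)) \<Longrightarrow> \<theta> z = \<zero>\<^bsub>quotient_module S J\<^esub> \<Longrightarrow>
        z = \<zero>\<^bsub>tensor_module R S \<phi> (quotient_module R I)\<^esub>"
    and "\<And>r s. r \<in> carrier R \<Longrightarrow> s \<in> carrier S \<Longrightarrow>
        \<theta> (pure_tensor R S \<phi> (quotient_module R I) (I +>\<^bsub>R\<^esub> r) s) = J +>\<^bsub>S\<^esub> (\<phi> r \<otimes>\<^bsub>S\<^esub> s)"
proof -
  interpret R: cring R by fact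
  interpret S: cring S by fact
  interpret I: quotient_by_ideal I R using I by (rule quotient_by_ideal.intro)
  have \<phi>_closed [simp]: "\<phi> r \<in> carrier S" if "r \<in> carrier R" for r using hom that by (rule ring_hom_closed)
  have \<phi>I: "\<phi> ` I \<subseteq> carrier S" using I.a_subset by auto
  interpret J: quotient_by_ideal J S
    unfolding J_def by (rule quotient_by_ideal.intro[OF S.genideal_ideal[OF \<phi>I]])
  have \<phi>_add: "\<phi> (r \<oplus>\<^bsub>R\<^esub> r') = \<phi> r \<oplus>\<^bsub>S\<^esub> \<phi> r'" if "r \<in> carrier R" "r' \<in> carrier R" for r r'
    using hom that by (simp add: ring_hom_add)
  have \<phi>_mult: "\<phi> (r \<otimes>\<^bsub>R\<^esub> r') = \<phi> r \<otimes>\<^bsub>S\<^esub> \<phi> r'" if "r \<in> carrier R" "r' \<in> carrier R" for r r'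
    using hom that by (simp add: ring_hom_mult)
  have \<phi>_one: "\<phi> \<one>\<^bsub>R\<^esub> = \<one>\<^bsub>S\<^esub>" using hom by (simp add: ring_hom_one)
  have \<phi>J: "\<phi> r \<in> J" if "r \<in> I" for r
    using S.genideal_self[OF \<phi>I] that by (auto simp: J_def)
  interpret T: tensor_product R I.quot S \<phi>
    by (simp add: tensor_product_def tensor_product_axioms_def hom I.module_quotient_module S R.is_cring S.is_cring)
  interpret SJ: Module.module S J.quot by (rule J.module_quotient_module[OF S])
  define f where "f X s = J +>\<^bsub>S\<^esub> (\<phi> (SOME r. r \<in> carrier R \<and> X = I +>\<^bsub>R\<^esub> r) \<otimes>\<^bsub>S\<^esub> s)" for X s
  have f: "f (I +>\<^bsub>R\<^esub> r) s = J +>\<^bsub>S\<^esub> (\<phi> r \<otimes>\<^bsub>S\<^esub> s)" if r: "r \<in> carrier R" and s: "s \<in> carrier S" for r s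
  proof -
    define r' where "r' = (SOME r'. r' \<in> carrier R \<and> I +>\<^bsub>R\<^esub> r = I +>\<^bsub>R\<^esub> r')"
    have r': "r' \<in> carrier R \<and> I +>\<^bsub>R\<^esub> r = I +>\<^bsub>R\<^esub> r'"
      unfolding r'_def by (rule someI[of _ r]) (simp add: r)
    then have "r' \<ominus>\<^bsub>R\<^esub> r \<in> I" using I.quotient_module_coset_eq_iff[of r' r] r by simp
    then have "\<phi> (r' \<ominus>\<^bsub>R\<^esub> r) \<otimes>\<^bsub>S\<^esub> s \<in> J" using \<phi>J J.I_r_closed s by blast
    moreover have "\<phi> r' = \<phi> (r' \<ominus>\<^bsub>R\<^esub> r) \<oplus>\<^bsub>S\<^esub> \<phi> r"
      using r r' by (subst \<phi>_add[symmetric]) (simp_all add: R.minus_eq R.a_assoc R.l_neg)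
    then have "\<phi> r' \<otimes>\<^bsub>S\<^esub> s \<ominus>\<^bsub>S\<^esub> \<phi> r \<otimes>\<^bsub>S\<^esub> s = \<phi> (r' \<ominus>\<^bsub>R\<^esub> r) \<otimes>\<^bsub>S\<^esub> s"
      using r r' s by (simp add: S.l_distr S.minus_eq S.a_assoc S.r_neg)
    ultimately show ?thesis
      unfolding f_def r'_def[symmetric] using r r' s by (simp add: J.quotient_module_coset_eq_iff)
  qed
  obtain \<theta> where \<theta>: "\<theta> \<in> hom (add_monoid T.T) (add_monoid J.quot)"
    and \<theta>_f: "\<And>X s. X \<in> carrier I.quot \<Longrightarrow> s \<in> carrier S \<Longrightarrow> \<theta> (T.pure X s) = f X s"
  proof (rule T.tensor_lift[of "add_monoid J.quot" f])
    show "comm_group (add_monoid J.quot)" by (rule SJ.a_comm_group)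
  qed (auto simp: I.carrier_quotient_module f I.coset_add J.coset_add I.coset_smult \<phi>_add \<phi>_mult
      S.l_distr S.r_distr S.m_ac intro!: J.coset_closed)
  have \<theta>_pure: "\<theta> (T.pure (I +>\<^bsub>R\<^esub> r) s) = J +>\<^bsub>S\<^esub> (\<phi> r \<otimes>\<^bsub>S\<^esub> s)"
    if "r \<in> carrier R" "s \<in> carrier S" for r s using that by (simp add: \<theta>_f f)
  have \<theta>_closed: "\<theta> z \<in> carrier J.quot" if "z \<in> carrier T.T" for z using \<theta> that by (auto simp: hom_def)
  have \<theta>_add: "\<theta> (a \<oplus>\<^bsub>T.T\<^esub> b) = \<theta> a \<oplus>\<^bsub>J.quot\<^esub> \<theta> b" if "a \<in> carrier T.T" "b \<in> carrier T.T" for a b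
    using \<theta> that by (auto simp: hom_def)
  show ?thesis
  proof
    show "linear_map S T.T J.quot \<theta>"
      unfolding linear_map_def
    proof (intro conjI ballI)
      fix s z assume s: "s \<in> carrier S" and "z \<in> carrier T.T"
      from this(2) show "\<theta> (s \<odot>\<^bsub>T.T\<^esub> z) = s \<odot>\<^bsub>J.quot\<^esub> \<theta> z"
      proof (induction z rule: T.tensor_induct)
        case (pure X t)
        then obtain r where "r \<in> carrier R" "X = I +>\<^bsub>R\<^esub> r" by (auto simp: I.carrier_quotient_module)
        then show ?case using pure s by (simp add: T.smult_pure \<theta>_pure J.coset_smult S.m_lcomm)
      next
        case (add a b)
        then show ?case using s by (simp add: \<theta>_add T.T.smult_r_distr SJ.smult_r_distr \<theta>_closed)
      qed
    qed (auto simp: \<theta>_closed \<theta>_add)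
    show "\<theta> ` carrier T.T = carrier J.quot"
    proof
      show "carrier J.quot \<subseteq> \<theta> ` carrier T.T"
      proof
        fix X assume "X \<in> carrier J.quot"
        then obtain s where s: "s \<in> carrier S" "X = J +>\<^bsub>S\<^esub> s" by (auto simp: J.carrier_quotient_module)
        then have "X = \<theta> (T.pure (I +>\<^bsub>R\<^esub> \<one>\<^bsub>R\<^esub>) s)" by (simp add: \<theta>_pure \<phi>_one)
        then show "X \<in> \<theta> ` carrier T.T" using s by (auto intro!: T.pure_closed)
      qed
    qed (use \<theta>_closed in auto)
    show "z = \<zero>\<^bsub>T.T\<^esub>" if z: "z \<in> carrier T.T" and 0: "\<theta> z = \<zero>\<^bsub>J.quot\<^esub>" for z
    proof -
      let ?u = "I +>\<^bsub>R\<^esub> \<one>\<^bsub>R\<^esub>"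
      have pure_u: "T.pure (I +>\<^bsub>R\<^esub> r) s = T.pure ?u (\<phi> r \<otimes>\<^bsub>S\<^esub> s)" if "r \<in> carrier R" "s \<in> carrier S" for r s
        using T.pure_smult[of r ?u s] that by (simp add: I.coset_smult I.coset_closed)
      have "\<exists>s\<in>carrier S. z = T.pure ?u s"
        using z
      proof (induction z rule: T.tensor_induct)
        case (pure X t)
        then obtain r where "r \<in> carrier R" "X = I +>\<^bsub>R\<^esub> r" by (auto simp: I.carrier_quotient_module)
        then have "T.pure X t = T.pure ?u (\<phi> r \<otimes>\<^bsub>S\<^esub> t)" "\<phi> r \<otimes>\<^bsub>S\<^esub> t \<in> carrier S"
          using pure pure_u[of r t] by auto
        then show ?case by blast
      next
        case (add a b)
        then obtain s t where "s \<in> carrier S" "a = T.pure ?u s" "t \<in> carrier S" "b = T.pure ?u t" by blast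
        then have "a \<oplus>\<^bsub>T.T\<^esub> b = T.pure ?u (s \<oplus>\<^bsub>S\<^esub> t)" "s \<oplus>\<^bsub>S\<^esub> t \<in> carrier S"
          by (simp_all add: T.pure_add_right I.coset_closed)
        then show ?case by blast
      qed
      then obtain s where s: "s \<in> carrier S" "z = T.pure ?u s" by blast
      then have "s \<in> J" using 0 by (simp add: \<theta>_pure \<phi>_one J.coset_zero)
      moreover have "J \<subseteq> {s \<in> carrier S. T.pure ?u s = \<zero>\<^bsub>T.T\<^esub>}"
        unfolding J_def
      proof (rule S.genideal_minimal)
        have smult: "T.pure ?u (a \<otimes>\<^bsub>S\<^esub> t) = \<zero>\<^bsub>T.T\<^esub>"
          if "a \<in> carrier S" "t \<in> carrier S" "T.pure ?u t = \<zero>\<^bsub>T.T\<^esub>" for a t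
          using T.smult_pure[of a ?u t] that by (simp add: I.coset_closed)
        show "ideal {s \<in> carrier S. T.pure ?u s = \<zero>\<^bsub>T.T\<^esub>} S"
        proof (rule idealI)
          show "subgroup {s \<in> carrier S. T.pure ?u s = \<zero>\<^bsub>T.T\<^esub>} (add_monoid S)"
          proof (rule group.subgroupI)
            show "inv\<^bsub>add_monoid S\<^esub> a \<in> {s \<in> carrier S. T.pure ?u s = \<zero>\<^bsub>T.T\<^esub>}"
              if "a \<in> {s \<in> carrier S. T.pure ?u s = \<zero>\<^bsub>T.T\<^esub>}" for a
              unfolding a_inv_def[symmetric] mem_Collect_eq
              using that smult[of "\<ominus>\<^bsub>S\<^esub> \<one>\<^bsub>S\<^esub>" a] by (simp add: S.l_minus)
            show "group (add_monoid S)" by (rule S.a_group)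
            have "\<zero>\<^bsub>S\<^esub> \<in> {s \<in> carrier S. T.pure ?u s = \<zero>\<^bsub>T.T\<^esub>}" by (simp add: I.coset_closed)
            then show "{s \<in> carrier S. T.pure ?u s = \<zero>\<^bsub>T.T\<^esub>} \<noteq> {}" by blast
            show "a \<otimes>\<^bsub>add_monoid S\<^esub> b \<in> {s \<in> carrier S. T.pure ?u s = \<zero>\<^bsub>T.T\<^esub>}"
              if "a \<in> {s \<in> carrier S. T.pure ?u s = \<zero>\<^bsub>T.T\<^esub>}"
                "b \<in> {s \<in> carrier S. T.pure ?u s = \<zero>\<^bsub>T.T\<^esub>}" for a b
              using that by (simp add: T.pure_add_right I.coset_closed)
          qed auto
          show "x \<otimes>\<^bsub>S\<^esub> a \<in> {s \<in> carrier S. T.pure ?u s = \<zero>\<^bsub>T.T\<^esub>}"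
            if "a \<in> {s \<in> carrier S. T.pure ?u s = \<zero>\<^bsub>T.T\<^esub>}" "x \<in> carrier S" for a x
            using that smult[of x a] by simp
          then show "a \<otimes>\<^bsub>S\<^esub> x \<in> {s \<in> carrier S. T.pure ?u s = \<zero>\<^bsub>T.T\<^esub>}"
            if "a \<in> {s \<in> carrier S. T.pure ?u s = \<zero>\<^bsub>T.T\<^esub>}" "x \<in> carrier S" for a x
            using that S.m_comm[of a x] by simp
        qed (rule S.ring_axioms)
        show "\<phi> ` I \<subseteq> {s \<in> carrier S. T.pure ?u s = \<zero>\<^bsub>T.T\<^esub>}"
        proof clarify
          fix r assume r: "r \<in> I"
          then have rc: "r \<in> carrier R" by (rule I.a_Hcarr)
          have "T.pure ?u (\<phi> r) = T.pure (I +>\<^bsub>R\<^esub> r) \<one>\<^bsub>S\<^esub>" using pure_u[OF rc S.one_closed] rc by simp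
          also have "I +>\<^bsub>R\<^esub> r = \<zero>\<^bsub>I.quot\<^esub>" using I.coset_zero[OF rc] r by simp
          finally show "\<phi> r \<in> carrier S \<and> T.pure ?u (\<phi> r) = \<zero>\<^bsub>T.T\<^esub>" using rc by simp
        qed
      qed
      ultimately show ?thesis using s by blast
    qed
  qed (use \<theta>_pure in auto)
qed

section \<open>Coordinates with respect to a basis\<close>

locale free_module = Module.module R M for R :: "'r ring" and M :: "('r, 'a) module" +
  fixes E :: "'a set"
  assumes basis: "module_basis R M E"
begin

definition coord :: "'a \<Rightarrow> 'a \<Rightarrow> 'r"
  where "coord x = (THE a. a \<in> E \<rightarrow>\<^sub>E carrier R \<and> x = (\<Oplus>\<^bsub>M\<^esub>e\<in>E. a e \<odot>\<^bsub>M\<^esub> e))"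

lemma finite_basis [simp, intro]: "finite E"
  and basis_closed [simp, intro]: "e \<in> E \<Longrightarrow> e \<in> carrier M"
  using basis by (auto simp: module_basis_def)

lemma coord:
  assumes "x \<in> carrier M"
  shows "coord x \<in> E \<rightarrow>\<^sub>E carrier R" and "x = (\<Oplus>\<^bsub>M\<^esub>e\<in>E. coord x e \<odot>\<^bsub>M\<^esub> e)"
proof -
  have "\<exists>!a. a \<in> E \<rightarrow>\<^sub>E carrier R \<and> x = (\<Oplus>\<^bsub>M\<^esub>e\<in>E. a e \<odot>\<^bsub>M\<^esub> e)"
    using basis assms by (simp add: module_basis_def)
  from theI'[OF this] show "coord x \<in> E \<rightarrow>\<^sub>E carrier R" "x = (\<Oplus>\<^bsub>M\<^esub>e\<in>E. coord x e \<odot>\<^bsub>M\<^esub> e)"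
    by (simp_all add: coord_def)
qed

lemma coord_closed [simp, intro]: "x \<in> carrier M \<Longrightarrow> e \<in> E \<Longrightarrow> coord x e \<in> carrier R"
  using coord(1) by (auto simp: PiE_iff)

lemma combination_closed [simp, intro]: "a \<in> E \<rightarrow> carrier R \<Longrightarrow> (\<Oplus>\<^bsub>M\<^esub>e\<in>E. a e \<odot>\<^bsub>M\<^esub> e) \<in> carrier M"
  by (intro M.finsum_closed) (simp add: Pi_def)

text \<open>Coordinates are total functions on \<open>E\<close> in the sense of \<open>\<rightarrow>\<^sub>E\<close>, that is undefined outside \<open>E\<close>;
  arbitrary coefficient functions are restricted to \<open>E\<close> before uniqueness applies.\<close>

lemma coord_combination:
  assumes a: "a \<in> E \<rightarrow> carrier R" and e: "e \<in> E"
  shows "coord (\<Oplus>\<^bsub>M\<^esub>e\<in>E. a e \<odot>\<^bsub>M\<^esub> e) e = a e"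
proof -
  let ?x = "\<Oplus>\<^bsub>M\<^esub>e\<in>E. a e \<odot>\<^bsub>M\<^esub> e"
  have x: "?x \<in> carrier M" using a by blast
  have "?x = (\<Oplus>\<^bsub>M\<^esub>e\<in>E. restrict a E e \<odot>\<^bsub>M\<^esub> e)"
    by (rule M.finsum_cong') (use a in \<open>simp_all add: Pi_def\<close>)
  moreover have "restrict a E \<in> E \<rightarrow>\<^sub>E carrier R" using a by auto
  moreover have "\<exists>!a. a \<in> E \<rightarrow>\<^sub>E carrier R \<and> ?x = (\<Oplus>\<^bsub>M\<^esub>e\<in>E. a e \<odot>\<^bsub>M\<^esub> e)"
    using basis x by (simp add: module_basis_def)
  ultimately have "coord ?x = restrict a E" using coord[OF x] by blast
  then show ?thesis using e by simp
qed

lemma coord_add: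
  assumes "x \<in> carrier M" "y \<in> carrier M" "e \<in> E"
  shows "coord (x \<oplus>\<^bsub>M\<^esub> y) e = coord x e \<oplus>\<^bsub>R\<^esub> coord y e"
proof -
  have "x \<oplus>\<^bsub>M\<^esub> y = (\<Oplus>\<^bsub>M\<^esub>e\<in>E. coord x e \<odot>\<^bsub>M\<^esub> e) \<oplus>\<^bsub>M\<^esub> (\<Oplus>\<^bsub>M\<^esub>e\<in>E. coord y e \<odot>\<^bsub>M\<^esub> e)"
    using coord(2) assms by simp
  also have "\<dots> = (\<Oplus>\<^bsub>M\<^esub>e\<in>E. coord x e \<odot>\<^bsub>M\<^esub> e \<oplus>\<^bsub>M\<^esub> coord y e \<odot>\<^bsub>M\<^esub> e)"
    by (rule M.finsum_addf[symmetric]) (use assms in auto)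
  also have "\<dots> = (\<Oplus>\<^bsub>M\<^esub>e\<in>E. (coord x e \<oplus>\<^bsub>R\<^esub> coord y e) \<odot>\<^bsub>M\<^esub> e)"
    by (rule M.finsum_cong') (use assms in \<open>auto simp: smult_l_distr\<close>)
  finally show ?thesis
    using coord_combination[of "\<lambda>e. coord x e \<oplus>\<^bsub>R\<^esub> coord y e" e] assms by (simp add: Pi_def)
qed

lemma coord_smult:
  assumes "r \<in> carrier R" "x \<in> carrier M" "e \<in> E"
  shows "coord (r \<odot>\<^bsub>M\<^esub> x) e = r \<otimes>\<^bsub>R\<^esub> coord x e"
proof -
  have "r \<odot>\<^bsub>M\<^esub> x = r \<odot>\<^bsub>M\<^esub> (\<Oplus>\<^bsub>M\<^esub>e\<in>E. coord x e \<odot>\<^bsub>M\<^esub> e)"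
    using coord(2) assms by simp
  also have "\<dots> = (\<Oplus>\<^bsub>M\<^esub>e\<in>E. r \<odot>\<^bsub>M\<^esub> (coord x e \<odot>\<^bsub>M\<^esub> e))"
    by (rule finsum_smult_ldistr) (use assms in auto)
  also have "\<dots> = (\<Oplus>\<^bsub>M\<^esub>e\<in>E. (r \<otimes>\<^bsub>R\<^esub> coord x e) \<odot>\<^bsub>M\<^esub> e)"
    by (rule M.finsum_cong') (use assms in \<open>auto simp: smult_assoc1\<close>)
  finally show ?thesis
    using coord_combination[of "\<lambda>e. r \<otimes>\<^bsub>R\<^esub> coord x e" e] assms by (simp add: Pi_def)
qed

lemma coord_zero: "e \<in> E \<Longrightarrow> coord \<zero>\<^bsub>M\<^esub> e = \<zero>\<^bsub>R\<^esub>"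
  using coord_smult[of "\<zero>\<^bsub>R\<^esub>" "\<zero>\<^bsub>M\<^esub>" e] by simp

lemma coord_basis:
  assumes "e \<in> E" "e' \<in> E"
  shows "coord e e' = (if e' = e then \<one>\<^bsub>R\<^esub> else \<zero>\<^bsub>R\<^esub>)"
proof -
  have "(\<Oplus>\<^bsub>M\<^esub>e'\<in>E. (if e' = e then \<one>\<^bsub>R\<^esub> else \<zero>\<^bsub>R\<^esub>) \<odot>\<^bsub>M\<^esub> e') = (\<Oplus>\<^bsub>M\<^esub>e'\<in>E. if e' = e then e' else \<zero>\<^bsub>M\<^esub>)"
    by (rule M.finsum_cong') auto
  also have "\<dots> = e"
    using M.add.finprod_singleton_swap[of e E "\<lambda>x. x"] assms by auto
  finally show ?thesis
    using coord_combination[of "\<lambda>e'. if e' = e then \<one>\<^bsub>R\<^esub> else \<zero>\<^bsub>R\<^esub>" e'] assms by simp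
qed

lemma coord_finsum:
  assumes "f \<in> J \<rightarrow> carrier M" "e \<in> E"
  shows "coord (\<Oplus>\<^bsub>M\<^esub>j\<in>J. f j) e = (\<Oplus>\<^bsub>R\<^esub>j\<in>J. coord (f j) e)"
  using assms coord_add
  by (intro additive_finsum[of M R "\<lambda>x. coord x e"] M.abelian_group_axioms R.abelian_group_axioms) auto

lemma coord_eqI:
  assumes "x \<in> carrier M" "y \<in> carrier M" "\<And>e. e \<in> E \<Longrightarrow> coord x e = coord y e"
  shows "x = y"
proof -
  have "x = (\<Oplus>\<^bsub>M\<^esub>e\<in>E. coord x e \<odot>\<^bsub>M\<^esub> e)" using coord(2) assms(1) by blast
  also have "\<dots> = (\<Oplus>\<^bsub>M\<^esub>e\<in>E. coord y e \<odot>\<^bsub>M\<^esub> e)" by (rule M.finsum_cong') (use assms in auto)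
  also have "\<dots> = y" using coord(2)[OF assms(2)] by simp
  finally show ?thesis .
qed

end

locale free_tensor = tensor_product R M S \<phi> + free_module R M E
  for R :: "'r ring" and M :: "('r, 'a) module" and S :: "'s ring" and \<phi> and E
begin

text \<open>The coordinate of a tensor at \<open>e \<otimes> 1\<close>, obtained by extending scalars in the coordinate at \<open>e\<close>;
  it is chosen among the maps that the universal property provides.\<close>

definition tcoord :: "'a \<Rightarrow> ('a \<times> 's \<Rightarrow>\<^sub>0 int) set \<Rightarrow> 's"
  where "tcoord e = (SOME h. h \<in> hom (add_monoid T) (add_monoid S) \<and>
    (\<forall>x\<in>carrier M. \<forall>s\<in>carrier S. h (pure x s) = \<phi> (coord x e) \<otimes>\<^bsub>S\<^esub> s))"

lemma tcoord:
  assumes e: "e \<in> E"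
  shows tcoord_hom: "tcoord e \<in> hom (add_monoid T) (add_monoid S)"
    and tcoord_pure: "\<And>x s. x \<in> carrier M \<Longrightarrow> s \<in> carrier S \<Longrightarrow> tcoord e (pure x s) = \<phi> (coord x e) \<otimes>\<^bsub>S\<^esub> s"
proof -
  have "\<exists>h. h \<in> hom (add_monoid T) (add_monoid S) \<and>
    (\<forall>x\<in>carrier M. \<forall>s\<in>carrier S. h (pure x s) = \<phi> (coord x e) \<otimes>\<^bsub>S\<^esub> s)"
  proof (rule tensor_lift[of "add_monoid S" "\<lambda>x s. \<phi> (coord x e) \<otimes>\<^bsub>S\<^esub> s"])
    show "comm_group (add_monoid S)" by (rule S.a_comm_group)
  qed (use e in \<open>auto simp: coord_add coord_smult S.l_distr S.r_distr S.m_ac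
      ring_hom_add[OF hom] ring_hom_mult[OF hom]\<close>)
  from someI_ex[OF this] show "tcoord e \<in> hom (add_monoid T) (add_monoid S)"
    "\<And>x s. x \<in> carrier M \<Longrightarrow> s \<in> carrier S \<Longrightarrow> tcoord e (pure x s) = \<phi> (coord x e) \<otimes>\<^bsub>S\<^esub> s"
    by (simp_all add: tcoord_def)
qed

lemma tcoord_closed [simp, intro]: "e \<in> E \<Longrightarrow> z \<in> carrier T \<Longrightarrow> tcoord e z \<in> carrier S"
  using tcoord_hom by (auto simp: hom_def)

lemma tcoord_add:
  "e \<in> E \<Longrightarrow> u \<in> carrier T \<Longrightarrow> v \<in> carrier T \<Longrightarrow> tcoord e (u \<oplus>\<^bsub>T\<^esub> v) = tcoord e u \<oplus>\<^bsub>S\<^esub> tcoord e v"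
  using tcoord_hom by (auto simp: hom_def)

lemma tcoord_finsum:
  assumes "f \<in> J \<rightarrow> carrier T" "e \<in> E"
  shows "tcoord e (\<Oplus>\<^bsub>T\<^esub>j\<in>J. f j) = (\<Oplus>\<^bsub>S\<^esub>j\<in>J. tcoord e (f j))"
  using assms tcoord_add
  by (intro additive_finsum[of T S "tcoord e"] abelian_group_T S.abelian_group_axioms) auto

lemma \<phi>_zero: "\<phi> \<zero>\<^bsub>R\<^esub> = \<zero>\<^bsub>S\<^esub>"
  using hom by (rule ring_hom_zero) (simp_all add: R.ring_axioms S.ring_axioms)

lemma tcoord_combination:
  assumes s: "s \<in> E \<rightarrow> carrier S" and e: "e \<in> E"
  shows "tcoord e (\<Oplus>\<^bsub>T\<^esub>e\<in>E. pure e (s e)) = s e"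
proof -
  have "tcoord e (\<Oplus>\<^bsub>T\<^esub>e'\<in>E. pure e' (s e')) = (\<Oplus>\<^bsub>S\<^esub>e'\<in>E. tcoord e (pure e' (s e')))"
    by (rule tcoord_finsum) (use s e in auto)
  also have "\<dots> = (\<Oplus>\<^bsub>S\<^esub>e'\<in>E. if e = e' then s e' else \<zero>\<^bsub>S\<^esub>)"
    by (rule S.finsum_cong')
      (use s e in \<open>simp_all add: Pi_def tcoord_pure coord_basis \<phi>_zero ring_hom_one[OF hom]\<close>)
  also have "\<dots> = s e"
    by (rule S.finsum_singleton) (use s e in auto)
  finally show ?thesis .
qed

lemma tensor_coord_expansion:
  assumes "z \<in> carrier T"
  shows "z = (\<Oplus>\<^bsub>T\<^esub>e\<in>E. pure e (tcoord e z))"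
  using assms
proof (induction z rule: tensor_induct)
  case (pure x s)
  have "pure x s = pure (\<Oplus>\<^bsub>M\<^esub>e\<in>E. coord x e \<odot>\<^bsub>M\<^esub> e) s" using coord(2)[OF pure(1)] by simp
  also have "\<dots> = (\<Oplus>\<^bsub>T\<^esub>e\<in>E. pure (coord x e \<odot>\<^bsub>M\<^esub> e) s)"
    by (rule additive_finsum[OF M.abelian_group_axioms abelian_group_T])
      (use pure in \<open>auto simp: pure_add_left\<close>)
  also have "\<dots> = (\<Oplus>\<^bsub>T\<^esub>e\<in>E. pure e (tcoord e (pure x s)))"
    by (rule T.finsum_cong') (use pure in \<open>auto simp: tcoord_pure pure_smult\<close>)
  finally show ?case .
next
  case (add u v)
  have "u \<oplus>\<^bsub>T\<^esub> v = (\<Oplus>\<^bsub>T\<^esub>e\<in>E. pure e (tcoord e u)) \<oplus>\<^bsub>T\<^esub> (\<Oplus>\<^bsub>T\<^esub>e\<in>E. pure e (tcoord e v))"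
    using add(3,4) by (rule arg_cong2)
  also have "\<dots> = (\<Oplus>\<^bsub>T\<^esub>e\<in>E. pure e (tcoord e u) \<oplus>\<^bsub>T\<^esub> pure e (tcoord e v))"
    by (rule T.finsum_addf[symmetric]) (use add(1,2) in auto)
  also have "\<dots> = (\<Oplus>\<^bsub>T\<^esub>e\<in>E. pure e (tcoord e (u \<oplus>\<^bsub>T\<^esub> v)))"
    by (rule T.finsum_cong') (use add(1,2) in \<open>auto simp: tcoord_add pure_add_right\<close>)
  finally show ?case .
qed

lemma tcoord_eqI:
  assumes "u \<in> carrier T" "v \<in> carrier T" "\<And>e. e \<in> E \<Longrightarrow> tcoord e u = tcoord e v"
  shows "u = v"
proof -
  have "u = (\<Oplus>\<^bsub>T\<^esub>e\<in>E. pure e (tcoord e u))" using assms(1) by (rule tensor_coord_expansion)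
  also have "\<dots> = (\<Oplus>\<^bsub>T\<^esub>e\<in>E. pure e (tcoord e v))" by (rule T.finsum_cong') (use assms in auto)
  also have "\<dots> = v" using assms(2) by (rule tensor_coord_expansion[symmetric])
  finally show ?thesis .
qed

text \<open>In a nontrivial ring \<open>S\<close> the coordinates tell the tensors \<open>e \<otimes> 1\<close> apart, so that functions on
  this set of tensors are the same as functions on \<open>E\<close>.\<close>

theorem tensor_basis:
  assumes nontrivial: "\<one>\<^bsub>S\<^esub> \<noteq> \<zero>\<^bsub>S\<^esub>"
  shows "module_basis S T ((\<lambda>e. pure e \<one>\<^bsub>S\<^esub>) ` E)"
proof -
  let ?u = "\<lambda>e. pure e \<one>\<^bsub>S\<^esub>"
  have tcoord_u: "tcoord e (?u e') = (if e = e' then \<one>\<^bsub>S\<^esub> else \<zero>\<^bsub>S\<^esub>)" if "e \<in> E" "e' \<in> E" for e e'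
    using that by (simp add: tcoord_pure coord_basis \<phi>_zero ring_hom_one[OF hom])
  have inj: "inj_on ?u E"
  proof (rule inj_onI)
    fix e e' assume e: "e \<in> E" "e' \<in> E" and "?u e = ?u e'"
    then have "(if e = e' then \<one>\<^bsub>S\<^esub> else \<zero>\<^bsub>S\<^esub>) = \<one>\<^bsub>S\<^esub>" using tcoord_u[of e e] tcoord_u[of e e'] by simp
    then show "e = e'" using nontrivial by (simp split: if_splits)
  qed
  have comb: "(\<Oplus>\<^bsub>T\<^esub>v\<in>?u ` E. a v \<odot>\<^bsub>T\<^esub> v) = (\<Oplus>\<^bsub>T\<^esub>e\<in>E. pure e (a (?u e)))"
    if a: "a \<in> ?u ` E \<rightarrow> carrier S" for a
  proof -
    have "(\<Oplus>\<^bsub>T\<^esub>v\<in>?u ` E. a v \<odot>\<^bsub>T\<^esub> v) = (\<Oplus>\<^bsub>T\<^esub>e\<in>E. a (?u e) \<odot>\<^bsub>T\<^esub> ?u e)"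
      by (rule T.add.finprod_reindex[OF _ inj]) (use a in auto)
    also have "\<dots> = (\<Oplus>\<^bsub>T\<^esub>e\<in>E. pure e (a (?u e)))"
      by (rule T.finsum_cong') (use a in \<open>auto simp: smult_pure Pi_def\<close>)
    finally show ?thesis .
  qed
  show ?thesis
    unfolding module_basis_def
  proof (intro conjI ballI)
    fix z assume z: "z \<in> carrier T"
    define a where "a = restrict (\<lambda>v. tcoord (inv_into E ?u v) z) (?u ` E)"
    have a_u: "a (?u e) = tcoord e z" if "e \<in> E" for e
      using that inv_into_f_f[OF inj that] by (simp add: a_def)
    show "\<exists>!a. a \<in> ?u ` E \<rightarrow>\<^sub>E carrier S \<and> z = (\<Oplus>\<^bsub>T\<^esub>v\<in>?u ` E. a v \<odot>\<^bsub>T\<^esub> v)"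
    proof (rule ex1I[of _ a])
      have a: "a \<in> ?u ` E \<rightarrow>\<^sub>E carrier S" using a_u z by (auto simp: a_def)
      have "(\<Oplus>\<^bsub>T\<^esub>v\<in>?u ` E. a v \<odot>\<^bsub>T\<^esub> v) = (\<Oplus>\<^bsub>T\<^esub>e\<in>E. pure e (a (?u e)))"
        using a by (intro comb) auto
      also have "\<dots> = (\<Oplus>\<^bsub>T\<^esub>e\<in>E. pure e (tcoord e z))"
        by (rule T.finsum_cong') (use a_u z in auto)
      also have "\<dots> = z" using tensor_coord_expansion[OF z] by simp
      finally show "a \<in> ?u ` E \<rightarrow>\<^sub>E carrier S \<and> z = (\<Oplus>\<^bsub>T\<^esub>v\<in>?u ` E. a v \<odot>\<^bsub>T\<^esub> v)"
        using a by simp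
    next
      fix a' assume a': "a' \<in> ?u ` E \<rightarrow>\<^sub>E carrier S \<and> z = (\<Oplus>\<^bsub>T\<^esub>v\<in>?u ` E. a' v \<odot>\<^bsub>T\<^esub> v)"
      then have "a' \<in> ?u ` E \<rightarrow> carrier S" by auto
      with a' comb have z': "z = (\<Oplus>\<^bsub>T\<^esub>e\<in>E. pure e (a' (?u e)))" by simp
      have "a' (?u e) = a (?u e)" if "e \<in> E" for e
        using a_u[OF that] z' tcoord_combination[of "\<lambda>e. a' (?u e)" e] that a' by (auto simp: PiE_iff)
      then show "a' = a"
        using a' by (intro extensionalityI[of _ "?u ` E"]) (auto simp: a_def PiE_iff)
    qed
  qed auto
qed

end

section \<open>Polynomial rings\<close>

lemma mpoly_ring_simps [simp]:
  "carrier mpoly_ring = UNIV" "mult mpoly_ring = (*)" "one mpoly_ring = 1"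
  "zero mpoly_ring = 0" "add mpoly_ring = (+)"
  by (simp_all add: mpoly_ring_def)

lemma cring_mpoly_ring: "cring (mpoly_ring :: ('v, 'k::field) mpoly ring)"
proof (rule cringI)
  show "abelian_group (mpoly_ring :: ('v, 'k) mpoly ring)"
  proof (rule abelian_groupI)
    show "\<exists>y\<in>carrier mpoly_ring. y \<oplus>\<^bsub>mpoly_ring\<^esub> x = \<zero>\<^bsub>mpoly_ring\<^esub>" for x :: "('v, 'k) mpoly"
      by (intro bexI[of _ "- x"]) simp_all
  qed (simp_all add: algebra_simps)
  show "Group.comm_monoid (mpoly_ring :: ('v, 'k) mpoly ring)"
    by (rule comm_monoidI) (simp_all add: algebra_simps)
qed (simp add: algebra_simps)

interpretation mpoly: cring "mpoly_ring :: ('v, 'k::field) mpoly ring"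
  rewrites "carrier (mpoly_ring :: ('v, 'k::field) mpoly ring) = UNIV"
    and "mult (mpoly_ring :: ('v, 'k::field) mpoly ring) = (*)"
    and "add (mpoly_ring :: ('v, 'k::field) mpoly ring) = (+)"
    and "one (mpoly_ring :: ('v, 'k::field) mpoly ring) = 1"
    and "zero (mpoly_ring :: ('v, 'k::field) mpoly ring) = 0"
  by (rule cring_mpoly_ring) simp_all

lemma finsum_mpoly_ring [simp]:
  fixes f :: "'b \<Rightarrow> ('v, 'k::field) mpoly"
  shows "finsum mpoly_ring f J = sum f J"
  by (induction J rule: infinite_finite_induct)
    (simp_all add: mpoly.finsum_infinite mpoly.finsum_empty mpoly.finsum_insert)

lemma a_inv_mpoly_ring [simp]: "\<ominus>\<^bsub>mpoly_ring\<^esub> (p :: ('v, 'k::field) mpoly) = - p"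
  by (rule mpoly.minus_equality) simp_all

lemma a_minus_mpoly_ring [simp]: "p \<ominus>\<^bsub>mpoly_ring\<^esub> q = p - (q :: ('v, 'k::field) mpoly)"
  by (simp add: a_minus_def)

lemma ideal_mpoly_ringI:
  fixes J :: "('v, 'k::field) mpoly set"
  assumes "0 \<in> J" "\<And>p q. p \<in> J \<Longrightarrow> q \<in> J \<Longrightarrow> p + q \<in> J" "\<And>p q. q \<in> J \<Longrightarrow> p * q \<in> J"
  shows "ideal J mpoly_ring"
proof (rule idealI)
  show "subgroup J (add_monoid mpoly_ring)"
  proof (rule group.subgroupI)
    show "group (add_monoid (mpoly_ring :: ('v, 'k) mpoly ring))"
      by (intro abelian_group.a_group ring.is_abelian_group cring.axioms(1) cring_mpoly_ring)
    show "inv\<^bsub>add_monoid mpoly_ring\<^esub> p \<in> J" if "p \<in> J" for p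
      using assms(3)[OF that, of "- 1"] unfolding a_inv_def[symmetric] by simp
  qed (use assms in auto)
qed (use assms in \<open>auto simp: cring.axioms(1)[OF cring_mpoly_ring] mult.commute\<close>)

lemma mpoly_ideal:
  fixes J :: "('v, 'k::field) mpoly set"
  assumes "ideal J mpoly_ring"
  shows "0 \<in> J" "p \<in> J \<Longrightarrow> q \<in> J \<Longrightarrow> p + q \<in> J" "q \<in> J \<Longrightarrow> p * q \<in> J"
    "p \<in> J \<Longrightarrow> q \<in> J \<Longrightarrow> p - q \<in> J" "(\<And>j. j \<in> X \<Longrightarrow> f j \<in> J) \<Longrightarrow> sum f X \<in> J"
proof -
  interpret ideal J mpoly_ring by fact
  show 0: "0 \<in> J" using zero_closed by simp
  show add: "p + q \<in> J" if "p \<in> J" "q \<in> J" for p q using a_closed[OF that] by simp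
  show mult: "p * q \<in> J" if "q \<in> J" for p q using I_l_closed[OF that, of p] by simp
  show "p - q \<in> J" if "p \<in> J" "q \<in> J"
    using add[OF that(1) mult[OF that(2), of "- 1"]] by simp
  show "sum f X \<in> J" if "\<And>j. j \<in> X \<Longrightarrow> f j \<in> J"
    using that by (induction X rule: infinite_finite_induct) (simp_all add: 0 add)
qed

lemma ideal_toric: "ideal (toric_ideal A :: ('n::finite, 'k::field) mpoly set) mpoly_ring"
  unfolding toric_ideal_def by (rule mpoly.genideal_ideal) simp

lemma binomial_in_toric_ideal:
  "u \<in> integer_kernel A \<Longrightarrow> monomial (pos_part u) - monomial (pos_part (- u)) \<in> toric_ideal A"
  unfolding toric_ideal_def by (intro subsetD[OF mpoly.genideal_self]) auto

lemma toric_ideal_minimal: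
  assumes "ideal J mpoly_ring"
    and "\<And>u. u \<in> integer_kernel A \<Longrightarrow> monomial (pos_part u) - monomial (pos_part (- u)) \<in> J"
  shows "toric_ideal A \<subseteq> J"
  unfolding toric_ideal_def by (rule mpoly.genideal_minimal) (use assms in auto)

lemma lookup_pos_part [simp]: "Poly_Mapping.lookup (pos_part u) i = nat (u $ i)"
  by (simp add: pos_part_def)

lemma mpoly_induct [case_names single add]:
  fixes p :: "('v, 'k::field) mpoly"
  assumes "\<And>e c. P (Poly_Mapping.single e c)" and "\<And>p q. P p \<Longrightarrow> P q \<Longrightarrow> P (p + q)"
  shows "P p"
proof (induction p rule: update_induct)
  case const
  then show ?case using assms(1)[of 0 0] by simp
next
  case (update f a b)
  have "Poly_Mapping.update a b f = f + Poly_Mapping.single a b"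
    using update(1) by (intro poly_mapping_eqI) (auto simp: lookup_update lookup_add lookup_single in_keys_iff)
  then show ?case using assms update(3) by simp
qed

section \<open>Homogeneous components\<close>

definition homogeneous_component :: "int^'n^'m \<Rightarrow> int^'m \<Rightarrow> ('n::finite, 'k::field) mpoly \<Rightarrow> ('n, 'k) mpoly"
  where "homogeneous_component A d p = Abs_poly_mapping (\<lambda>e. Poly_Mapping.lookup p e when exp_degree A e = d)"

lemma lookup_homogeneous_component:
  "Poly_Mapping.lookup (homogeneous_component A d p) e = (Poly_Mapping.lookup p e when exp_degree A e = d)"
proof -
  have "finite {e. (Poly_Mapping.lookup p e when exp_degree A e = d) \<noteq> 0}"
    by (rule finite_subset[OF _ finite_keys[of p]]) (auto simp: in_keys_iff)
  then show ?thesis by (simp add: homogeneous_component_def)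
qed

lemma mpoly_grading_iff: "p \<in> mpoly_grading A d \<longleftrightarrow> (\<forall>e. Poly_Mapping.lookup p e \<noteq> 0 \<longrightarrow> exp_degree A e = d)"
  by (auto simp: mpoly_grading_def in_keys_iff)

lemma homogeneous_component_in: "homogeneous_component A d p \<in> mpoly_grading A d"
  by (auto simp: mpoly_grading_iff lookup_homogeneous_component)

lemma homogeneous_component_of:
  "p \<in> mpoly_grading A c \<Longrightarrow> homogeneous_component A d p = (if d = c then p else 0)"
  by (intro poly_mapping_eqI) (auto simp: mpoly_grading_iff lookup_homogeneous_component when_def)

lemma homogeneous_component_0 [simp]: "homogeneous_component A d 0 = 0"
  by (intro poly_mapping_eqI) (simp add: lookup_homogeneous_component)

lemma homogeneous_component_add:
  "homogeneous_component A d (p + q) = homogeneous_component A d p + homogeneous_component A d q"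
  by (intro poly_mapping_eqI) (simp add: lookup_homogeneous_component lookup_add when_add_distrib)

lemma homogeneous_component_diff:
  "homogeneous_component A d (p - q) = homogeneous_component A d p - homogeneous_component A d q"
  by (intro poly_mapping_eqI) (simp add: lookup_homogeneous_component lookup_minus when_diff_distrib)

lemma finite_homogeneous_components: "finite {d. homogeneous_component A d p \<noteq> 0}"
proof (rule finite_subset[OF _ finite_imageI[OF finite_keys[of p], of "exp_degree A"]], rule subsetI)
  fix d assume "d \<in> {d. homogeneous_component A d p \<noteq> 0}"
  then obtain e where "Poly_Mapping.lookup (homogeneous_component A d p) e \<noteq> 0"
    by (metis (mono_tags, lifting) lookup_zero mem_Collect_eq poly_mapping_eqI)
  then show "d \<in> exp_degree A ` Poly_Mapping.keys p"
    by (auto simp: lookup_homogeneous_component in_keys_iff when_def split: if_splits)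
qed

text \<open>The degrees are indexed through an injection \<open>\<delta>\<close> because, in a shifted module, the component of
  degree \<open>d - c\<close> contributes to degree \<open>d\<close>.\<close>

lemma sum_homogeneous_components:
  assumes "finite X" and inj: "inj_on \<delta> X"
    and "\<And>d. homogeneous_component A d p \<noteq> 0 \<Longrightarrow> d \<in> \<delta> ` X"
  shows "(\<Sum>d\<in>X. homogeneous_component A (\<delta> d) p) = p"
proof (rule poly_mapping_eqI)
  fix e
  have "Poly_Mapping.lookup (\<Sum>d\<in>X. homogeneous_component A (\<delta> d) p) e =
      (\<Sum>d\<in>X. Poly_Mapping.lookup p e when exp_degree A e = \<delta> d)"
    by (simp add: lookup_sum lookup_homogeneous_component)
  also have "\<dots> = Poly_Mapping.lookup p e"
  proof (cases "Poly_Mapping.lookup p e = 0")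
    case False
    then have "Poly_Mapping.lookup (homogeneous_component A (exp_degree A e) p) e \<noteq> 0"
      by (simp add: lookup_homogeneous_component)
    then have "homogeneous_component A (exp_degree A e) p \<noteq> 0" by (metis lookup_zero)
    then obtain d where d: "d \<in> X" "exp_degree A e = \<delta> d" using assms(3) by blast
    have "(\<Sum>d'\<in>X. Poly_Mapping.lookup p e when exp_degree A e = \<delta> d') = (\<Sum>d'\<in>X. if d' = d then Poly_Mapping.lookup p e else 0)"
      by (rule sum.cong) (use d inj in \<open>auto simp: when_def inj_on_def\<close>)
    then show ?thesis using d assms(1) by simp
  qed simp
  finally show "Poly_Mapping.lookup (\<Sum>d\<in>X. homogeneous_component A (\<delta> d) p) e = Poly_Mapping.lookup p e" .
qed

lemma exp_degree_0 [simp]: "exp_degree A 0 = 0"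
  by (simp add: exp_degree_def)

lemma exp_degree_add: "exp_degree A (e + e') = exp_degree A e + exp_degree A e'"
  by (simp add: exp_degree_def lookup_add vector_sadd_rdistrib sum.distrib)

lemma exp_degree_in_semigroup: "exp_degree A e \<in> semigroup_NA A"
  by (auto simp: exp_degree_def semigroup_NA_def)

lemma semigroup_NA_0: "0 \<in> semigroup_NA A"
  using exp_degree_in_semigroup[of A 0] by simp

lemma semigroup_NA_add:
  assumes "c \<in> semigroup_NA A" "d \<in> semigroup_NA A"
  shows "c + d \<in> semigroup_NA A"
proof -
  obtain k l where "c = (\<Sum>j\<in>UNIV. int (k j) *s column j A)" "d = (\<Sum>j\<in>UNIV. int (l j) *s column j A)"
    using assms by (auto simp: semigroup_NA_def)
  then have "c + d = (\<Sum>j\<in>UNIV. int (k j + l j) *s column j A)"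
    by (simp add: vector_sadd_rdistrib sum.distrib)
  then show ?thesis unfolding semigroup_NA_def by (intro CollectI exI[of _ "\<lambda>j. k j + l j"]) simp
qed

lemma homogeneous_component_outside: "d \<notin> semigroup_NA A \<Longrightarrow> homogeneous_component A d p = 0"
  using exp_degree_in_semigroup by (intro poly_mapping_eqI) (force simp: lookup_homogeneous_component when_def)

lemma mpoly_grading_0 [simp]: "0 \<in> mpoly_grading A d"
  by (simp add: mpoly_grading_iff)

lemma mpoly_grading_add: "p \<in> mpoly_grading A d \<Longrightarrow> q \<in> mpoly_grading A d \<Longrightarrow> p + q \<in> mpoly_grading A d"
  using keys_add[of p q] by (auto simp: mpoly_grading_def)

lemma mpoly_grading_uminus: "p \<in> mpoly_grading A d \<Longrightarrow> - p \<in> mpoly_grading A d"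
  by (simp add: mpoly_grading_iff)

lemma mpoly_grading_diff: "p \<in> mpoly_grading A d \<Longrightarrow> q \<in> mpoly_grading A d \<Longrightarrow> p - q \<in> mpoly_grading A d"
  using keys_diff[of p q] by (auto simp: mpoly_grading_def)

lemma mpoly_grading_mult:
  "p \<in> mpoly_grading A c \<Longrightarrow> q \<in> mpoly_grading A d \<Longrightarrow> p * q \<in> mpoly_grading A (c + d)"
  using keys_mult[of p q] by (fastforce simp: mpoly_grading_def exp_degree_add)

lemma homogeneous_component_single_mult:
  "homogeneous_component A d (Poly_Mapping.single e c * q) =
    Poly_Mapping.single e c * homogeneous_component A (d - exp_degree A e) q"
proof (induction q rule: mpoly_induct)
  case (single e' c')
  then show ?case
    by (intro poly_mapping_eqI)
      (auto simp: mult_single lookup_homogeneous_component lookup_single when_def exp_degree_add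
        homogeneous_component_of[of "Poly_Mapping.single e' c'" A "exp_degree A e'"] mpoly_grading_iff algebra_simps)
qed (simp add: homogeneous_component_add ring_distribs)

text \<open>Both terms of a generating binomial have the same degree, since their exponents differ by a
  kernel vector; and multiplication by a monomial shifts homogeneous components.\<close>

lemma toric_ideal_homogeneous:
  fixes p :: "('n::finite, 'k::field) mpoly"
  assumes "p \<in> toric_ideal A"
  shows "homogeneous_component A d p \<in> toric_ideal A"
proof -
  let ?I = "toric_ideal A :: ('n, 'k) mpoly set"
  note I = mpoly_ideal[OF ideal_toric]
  have "?I \<subseteq> {p. \<forall>d. homogeneous_component A d p \<in> ?I}"
  proof (rule toric_ideal_minimal)
    show "ideal {p. \<forall>d. homogeneous_component A d p \<in> ?I} mpoly_ring"
    proof (rule ideal_mpoly_ringI)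
      fix p q :: "('n, 'k) mpoly" assume q: "q \<in> {p. \<forall>d. homogeneous_component A d p \<in> ?I}"
      then show "p * q \<in> {p. \<forall>d. homogeneous_component A d p \<in> ?I}"
        by (induction p rule: mpoly_induct)
          (simp_all add: I homogeneous_component_single_mult homogeneous_component_add ring_distribs)
    qed (simp_all add: I homogeneous_component_add)
    fix u assume u: "u \<in> integer_kernel A"
    have "exp_degree A (pos_part u) - exp_degree A (pos_part (- u)) = (\<Sum>j\<in>UNIV. u $ j *s column j A)"
      unfolding exp_degree_def lookup_pos_part sum_subtractf[symmetric]
      by (rule sum.cong) (auto simp: vec_eq_iff algebra_simps)
    also have "\<dots> = A *v u"
      by (simp add: vec_eq_iff matrix_vector_mult_def column_def mult.commute)
    finally have "exp_degree A (pos_part u) = exp_degree A (pos_part (- u))"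
      using u by (simp add: integer_kernel_def)
    then have "monomial (pos_part u) - monomial (pos_part (- u)) \<in> (mpoly_grading A (exp_degree A (pos_part u)) :: ('n, 'k) mpoly set)"
      by (intro mpoly_grading_diff) (auto simp: mpoly_grading_def monomial_def)
    then show "monomial (pos_part u) - monomial (pos_part (- u)) \<in> {p. \<forall>d. homogeneous_component A d p \<in> ?I}"
      by (simp add: homogeneous_component_of I(1) binomial_in_toric_ideal[OF u])
  qed
  then show ?thesis using assms by blast
qed

section \<open>Gradings\<close>

lemma additive_subgroupI:
  assumes "abelian_group G" "H \<subseteq> carrier G" "\<zero>\<^bsub>G\<^esub> \<in> H"
    and "\<And>x y. x \<in> H \<Longrightarrow> y \<in> H \<Longrightarrow> x \<oplus>\<^bsub>G\<^esub> y \<in> H" "\<And>x. x \<in> H \<Longrightarrow> \<ominus>\<^bsub>G\<^esub> x \<in> H"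
  shows "additive_subgroup H G"
proof (rule additive_subgroup.intro, rule group.subgroupI)
  show "group (add_monoid G)" using assms(1) by (rule abelian_group.a_group)
  show "inv\<^bsub>add_monoid G\<^esub> x \<in> H" if "x \<in> H" for x
    using assms(5)[OF that] unfolding a_inv_def .
qed (use assms in auto)

lemma additive_subgroup_finsum:
  assumes "abelian_group G" and H: "additive_subgroup H G" and f: "\<And>j. j \<in> J \<Longrightarrow> f j \<in> H"
  shows "(\<Oplus>\<^bsub>G\<^esub>j\<in>J. f j) \<in> H"
proof -
  interpret abelian_group G by fact
  have sub: "H \<subseteq> carrier G" by (rule additive_subgroup.a_subset[OF H])
  show ?thesis
    using f
  proof (induction J rule: infinite_finite_induct)
    case (insert j J)
    then have "f \<in> J \<rightarrow> carrier G" "f j \<in> carrier G" using sub by auto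
    then show ?case using insert additive_subgroup.a_closed[OF H] by simp
  qed (simp_all add: additive_subgroup.zero_closed[OF H])
qed

lemma generate_additive_subgroup:
  assumes "abelian_group G" "X \<subseteq> carrier G"
  shows "additive_subgroup (generate (add_monoid G) X) G"
  using assms by (intro additive_subgroup.intro group.generate_is_subgroup abelian_group.a_group) auto

lemma generate_least:
  assumes "abelian_group G" "additive_subgroup H G" "X \<subseteq> H"
  shows "generate (add_monoid G) X \<subseteq> H"
  using assms by (intro group.generate_subgroup_incl abelian_group.a_group additive_subgroup.a_subgroup)

lemma tensor_grading_pure:
  "c \<in> \<Gamma> \<Longrightarrow> x \<in> Mg c \<Longrightarrow> d \<in> \<Delta> \<Longrightarrow> s \<in> Sg d \<Longrightarrow>
    pure_tensor R S \<phi> M x s \<in> tensor_grading R S \<phi> M \<Gamma> Mg \<Delta> Sg (c + d)"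
  unfolding tensor_grading_def pure_tensor_def by (intro generate.incl) blast

text \<open>A family of additive projections onto the homogeneous parts gives existence and uniqueness of
  the homogeneous decomposition at once: applying the projection to any decomposition of \<open>x\<close>
  singles out one of its terms.\<close>

lemma graded_moduleI:
  assumes M: "Module.module R M"
    and sub: "\<And>d. d \<in> \<Gamma> \<Longrightarrow> additive_subgroup (Mg d) M"
    and smult: "\<And>c d a x. c \<in> \<Gamma> \<Longrightarrow> d \<in> \<Gamma> \<Longrightarrow> a \<in> Rg c \<Longrightarrow> x \<in> Mg d \<Longrightarrow> a \<odot>\<^bsub>M\<^esub> x \<in> Mg (c + d)"
    and pr_in: "\<And>d x. d \<in> \<Gamma> \<Longrightarrow> x \<in> carrier M \<Longrightarrow> pr d x \<in> Mg d"
    and pr_outside: "\<And>d x. d \<notin> \<Gamma> \<Longrightarrow> x \<in> carrier M \<Longrightarrow> pr d x = \<zero>\<^bsub>M\<^esub>"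
    and pr_add: "\<And>d x y. x \<in> carrier M \<Longrightarrow> y \<in> carrier M \<Longrightarrow> pr d (x \<oplus>\<^bsub>M\<^esub> y) = pr d x \<oplus>\<^bsub>M\<^esub> pr d y"
    and pr_of: "\<And>c d x. c \<in> \<Gamma> \<Longrightarrow> x \<in> Mg c \<Longrightarrow> pr d x = (if d = c then x else \<zero>\<^bsub>M\<^esub>)"
    and finite: "\<And>x. x \<in> carrier M \<Longrightarrow> finite {d. pr d x \<noteq> \<zero>\<^bsub>M\<^esub>}"
    and expansion: "\<And>x. x \<in> carrier M \<Longrightarrow> x = (\<Oplus>\<^bsub>M\<^esub>d\<in>{d. pr d x \<noteq> \<zero>\<^bsub>M\<^esub>}. pr d x)"
  shows "graded_module R \<Gamma> Rg M Mg"
  unfolding graded_module_def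
proof (intro conjI ballI)
  interpret Module.module R M by fact
  have carrier: "x \<in> carrier M" if "d \<in> \<Gamma>" "x \<in> Mg d" for d x
    using additive_subgroup.a_subset[OF sub[OF that(1)]] that(2) by blast
  have pr_closed: "pr d x \<in> carrier M" if "x \<in> carrier M" for d x
    using that pr_in[of d x] pr_outside[of d x] carrier[of d] by (cases "d \<in> \<Gamma>") auto
  fix x assume x: "x \<in> carrier M"
  show "\<exists>!f. (\<forall>d\<in>\<Gamma>. f d \<in> Mg d) \<and> (\<forall>d. d \<notin> \<Gamma> \<longrightarrow> f d = \<zero>\<^bsub>M\<^esub>) \<and>
        finite {d. f d \<noteq> \<zero>\<^bsub>M\<^esub>} \<and> x = (\<Oplus>\<^bsub>M\<^esub>d\<in>{d. f d \<noteq> \<zero>\<^bsub>M\<^esub>}. f d)"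
  proof (rule ex1I[of _ "\<lambda>d. pr d x"], intro conjI ballI allI impI)
    fix f assume f: "(\<forall>d\<in>\<Gamma>. f d \<in> Mg d) \<and> (\<forall>d. d \<notin> \<Gamma> \<longrightarrow> f d = \<zero>\<^bsub>M\<^esub>) \<and>
        finite {d. f d \<noteq> \<zero>\<^bsub>M\<^esub>} \<and> x = (\<Oplus>\<^bsub>M\<^esub>d\<in>{d. f d \<noteq> \<zero>\<^bsub>M\<^esub>}. f d)"
    define D where "D = {d. f d \<noteq> \<zero>\<^bsub>M\<^esub>}"
    have D: "finite D" "D \<subseteq> \<Gamma>" using f by (auto simp: D_def)
    have fc: "f d \<in> carrier M" if "d \<in> D" for d using that D f carrier by blast
    show "f = (\<lambda>d. pr d x)"
    proof
      fix c
      have "pr c x = pr c (\<Oplus>\<^bsub>M\<^esub>d\<in>D. f d)" using f by (simp add: D_def)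
      also have "\<dots> = (\<Oplus>\<^bsub>M\<^esub>d\<in>D. pr c (f d))"
        by (rule additive_finsum[OF M.abelian_group_axioms M.abelian_group_axioms])
          (use fc pr_closed pr_add in auto)
      also have "\<dots> = (\<Oplus>\<^bsub>M\<^esub>d\<in>D. if c = d then f d else \<zero>\<^bsub>M\<^esub>)"
        by (rule M.finsum_cong') (use fc D f pr_of in auto)
      also have "\<dots> = f c"
      proof (cases "c \<in> D")
        case True
        show ?thesis by (rule M.finsum_singleton) (use True D fc in auto)
      next
        case False
        have "(\<Oplus>\<^bsub>M\<^esub>d\<in>D. if c = d then f d else \<zero>\<^bsub>M\<^esub>) = (\<Oplus>\<^bsub>M\<^esub>d\<in>D. \<zero>\<^bsub>M\<^esub>)"
          by (rule M.finsum_cong') (use False in auto)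
        then show ?thesis using False by (simp add: D_def)
      qed
      finally show "f c = pr c x" ..
    qed
  qed (use x pr_in pr_outside finite expansion in auto)
qed (use M sub smult in auto)

text \<open>Taking components of a representative induces the projections on the quotient, because the
  components of an element of \<open>I\<close> lie in \<open>I\<close>.\<close>

lemma graded_module_quotient:
  fixes I :: "('n::finite, 'k::field) mpoly set"
  assumes I: "ideal I mpoly_ring"
    and homogeneous: "\<And>p d. p \<in> I \<Longrightarrow> homogeneous_component A d p \<in> I"
  shows "graded_module mpoly_ring (semigroup_NA A) (mpoly_grading A) (quotient_module mpoly_ring I)
    (\<lambda>d. (\<lambda>p. I +>\<^bsub>mpoly_ring\<^esub> p) ` mpoly_grading A d)"
proof -
  interpret I: quotient_by_ideal I "mpoly_ring :: ('n, 'k) mpoly ring"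
    using I by (rule quotient_by_ideal.intro)
  interpret Q: Module.module "mpoly_ring :: ('n, 'k) mpoly ring" I.quot
    by (rule I.module_quotient_module[OF cring_mpoly_ring])
  let ?cl = "\<lambda>p. I +>\<^bsub>mpoly_ring\<^esub> p"
  have carrier: "carrier I.quot = range ?cl" by (simp add: I.carrier_quotient_module)
  have eq: "?cl p = ?cl q \<longleftrightarrow> p - q \<in> I" for p q using I.quotient_module_coset_eq_iff[of p q] by simp
  have add: "?cl p \<oplus>\<^bsub>I.quot\<^esub> ?cl q = ?cl (p + q)" for p q using I.coset_add[of p q] by simp
  have smult: "p \<odot>\<^bsub>I.quot\<^esub> ?cl q = ?cl (p * q)" for p q using I.coset_smult[of p q] by simp
  have zero: "?cl p = \<zero>\<^bsub>I.quot\<^esub> \<longleftrightarrow> p \<in> I" for p using I.coset_zero[of p] by simp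
  have zero0: "\<zero>\<^bsub>I.quot\<^esub> = ?cl 0" using zero[of 0] mpoly_ideal(1)[OF I] by simp
  define pr where "pr d X = ?cl (homogeneous_component A d (SOME p. X = ?cl p))" for d X
  have pr: "pr d (?cl p) = ?cl (homogeneous_component A d p)" for d p
  proof -
    define r where "r = (SOME q. ?cl p = ?cl q)"
    have "?cl p = ?cl r" unfolding r_def by (rule someI[of _ p]) simp
    then have "r - p \<in> I" using eq by metis
    then have "homogeneous_component A d r - homogeneous_component A d p \<in> I"
      using homogeneous[of "r - p" d] by (simp add: homogeneous_component_diff)
    then show ?thesis using eq by (simp add: pr_def r_def)
  qed
  show ?thesis
  proof (rule graded_moduleI[where pr = pr])
    show "additive_subgroup (?cl ` mpoly_grading A d) I.quot" for d
    proof (rule additive_subgroupI)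
      show "x \<oplus>\<^bsub>I.quot\<^esub> y \<in> ?cl ` mpoly_grading A d" if "x \<in> ?cl ` mpoly_grading A d" "y \<in> ?cl ` mpoly_grading A d" for x y
        using that mpoly_grading_add by (fastforce simp: add)
      show "\<ominus>\<^bsub>I.quot\<^esub> x \<in> ?cl ` mpoly_grading A d" if "x \<in> ?cl ` mpoly_grading A d" for x
      proof -
        obtain p where p: "p \<in> mpoly_grading A d" "x = ?cl p" using \<open>x \<in> _\<close> by blast
        have "\<ominus>\<^bsub>I.quot\<^esub> x = ?cl (- p)"
          by (rule Q.M.minus_equality) (auto simp: p add zero0 carrier)
        then show ?thesis using mpoly_grading_uminus[OF p(1)] by simp
      qed
      show "\<zero>\<^bsub>I.quot\<^esub> \<in> ?cl ` mpoly_grading A d" unfolding zero0 by (rule imageI) simp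
    qed (auto simp: carrier Q.M.abelian_group_axioms)
    show "pr d X \<in> ?cl ` mpoly_grading A d" if "X \<in> carrier I.quot" for d X
      using that by (auto simp: carrier pr intro!: imageI homogeneous_component_in)
    show "pr d X = \<zero>\<^bsub>I.quot\<^esub>" if "d \<notin> semigroup_NA A" "X \<in> carrier I.quot" for d X
      using that(2) by (auto simp: carrier pr zero0 homogeneous_component_outside[OF that(1)])
    show "pr d (X \<oplus>\<^bsub>I.quot\<^esub> Y) = pr d X \<oplus>\<^bsub>I.quot\<^esub> pr d Y" if "X \<in> carrier I.quot" "Y \<in> carrier I.quot" for d X Y
      using that by (auto simp: carrier pr add homogeneous_component_add)
    show "pr d X = (if d = c then X else \<zero>\<^bsub>I.quot\<^esub>)" if "X \<in> ?cl ` mpoly_grading A c" for c d X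
      using that by (auto simp: pr homogeneous_component_of zero0)
    show "finite {d. pr d X \<noteq> \<zero>\<^bsub>I.quot\<^esub>}" if X: "X \<in> carrier I.quot" for X
    proof -
      obtain p where p: "X = ?cl p" using X by (auto simp: carrier)
      show ?thesis
        by (rule finite_subset[OF _ finite_homogeneous_components[of A p]]) (auto simp: p pr zero0)
    qed
    show "X = (\<Oplus>\<^bsub>I.quot\<^esub>d\<in>{d. pr d X \<noteq> \<zero>\<^bsub>I.quot\<^esub>}. pr d X)" if X: "X \<in> carrier I.quot" for X
    proof -
      obtain p where p: "X = ?cl p" using X by (auto simp: carrier)
      let ?D = "{d. homogeneous_component A d p \<noteq> 0}"
      have "X = ?cl (\<Sum>d\<in>?D. homogeneous_component A d p)"
        using sum_homogeneous_components[of ?D "\<lambda>d. d" A p] finite_homogeneous_components[of A p] p by simp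
      also have "\<dots> = (\<Oplus>\<^bsub>I.quot\<^esub>d\<in>?D. ?cl (homogeneous_component A d p))"
        using additive_finsum[of mpoly_ring I.quot ?cl "\<lambda>d. homogeneous_component A d p" ?D]
          ring.is_abelian_group[OF cring.axioms(1)[OF cring_mpoly_ring]] Q.M.abelian_group_axioms
        by (simp add: carrier add)
      also have "\<dots> = (\<Oplus>\<^bsub>I.quot\<^esub>d\<in>{d. pr d X \<noteq> \<zero>\<^bsub>I.quot\<^esub>}. pr d X)"
        by (rule Q.M.add.finprod_mono_neutral_cong_right)
          (use finite_homogeneous_components[of A p] in \<open>auto simp: p pr zero0 carrier\<close>)
      finally show ?thesis .
    qed
  qed (auto simp: smult Q.module_axioms intro!: mpoly_grading_mult)
qed

text \<open>The degree \<open>dg e\<close> of each element of the homogeneous basis \<open>E\<close> is a parameter, since the grading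
  itself only asserts that some degree exists.\<close>

locale graded_free_tensor =
  free_tensor "mpoly_ring :: ('s::finite, 'k::field) mpoly ring" M "mpoly_ring :: ('n::finite, 'k::field) mpoly ring" \<phi> E
  for M :: "(('s::finite, 'k::field) mpoly, 'a) module"
    and \<phi> :: "('s::finite, 'k::field) mpoly \<Rightarrow> ('n::finite, 'k::field) mpoly" and E +
  fixes C :: "int^('s::finite)^'m" and A :: "int^('n::finite)^'m" and Mg :: "int^'m \<Rightarrow> 'a set" and dg :: "'a \<Rightarrow> int^'m"
  assumes graded: "graded_module mpoly_ring (semigroup_NA C) (mpoly_grading C) M Mg"
    and dg: "e \<in> E \<Longrightarrow> dg e \<in> semigroup_NA C" "e \<in> E \<Longrightarrow> e \<in> Mg (dg e)"
    and \<phi>_graded: "p \<in> mpoly_grading C d \<Longrightarrow> \<phi> p \<in> mpoly_grading A d"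
    and semigroup_incl: "semigroup_NA C \<subseteq> semigroup_NA A"
begin

abbreviation "Tg \<equiv> tensor_grading mpoly_ring mpoly_ring \<phi> M (semigroup_NA C) Mg (semigroup_NA A) (mpoly_grading A)"

lemma Mg_subgroup: "d \<in> semigroup_NA C \<Longrightarrow> additive_subgroup (Mg d) M"
  using graded by (simp add: graded_module_def)

lemma Mg_carrier: "d \<in> semigroup_NA C \<Longrightarrow> x \<in> Mg d \<Longrightarrow> x \<in> carrier M"
  using additive_subgroup.a_subset[OF Mg_subgroup] by blast

text \<open>Collecting the terms of equal degree in the expansion of \<open>x\<close> gives a homogeneous decomposition
  of \<open>x\<close>; another one consists of the single term \<open>x\<close>. The two agree, so all terms of degree other
  than \<open>c\<close> cancel and, by the uniqueness of coordinates, vanish.\<close>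

lemma homogeneous_coord:
  assumes c: "c \<in> semigroup_NA C" and x: "x \<in> Mg c" and e: "e \<in> E"
  shows "coord x e \<in> mpoly_grading C (c - dg e)"
proof -
  have xc: "x \<in> carrier M" using Mg_carrier c x by blast
  define a where "a d e = homogeneous_component C (d - dg e) (coord x e)" for d e
  \<comment> \<open>the terms of degree \<open>d\<close> in the expansion of \<open>x\<close>\<close>
  define f where "f d = (\<Oplus>\<^bsub>M\<^esub>e\<in>E. a d e \<odot>\<^bsub>M\<^esub> e)" for d
  have f_closed: "f d \<in> carrier M" for d unfolding f_def by (rule combination_closed) simp
  have coord_f: "coord (f d) e = a d e" if "e \<in> E" for d e
    unfolding f_def using that by (intro coord_combination) auto
  have a_NA: "d \<in> semigroup_NA C" "d - dg e \<in> semigroup_NA C" if "a d e \<noteq> 0" "e \<in> E" for d e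
  proof -
    show *: "d - dg e \<in> semigroup_NA C" using that homogeneous_component_outside a_def by metis
    show "d \<in> semigroup_NA C" using semigroup_NA_add[OF * dg(1)[OF that(2)]] by simp
  qed
  have f_in: "f d \<in> Mg d" if d: "d \<in> semigroup_NA C" for d
    unfolding f_def
  proof (rule additive_subgroup_finsum[OF M.abelian_group_axioms Mg_subgroup[OF d]])
    fix e assume e: "e \<in> E"
    show "a d e \<odot>\<^bsub>M\<^esub> e \<in> Mg d"
    proof (cases "a d e = 0")
      case True
      then show ?thesis
        using additive_subgroup.zero_closed[OF Mg_subgroup[OF d]] smult_l_null[OF basis_closed[OF e]] by simp
    next
      case False
      have "a d e \<odot>\<^bsub>M\<^esub> e \<in> Mg (d - dg e + dg e)"
        using graded a_NA(2)[OF False e] dg[OF e] homogeneous_component_in[of C "d - dg e" "coord x e"]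
        unfolding graded_module_def a_def by blast
      then show ?thesis by simp
    qed
  qed
  have f_outside: "f d = \<zero>\<^bsub>M\<^esub>" if "d \<notin> semigroup_NA C" for d
    by (rule coord_eqI) (use a_NA(1)[of d] that f_closed in \<open>auto simp: coord_f coord_zero\<close>)
  have f_zero: "f d = \<zero>\<^bsub>M\<^esub> \<Longrightarrow> e \<in> E \<Longrightarrow> a d e = 0" for d e
    using coord_f[of e d] coord_zero[of e] by simp
  have fin: "finite {d. f d \<noteq> \<zero>\<^bsub>M\<^esub>}"
  proof (rule finite_subset)
    show "{d. f d \<noteq> \<zero>\<^bsub>M\<^esub>} \<subseteq> (\<Union>e\<in>E. (\<lambda>d. d + dg e) ` {d. homogeneous_component C d (coord x e) \<noteq> 0})"
    proof
      fix d assume d: "d \<in> {d. f d \<noteq> \<zero>\<^bsub>M\<^esub>}"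
      have "\<exists>e\<in>E. a d e \<noteq> 0"
      proof (rule ccontr)
        assume "\<not> (\<exists>e\<in>E. a d e \<noteq> 0)"
        then have "f d = \<zero>\<^bsub>M\<^esub>" by (intro coord_eqI) (auto simp: coord_f coord_zero f_closed)
        then show False using d by simp
      qed
      then obtain e where "e \<in> E" "d - dg e \<in> {d. homogeneous_component C d (coord x e) \<noteq> 0}"
        by (auto simp: a_def)
      then show "d \<in> (\<Union>e\<in>E. (\<lambda>d. d + dg e) ` {d. homogeneous_component C d (coord x e) \<noteq> 0})"
        by (intro UN_I[of e] image_eqI[of _ _ "d - dg e"]) auto
    qed
  qed (auto intro: finite_homogeneous_components)
  have sum: "x = (\<Oplus>\<^bsub>M\<^esub>d\<in>{d. f d \<noteq> \<zero>\<^bsub>M\<^esub>}. f d)"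
  proof (rule coord_eqI[OF xc])
    fix e assume e: "e \<in> E"
    have "coord (\<Oplus>\<^bsub>M\<^esub>d\<in>{d. f d \<noteq> \<zero>\<^bsub>M\<^esub>}. f d) e = (\<Sum>d\<in>{d. f d \<noteq> \<zero>\<^bsub>M\<^esub>}. a d e)"
      using coord_finsum[of f "{d. f d \<noteq> \<zero>\<^bsub>M\<^esub>}" e] f_closed e by (simp add: coord_f)
    also have "\<dots> = coord x e"
      unfolding a_def
    proof (rule sum_homogeneous_components[OF fin])
      fix d assume "homogeneous_component C d (coord x e) \<noteq> 0"
      then have "a (d + dg e) e \<noteq> 0" by (simp add: a_def)
      then have "d + dg e \<in> {d. f d \<noteq> \<zero>\<^bsub>M\<^esub>}" using f_zero e by blast
      then show "d \<in> (\<lambda>d. d - dg e) ` {d. f d \<noteq> \<zero>\<^bsub>M\<^esub>}" by (intro image_eqI[of _ _ "d + dg e"]) auto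
    qed (auto simp: inj_on_def)
    finally show "coord x e = coord (\<Oplus>\<^bsub>M\<^esub>d\<in>{d. f d \<noteq> \<zero>\<^bsub>M\<^esub>}. f d) e" ..
  qed (auto simp: f_closed)
  define g where "g d = (if d = c then x else \<zero>\<^bsub>M\<^esub>)" for d
  have "{d. g d \<noteq> \<zero>\<^bsub>M\<^esub>} = (if x = \<zero>\<^bsub>M\<^esub> then {} else {c})" by (auto simp: g_def)
  then have g: "finite {d. g d \<noteq> \<zero>\<^bsub>M\<^esub>}" "x = (\<Oplus>\<^bsub>M\<^esub>d\<in>{d. g d \<noteq> \<zero>\<^bsub>M\<^esub>}. g d)"
    using xc by (auto simp: g_def)
  have g_in: "g d \<in> Mg d" if "d \<in> semigroup_NA C" for d
    using x additive_subgroup.zero_closed[OF Mg_subgroup[OF that]] by (simp add: g_def)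
  have g_out: "g d = \<zero>\<^bsub>M\<^esub>" if "d \<notin> semigroup_NA C" for d using c that by (auto simp: g_def)
  let ?P = "\<lambda>f. (\<forall>d\<in>semigroup_NA C. f d \<in> Mg d) \<and> (\<forall>d. d \<notin> semigroup_NA C \<longrightarrow> f d = \<zero>\<^bsub>M\<^esub>) \<and>
        finite {d. f d \<noteq> \<zero>\<^bsub>M\<^esub>} \<and> x = (\<Oplus>\<^bsub>M\<^esub>d\<in>{d. f d \<noteq> \<zero>\<^bsub>M\<^esub>}. f d)"
  have unique: "\<exists>!f. ?P f"
    using graded xc unfolding graded_module_def by (elim conjE) (rule bspec)
  have Pf: "?P f" by (intro conjI ballI allI impI f_in f_outside fin sum)
  have Pg: "?P g" by (intro conjI ballI allI impI g_in g_out g)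
  have "f = g"
    by (rule trans[OF sym[OF the1_equality[of ?P f, OF unique Pf]] the1_equality[of ?P g, OF unique Pg]])
  then have "a d e = 0" if "d \<noteq> c" for d using that f_zero e by (simp add: g_def)
  then have comp: "homogeneous_component C d (coord x e) = 0" if "d \<noteq> c - dg e" for d
    using that a_def[of "d + dg e" e] by (auto simp: algebra_simps)
  show ?thesis
    unfolding mpoly_grading_iff
  proof (intro allI impI)
    fix k assume k: "Poly_Mapping.lookup (coord x e) k \<noteq> 0"
    then have "homogeneous_component C (exp_degree C k) (coord x e) \<noteq> 0"
      using lookup_homogeneous_component[of C "exp_degree C k" "coord x e" k] by auto
    then show "exp_degree C k = c - dg e" using comp by blast
  qed
qed

lemma Tg_generators:
  "{cls (frag_of (x, s)) | x s c d'. c \<in> semigroup_NA C \<and> x \<in> Mg c \<and> d' \<in> semigroup_NA A \<and> s \<in> mpoly_grading A d' \<and> c + d' = d} \<subseteq> carrier T"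
  using pure_closed Mg_carrier by (auto simp: pure_tensor_def)

lemma Tg_subgroup: "additive_subgroup (Tg d) T"
  unfolding tensor_grading_def by (rule generate_additive_subgroup[OF abelian_group_T Tg_generators])

lemma Tg_least:
  assumes "additive_subgroup H T"
    and "\<And>x s c d'. c \<in> semigroup_NA C \<Longrightarrow> x \<in> Mg c \<Longrightarrow> d' \<in> semigroup_NA A \<Longrightarrow> s \<in> mpoly_grading A d' \<Longrightarrow>
          c + d' = d \<Longrightarrow> pure x s \<in> H"
  shows "Tg d \<subseteq> H"
  unfolding tensor_grading_def
  by (rule generate_least[OF abelian_group_T assms(1)]) (use assms(2) in \<open>auto simp: pure_tensor_def\<close>)

lemma tcoord_T_minus: "e \<in> E \<Longrightarrow> z \<in> carrier T \<Longrightarrow> tcoord e (\<ominus>\<^bsub>T\<^esub> z) = - tcoord e z"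
  using tcoord_add[of e "\<ominus>\<^bsub>T\<^esub> z" z] tcoord_finsum[of "\<lambda>_. \<zero>\<^bsub>T\<^esub>" "{}" e] by (simp add: T.l_neg eq_neg_iff_add_eq_0)

lemma tcoord_T_zero: "e \<in> E \<Longrightarrow> tcoord e \<zero>\<^bsub>T\<^esub> = 0"
  using tcoord_finsum[of "\<lambda>_. \<zero>\<^bsub>T\<^esub>" "{}" e] by simp

text \<open>Coordinates turn membership in a homogeneous part of the tensor product, which is defined by
  generators, into a condition on polynomials; this is what makes homogeneous decompositions
  unique.\<close>

lemma Tg_tcoord:
  assumes z: "z \<in> Tg d" and e: "e \<in> E"
  shows "tcoord e z \<in> mpoly_grading A (d - dg e)"
proof -
  have "Tg d \<subseteq> {z \<in> carrier T. tcoord e z \<in> mpoly_grading A (d - dg e)}"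
  proof (rule Tg_least)
    show "additive_subgroup {z \<in> carrier T. tcoord e z \<in> mpoly_grading A (d - dg e)} T"
      by (rule additive_subgroupI)
        (use e in \<open>auto simp: tcoord_T_zero tcoord_T_minus tcoord_add mpoly_grading_add mpoly_grading_uminus abelian_group_T\<close>)
    fix x c d' and s :: "('n, 'k) mpoly" assume a: "c \<in> semigroup_NA C" "x \<in> Mg c" "d' \<in> semigroup_NA A" "s \<in> mpoly_grading A d'" "c + d' = d"
    have x: "x \<in> carrier M" using a Mg_carrier by blast
    have "\<phi> (coord x e) * s \<in> mpoly_grading A (c - dg e + d')"
      using homogeneous_coord[OF a(1,2) e] \<phi>_graded a(4) by (intro mpoly_grading_mult)
    then show "pure x s \<in> {z \<in> carrier T. tcoord e z \<in> mpoly_grading A (d - dg e)}"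
      using x e a(5) by (auto simp: tcoord_pure algebra_simps)
  qed
  then show ?thesis using z by blast
qed

text \<open>The projection to degree \<open>d\<close> takes the component of degree \<open>d - dg e\<close> of the coordinate at each
  \<open>e\<close>.\<close>

theorem graded_module_tensor:
  "graded_module mpoly_ring (semigroup_NA A) (mpoly_grading A) T Tg"
proof -
  define pr where "pr d z = (\<Oplus>\<^bsub>T\<^esub>e\<in>E. pure e (homogeneous_component A (d - dg e) (tcoord e z)))" for d z
  have pr_closed [simp]: "pr d z \<in> carrier T" for d z unfolding pr_def by (intro T.finsum_closed) auto
  have tcoord_pr: "tcoord e (pr d z) = homogeneous_component A (d - dg e) (tcoord e z)" if "e \<in> E" for e d z
    unfolding pr_def using that by (intro tcoord_combination) auto
  have NA: "d \<in> semigroup_NA A" "d - dg e \<in> semigroup_NA A"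
    if "homogeneous_component A (d - dg e) p \<noteq> 0" "e \<in> E" for d e and p :: "('n, 'k) mpoly"
  proof -
    show *: "d - dg e \<in> semigroup_NA A" using that homogeneous_component_outside by metis
    show "d \<in> semigroup_NA A" using semigroup_NA_add[OF *, of "dg e"] dg(1)[OF that(2)] semigroup_incl by auto
  qed
  show ?thesis
  proof (rule graded_moduleI[where pr = pr])
    fix c d z and a :: "('n, 'k) mpoly" assume a: "c \<in> semigroup_NA A" "a \<in> mpoly_grading A c" and z: "z \<in> Tg d"
    have "Tg d \<subseteq> {z \<in> carrier T. a \<odot>\<^bsub>T\<^esub> z \<in> Tg (c + d)}"
    proof (rule Tg_least)
      show "additive_subgroup {z \<in> carrier T. a \<odot>\<^bsub>T\<^esub> z \<in> Tg (c + d)} T"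
      proof (rule additive_subgroupI)
        show "\<ominus>\<^bsub>T\<^esub> x \<in> {z \<in> carrier T. a \<odot>\<^bsub>T\<^esub> z \<in> Tg (c + d)}" if "x \<in> {z \<in> carrier T. a \<odot>\<^bsub>T\<^esub> z \<in> Tg (c + d)}" for x
          using that additive_subgroup.a_inv_closed[OF Tg_subgroup] T.smult_r_minus[of a x] abelian_group_T by auto
      qed (auto simp: abelian_group_T T.smult_r_distr additive_subgroup.a_closed[OF Tg_subgroup]
          T.smult_r_null additive_subgroup.zero_closed[OF Tg_subgroup] intro!: T.smult_closed)
      fix x c' d' and s :: "('n, 'k) mpoly" assume b: "c' \<in> semigroup_NA C" "x \<in> Mg c'" "d' \<in> semigroup_NA A" "s \<in> mpoly_grading A d'" "c' + d' = d"
      have x: "x \<in> carrier M" using b Mg_carrier by blast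
      have "pure x (a * s) \<in> Tg (c' + (c + d'))"
        using a b by (intro tensor_grading_pure semigroup_NA_add mpoly_grading_mult)
      then show "pure x s \<in> {z \<in> carrier T. a \<odot>\<^bsub>T\<^esub> z \<in> Tg (c + d)}"
        using x b(5) smult_pure[of a x s] by (auto simp: algebra_simps)
    qed
    then show "a \<odot>\<^bsub>T\<^esub> z \<in> Tg (c + d)" using z by blast
  next
    fix d z assume "d \<in> semigroup_NA A" "z \<in> carrier T"
    show "pr d z \<in> Tg d"
      unfolding pr_def
    proof (rule additive_subgroup_finsum[OF abelian_group_T Tg_subgroup])
      fix e assume e: "e \<in> E"
      show "pure e (homogeneous_component A (d - dg e) (tcoord e z)) \<in> Tg d"
      proof (cases "homogeneous_component A (d - dg e) (tcoord e z) = 0")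
        case True
        then show ?thesis
          using additive_subgroup.zero_closed[OF Tg_subgroup] pure_zero_right[OF basis_closed[OF e]] by simp
      next
        case False
        then have "pure e (homogeneous_component A (d - dg e) (tcoord e z)) \<in> Tg (dg e + (d - dg e))"
          by (intro tensor_grading_pure dg[OF e] NA(2)[OF False e] homogeneous_component_in)
        then show ?thesis by simp
      qed
    qed
  next
    fix d z assume "d \<notin> semigroup_NA A" "z \<in> carrier T"
    then show "pr d z = \<zero>\<^bsub>T\<^esub>"
      using NA(1)[of d] by (intro tcoord_eqI) (auto simp: tcoord_pr tcoord_T_zero)
  next
    fix d x y assume "x \<in> carrier T" "y \<in> carrier T"
    then show "pr d (x \<oplus>\<^bsub>T\<^esub> y) = pr d x \<oplus>\<^bsub>T\<^esub> pr d y"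
      by (intro tcoord_eqI) (auto simp: tcoord_pr tcoord_add homogeneous_component_add)
  next
    fix c d z assume "c \<in> semigroup_NA A" and z: "z \<in> Tg c"
    have "z \<in> carrier T" using z additive_subgroup.a_subset[OF Tg_subgroup] by blast
    then show "pr d z = (if d = c then z else \<zero>\<^bsub>T\<^esub>)"
      by (intro tcoord_eqI) (auto simp: tcoord_pr tcoord_T_zero homogeneous_component_of[OF Tg_tcoord[OF z]])
  next
    fix z assume z: "z \<in> carrier T"
    show fin: "finite {d. pr d z \<noteq> \<zero>\<^bsub>T\<^esub>}"
    proof (rule finite_subset)
      show "{d. pr d z \<noteq> \<zero>\<^bsub>T\<^esub>} \<subseteq> (\<Union>e\<in>E. (\<lambda>d. d + dg e) ` {d. homogeneous_component A d (tcoord e z) \<noteq> 0})"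
      proof
        fix d assume d: "d \<in> {d. pr d z \<noteq> \<zero>\<^bsub>T\<^esub>}"
        have "\<exists>e\<in>E. homogeneous_component A (d - dg e) (tcoord e z) \<noteq> 0"
        proof (rule ccontr)
          assume "\<not> (\<exists>e\<in>E. homogeneous_component A (d - dg e) (tcoord e z) \<noteq> 0)"
          then have "pr d z = \<zero>\<^bsub>T\<^esub>" by (intro tcoord_eqI) (auto simp: tcoord_pr tcoord_T_zero)
          then show False using d by simp
        qed
        then obtain e where "e \<in> E" "d - dg e \<in> {d. homogeneous_component A d (tcoord e z) \<noteq> 0}" by auto
        then show "d \<in> (\<Union>e\<in>E. (\<lambda>d. d + dg e) ` {d. homogeneous_component A d (tcoord e z) \<noteq> 0})"
          by (intro UN_I[of e] image_eqI[of _ _ "d - dg e"]) auto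
      qed
    qed (auto intro: finite_homogeneous_components)
    show "z = (\<Oplus>\<^bsub>T\<^esub>d\<in>{d. pr d z \<noteq> \<zero>\<^bsub>T\<^esub>}. pr d z)"
    proof (rule tcoord_eqI[OF z])
      fix e assume e: "e \<in> E"
      have "tcoord e (\<Oplus>\<^bsub>T\<^esub>d\<in>{d. pr d z \<noteq> \<zero>\<^bsub>T\<^esub>}. pr d z) =
          (\<Sum>d\<in>{d. pr d z \<noteq> \<zero>\<^bsub>T\<^esub>}. homogeneous_component A (d - dg e) (tcoord e z))"
        using tcoord_finsum[of "\<lambda>d. pr d z" "{d. pr d z \<noteq> \<zero>\<^bsub>T\<^esub>}" e] e by (simp add: tcoord_pr)
      also have "\<dots> = tcoord e z"
      proof (rule sum_homogeneous_components[OF fin])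
        fix d assume "homogeneous_component A d (tcoord e z) \<noteq> 0"
        then have "tcoord e (pr (d + dg e) z) \<noteq> 0" using e by (simp add: tcoord_pr)
        then have "d + dg e \<in> {d. pr d z \<noteq> \<zero>\<^bsub>T\<^esub>}" using tcoord_T_zero[OF e] by auto
        then show "d \<in> (\<lambda>d. d - dg e) ` {d. pr d z \<noteq> \<zero>\<^bsub>T\<^esub>}" by (intro image_eqI[of _ _ "d + dg e"]) auto
      qed (auto simp: inj_on_def)
      finally show "tcoord e z = tcoord e (\<Oplus>\<^bsub>T\<^esub>d\<in>{d. pr d z \<noteq> \<zero>\<^bsub>T\<^esub>}. pr d z)" ..
    qed auto
  qed (rule module_T Tg_subgroup)+
qed

theorem graded_free_module_tensor:
  "graded_free_module mpoly_ring (semigroup_NA A) (mpoly_grading A) T Tg"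
  unfolding graded_free_module_def
proof (intro conjI exI)
  show "module_basis mpoly_ring T ((\<lambda>e. pure e \<one>\<^bsub>mpoly_ring\<^esub>) ` E)"
    by (rule tensor_basis) simp
  show "(\<lambda>e. pure e \<one>\<^bsub>mpoly_ring\<^esub>) ` E \<subseteq> (\<Union>d\<in>semigroup_NA A. Tg d)"
  proof clarify
    fix e assume e: "e \<in> E"
    have "pure e 1 \<in> Tg (dg e + 0)"
      using dg[OF e] semigroup_NA_0 by (intro tensor_grading_pure) (auto simp: mpoly_grading_def)
    then show "pure e \<one>\<^bsub>mpoly_ring\<^esub> \<in> (\<Union>d\<in>semigroup_NA A. Tg d)"
      using dg(1)[OF e] semigroup_incl by auto
  qed
qed (rule graded_module_tensor)

end

text \<open>Compatibility with degrees needs to be checked on the defining generators only. The additional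
  map \<open>h\<close> covers the augmentation, which is an induced map followed by an isomorphism.\<close>

lemma (in tensor_linear_map) tmap_graded:
  assumes M: "\<And>d. d \<in> \<Gamma> \<Longrightarrow> Mg d \<subseteq> carrier M"
    and N: "\<And>d. d \<in> \<Gamma> \<Longrightarrow> Ng d \<subseteq> carrier N"
    and S: "\<And>d. d \<in> \<Delta> \<Longrightarrow> Sg d \<subseteq> carrier S"
    and H: "additive_subgroup H Q" and Q: "abelian_group Q"
    and h: "h \<in> carrier N.T \<rightarrow> carrier Q"
    and h_add: "\<And>u v. u \<in> carrier N.T \<Longrightarrow> v \<in> carrier N.T \<Longrightarrow> h (u \<oplus>\<^bsub>N.T\<^esub> v) = h u \<oplus>\<^bsub>Q\<^esub> h v"
    and pure: "\<And>x s c d. c \<in> \<Gamma> \<Longrightarrow> x \<in> Mg c \<Longrightarrow> d \<in> \<Delta> \<Longrightarrow> s \<in> Sg d \<Longrightarrow> c + d = e \<Longrightarrow> h (N.pure (f x) s) \<in> H"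
    and z: "z \<in> tensor_grading R S \<phi> M \<Gamma> Mg \<Delta> Sg e"
  shows "h (tmap z) \<in> H"
proof -
  have hc: "h u \<in> carrier Q" if "u \<in> carrier N.T" for u using h that by auto
  interpret Q: abelian_group Q by fact
  have zero: "h (tmap \<zero>\<^bsub>M.T\<^esub>) = \<zero>\<^bsub>Q\<^esub>"
    by (rule additive_zero[OF M.abelian_group_T Q, of "\<lambda>z. h (tmap z)"]) (auto simp: hc h_add tmap_add)
  have "tensor_grading R S \<phi> M \<Gamma> Mg \<Delta> Sg e \<subseteq> {z \<in> carrier M.T. h (tmap z) \<in> H}"
    unfolding tensor_grading_def
  proof (rule generate_least[OF M.abelian_group_T])
    show "additive_subgroup {z \<in> carrier M.T. h (tmap z) \<in> H} M.T"
    proof (rule additive_subgroupI)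
      show "\<ominus>\<^bsub>M.T\<^esub> x \<in> {z \<in> carrier M.T. h (tmap z) \<in> H}" if "x \<in> {z \<in> carrier M.T. h (tmap z) \<in> H}" for x
      proof -
        have x: "x \<in> carrier M.T" "h (tmap x) \<in> H" using that by auto
        have "h (tmap (\<ominus>\<^bsub>M.T\<^esub> x)) = \<ominus>\<^bsub>Q\<^esub> h (tmap x)"
          using x(1) zero h_add[of "tmap (\<ominus>\<^bsub>M.T\<^esub> x)" "tmap x"] tmap_add[of "\<ominus>\<^bsub>M.T\<^esub> x" x]
          by (intro Q.minus_equality[symmetric]) (simp_all add: M.T.l_neg hc)
        then show ?thesis using x abelian_group.a_inv_closed[OF M.abelian_group_T x(1)]
          additive_subgroup.a_inv_closed[OF H x(2)] by simp
      qed
      show "x \<oplus>\<^bsub>M.T\<^esub> y \<in> {z \<in> carrier M.T. h (tmap z) \<in> H}"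
        if "x \<in> {z \<in> carrier M.T. h (tmap z) \<in> H}" "y \<in> {z \<in> carrier M.T. h (tmap z) \<in> H}" for x y
        using that additive_subgroup.a_closed[OF H] by (auto simp: tmap_add h_add)
      show "\<zero>\<^bsub>M.T\<^esub> \<in> {z \<in> carrier M.T. h (tmap z) \<in> H}"
        using zero additive_subgroup.zero_closed[OF H] by simp
    qed (auto intro: M.abelian_group_T)
    show "{M.cls (frag_of (x, s)) |x s c d. c \<in> \<Gamma> \<and> x \<in> Mg c \<and> d \<in> \<Delta> \<and> s \<in> Sg d \<and> c + d = e} \<subseteq>
        {z \<in> carrier M.T. h (tmap z) \<in> H}"
    proof clarify
      fix x s c d assume a: "c \<in> \<Gamma>" "x \<in> Mg c" "d \<in> \<Delta>" "s \<in> Sg d" "e = c + d"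
      have "x \<in> carrier M" "s \<in> carrier S" using a M S by blast+
      then show "M.cls (frag_of (x, s)) \<in> carrier M.T \<and> h (tmap (M.cls (frag_of (x, s)))) \<in> H"
        using pure[OF a(1-4)] a(5) tmap_pure[of x s] M.pure_closed[of x s] by (simp add: pure_tensor_def)
    qed
  qed
  then show ?thesis using z by blast
qed

lemma graded_hom_linear: "graded_hom R \<Gamma> M Mg N Ng f \<Longrightarrow> linear_map R M N f"
  by (simp add: graded_hom_def linear_map_def)

lemma graded_hom_degree: "graded_hom R \<Gamma> M Mg N Ng f \<Longrightarrow> d \<in> \<Gamma> \<Longrightarrow> x \<in> Mg d \<Longrightarrow> f x \<in> Ng d"
  unfolding graded_hom_def by blast

lemma graded_module_component: "graded_module R \<Gamma> Rg M Mg \<Longrightarrow> d \<in> \<Gamma> \<Longrightarrow> Mg d \<subseteq> carrier M"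
  using additive_subgroup.a_subset by (fastforce simp: graded_module_def)

section \<open>Pulling back monomials\<close>

text \<open>The exponent of the image of \<open>y\<^sup>e\<close> under the map that sends \<open>y\<^sub>b\<close> to the product, over the fibre
  of \<open>\<beta>\<close> at \<open>b\<close>, of the variables \<open>x\<^sub>i\<close> with multiplicities \<open>w i\<close>.\<close>

definition pullback_exp :: "('n::finite \<Rightarrow> 's) \<Rightarrow> ('n \<Rightarrow> nat) \<Rightarrow> ('s \<Rightarrow>\<^sub>0 nat) \<Rightarrow> ('n \<Rightarrow>\<^sub>0 nat)"
  where "pullback_exp \<beta> w e = Abs_poly_mapping (\<lambda>i. Poly_Mapping.lookup e (\<beta> i) * w i)"

lemma lookup_pullback_exp [simp]:
  "Poly_Mapping.lookup (pullback_exp \<beta> w e) i = Poly_Mapping.lookup e (\<beta> i) * w i"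
  by (simp add: pullback_exp_def)

lemma pullback_exp_add: "pullback_exp \<beta> w (e + e') = pullback_exp \<beta> w e + pullback_exp \<beta> w e'"
  by (intro poly_mapping_eqI) (simp add: lookup_add algebra_simps)

lemma pullback_exp_0 [simp]: "pullback_exp \<beta> w 0 = 0"
  by (intro poly_mapping_eqI) simp

definition pullback :: "('n::finite \<Rightarrow> 's) \<Rightarrow> ('n \<Rightarrow> nat) \<Rightarrow> ('s, 'k::field) mpoly \<Rightarrow> ('n, 'k) mpoly"
  where "pullback \<beta> w p = (\<Sum>e\<in>Poly_Mapping.keys p. Poly_Mapping.single (pullback_exp \<beta> w e) (Poly_Mapping.lookup p e))"

lemma pullback_single [simp]:
  "pullback \<beta> w (Poly_Mapping.single e c) = Poly_Mapping.single (pullback_exp \<beta> w e) c"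
  by (simp add: pullback_def)

lemma pullback_add: "pullback \<beta> w (p + q) = pullback \<beta> w p + pullback \<beta> w q"
  unfolding pullback_def
  by (rule setsum_keys_plus_distrib) (simp_all add: single_add)

lemma pullback_0 [simp]: "pullback \<beta> w 0 = 0"
  by (simp add: pullback_def)

lemma pullback_diff: "pullback \<beta> w (p - q) = pullback \<beta> w p - pullback \<beta> w q"
  using pullback_add[of \<beta> w "p - q" q] by (simp add: algebra_simps)

lemma pullback_mult: "pullback \<beta> w (p * q) = pullback \<beta> w p * pullback \<beta> w q"
proof (induction p rule: mpoly_induct)
  case (single e c)
  show ?case
    by (induction q rule: mpoly_induct) (simp_all add: mult_single pullback_exp_add pullback_add ring_distribs)
qed (simp add: pullback_add ring_distribs)

lemma pullback_1 [simp]: "pullback \<beta> w 1 = 1"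
  using pullback_single[of \<beta> w 0 1] by simp

lemma pullback_ring_hom: "pullback \<beta> w \<in> ring_hom mpoly_ring mpoly_ring"
  by (simp add: ring_hom_def pullback_mult pullback_add)

lemma monomial_power: "monomial e ^ k = monomial (\<Sum>_<k. e)"
  by (induction k) (simp_all add: monomial_def mult_single add.commute)

lemma monomial_prod: "(\<Prod>b\<in>X. monomial (g b)) = monomial (\<Sum>b\<in>X. g b)"
  by (induction X rule: infinite_finite_induct) (simp_all add: monomial_def mult_single)

text \<open>The vectors of different bouquets have disjoint supports, so in the product of the substituted
  monomials each variable \<open>x\<^sub>i\<close> receives its exponent from the bouquet \<open>\<beta> i\<close> alone.\<close>

lemma substitution_monomials:
  assumes "\<And>b i. Poly_Mapping.lookup (g b) i = (if \<beta> i = b then w i else 0)"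
  shows "substitution (\<lambda>b. monomial (g b)) = (pullback \<beta> w :: ('s, 'k::field) mpoly \<Rightarrow> ('n::finite, 'k) mpoly)"
proof
  fix p :: "('s, 'k) mpoly"
  have "mpoly_const c * (\<Prod>b\<in>Poly_Mapping.keys e. monomial (g b) ^ Poly_Mapping.lookup e b) =
      Poly_Mapping.single (pullback_exp \<beta> w e) c" for c :: 'k and e
  proof -
    have "(\<Sum>b\<in>Poly_Mapping.keys e. \<Sum>_<Poly_Mapping.lookup e b. g b) = pullback_exp \<beta> w e"
    proof (rule poly_mapping_eqI)
      fix i
      have "Poly_Mapping.lookup (\<Sum>b\<in>Poly_Mapping.keys e. \<Sum>_<Poly_Mapping.lookup e b. g b) i =
          (\<Sum>b\<in>Poly_Mapping.keys e. if \<beta> i = b then Poly_Mapping.lookup e b * w i else 0)"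
        by (simp add: lookup_sum assms if_distrib cong: if_cong)
      then show "Poly_Mapping.lookup (\<Sum>b\<in>Poly_Mapping.keys e. \<Sum>_<Poly_Mapping.lookup e b. g b) i =
          Poly_Mapping.lookup (pullback_exp \<beta> w e) i"
        by (simp add: in_keys_iff)
    qed
    then show ?thesis
      by (simp add: monomial_power monomial_prod mpoly_const_def) (simp add: monomial_def mult_single)
  qed
  then show "substitution (\<lambda>b. monomial (g b)) p = pullback \<beta> w p"
    by (simp add: substitution_def pullback_def)
qed

section \<open>Dividing monomials along the bouquets\<close>

locale exponent_pullback =
  fixes \<beta> :: "'n::finite \<Rightarrow> 's::finite" and w :: "'n \<Rightarrow> nat"
  assumes surj: "surj \<beta>" and weight_pos: "w i > 0"
begin

text \<open>The exponents of monomials that are not divisible by the image of any variable \<open>y\<^sub>b\<close>; they index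
  the monomial basis of \<open>S\<close> over \<open>R\<close>.\<close>

definition reduced :: "('n \<Rightarrow>\<^sub>0 nat) \<Rightarrow> bool"
  where "reduced r \<longleftrightarrow> (\<forall>b. \<exists>i. \<beta> i = b \<and> Poly_Mapping.lookup r i < w i)"

text \<open>Divide by the image of each \<open>y\<^sub>b\<close> as often as possible: the quotient exponent at \<open>b\<close> is the
  least \<open>e i div w i\<close> over the fibre of \<open>b\<close>.\<close>

lemma division_exists: "\<exists>q r. reduced r \<and> e = pullback_exp \<beta> w q + r"
proof -
  define m where "m b = Min ((\<lambda>i. Poly_Mapping.lookup e i div w i) ` {i. \<beta> i = b})" for b
  have m_le: "m (\<beta> i) * w i \<le> Poly_Mapping.lookup e i" for i
  proof -
    have "m (\<beta> i) \<le> Poly_Mapping.lookup e i div w i" unfolding m_def by (rule Min_le) auto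
    then show ?thesis using weight_pos[of i] by (simp add: less_eq_div_iff_mult_less_eq)
  qed
  define q r where "q = Abs_poly_mapping m" and "r = e - pullback_exp \<beta> w q"
  have q: "Poly_Mapping.lookup q b = m b" for b by (simp add: q_def)
  have r: "Poly_Mapping.lookup r i = Poly_Mapping.lookup e i - m (\<beta> i) * w i" for i
    by (simp add: r_def lookup_minus q)
  have "\<exists>i. \<beta> i = b \<and> Poly_Mapping.lookup r i < w i" for b
  proof -
    have "{i. \<beta> i = b} \<noteq> {}" using surj by (metis (mono_tags) empty_iff mem_Collect_eq surjD)
    then have "m b \<in> (\<lambda>i. Poly_Mapping.lookup e i div w i) ` {i. \<beta> i = b}"
      unfolding m_def by (intro Min_in) auto
    then obtain i where i: "\<beta> i = b" "m b = Poly_Mapping.lookup e i div w i" by blast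
    have "Poly_Mapping.lookup r i = Poly_Mapping.lookup e i mod w i"
      using i by (simp add: r minus_div_mult_eq_mod)
    then show ?thesis using i weight_pos[of i] by auto
  qed
  moreover have "e = pullback_exp \<beta> w q + r"
    using m_le by (intro poly_mapping_eqI) (simp add: lookup_add r q)
  ultimately show ?thesis unfolding reduced_def by blast
qed

text \<open>Where the first remainder is small, \<open>r i < w i\<close>, comparing the exponents at \<open>i\<close> bounds the
  quotient of the second decomposition by that of the first; the situation is symmetric.\<close>

lemma division_unique:
  assumes "reduced r" "reduced r'"
  shows "pullback_exp \<beta> w q + r = pullback_exp \<beta> w q' + r' \<longleftrightarrow> q = q' \<and> r = r'"
proof
  have le: "Poly_Mapping.lookup q' b \<le> Poly_Mapping.lookup q b"
    if eq: "pullback_exp \<beta> w q + r = pullback_exp \<beta> w q' + r'" and r: "reduced r" for q r q' r' b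
  proof -
    obtain i where i: "\<beta> i = b" "Poly_Mapping.lookup r i < w i" using r by (auto simp: reduced_def)
    have "Poly_Mapping.lookup q b * w i + Poly_Mapping.lookup r i = Poly_Mapping.lookup q' b * w i + Poly_Mapping.lookup r' i"
      using arg_cong[OF eq, of "\<lambda>e. Poly_Mapping.lookup e i"] i by (simp add: lookup_add)
    then have "Poly_Mapping.lookup q' b * w i < (Poly_Mapping.lookup q b + 1) * w i" using i(2) by simp
    then show ?thesis by (simp only: mult_less_cancel2) simp
  qed
  assume eq: "pullback_exp \<beta> w q + r = pullback_exp \<beta> w q' + r'"
  have "q = q'" using le[OF eq assms(1)] le[OF eq[symmetric] assms(2)] by (intro poly_mapping_eqI antisym)
  then show "q = q' \<and> r = r'" using eq by simp
qed simp

text \<open>The coefficient in \<open>R\<close> of the basis element \<open>x\<^sup>r\<close>.\<close>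

definition remainder_coeff :: "('n \<Rightarrow>\<^sub>0 nat) \<Rightarrow> ('n, 'k::field) mpoly \<Rightarrow> ('s, 'k) mpoly"
  where "remainder_coeff r p = Poly_Mapping.map_key (\<lambda>q. pullback_exp \<beta> w q + r) p"

lemma lookup_remainder_coeff:
  assumes "reduced r"
  shows "Poly_Mapping.lookup (remainder_coeff r p) q = Poly_Mapping.lookup p (pullback_exp \<beta> w q + r)"
proof -
  have "inj (\<lambda>q. pullback_exp \<beta> w q + r)"
    using division_unique[OF assms assms] by (auto intro: injI)
  then show ?thesis by (simp add: remainder_coeff_def map_key.rep_eq)
qed

lemma remainder_coeff_add:
  "reduced r \<Longrightarrow> remainder_coeff r (p + q) = remainder_coeff r p + remainder_coeff r q"
  by (intro poly_mapping_eqI) (simp add: lookup_remainder_coeff lookup_add)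

lemma remainder_coeff_single:
  assumes "reduced r" "reduced r'"
  shows "remainder_coeff r (Poly_Mapping.single (pullback_exp \<beta> w q + r') c) = (if r = r' then Poly_Mapping.single q c else 0)"
  using assms
  by (intro poly_mapping_eqI) (auto simp: lookup_remainder_coeff lookup_single division_unique when_def)

text \<open>Division of exponents sorts the terms of a polynomial by their remainders, which makes the
  monomials of reduced exponent a basis of \<open>S\<close> over \<open>R\<close>.\<close>

theorem dual_basis_pullback:
  "dual_basis mpoly_ring mpoly_ring (pullback \<beta> w :: ('s, 'k::field) mpoly \<Rightarrow> ('n, 'k) mpoly)
    {r. reduced r} monomial remainder_coeff"
proof -
  have hom: "remainder_coeff r (pullback \<beta> w a * s) = a * remainder_coeff r s"
    if r: "reduced r" for r and a :: "('s, 'k) mpoly" and s :: "('n, 'k) mpoly"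
  proof (induction a rule: mpoly_induct)
    case (single e c)
    show ?case
    proof (induction s rule: mpoly_induct)
      case (single e' c')
      obtain q r' where e': "reduced r'" "e' = pullback_exp \<beta> w q + r'" using division_exists by blast
      have "pullback_exp \<beta> w e + e' = pullback_exp \<beta> w (e + q) + r'" by (simp add: e' pullback_exp_add add.assoc)
      then show ?case
        by (simp add: e'(2) mult_single remainder_coeff_single[OF r e'(1)])
    qed (simp add: ring_distribs remainder_coeff_add r)
  qed (simp add: ring_distribs remainder_coeff_add r pullback_add)
  have finite: "finite {r. reduced r \<and> remainder_coeff r s \<noteq> 0}" for s :: "('n, 'k) mpoly"
  proof (induction s rule: mpoly_induct)
    case (single e c)
    obtain q r' where e: "reduced r'" "e = pullback_exp \<beta> w q + r'" using division_exists by blast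
    show ?case
      by (rule finite_subset[of _ "{r'}"]) (auto simp: e remainder_coeff_single split: if_splits)
  next
    case (add p q)
    show ?case
      by (rule finite_subset[OF _ finite_UnI[OF add]]) (auto simp: remainder_coeff_add)
  qed
  have lookup: "Poly_Mapping.lookup (pullback \<beta> w p * monomial r) (pullback_exp \<beta> w q + r') = (if r = r' then Poly_Mapping.lookup p q else 0)"
    if "reduced r" "reduced r'" for r r' q and p :: "('s, 'k) mpoly"
  proof (induction p rule: mpoly_induct)
    case (single e c)
    then show ?case using that by (auto simp: monomial_def mult_single lookup_single division_unique when_def)
  qed (simp add: pullback_add ring_distribs lookup_add)
  have expansion: "s = (\<Sum>r\<in>{r. reduced r \<and> remainder_coeff r s \<noteq> 0}. pullback \<beta> w (remainder_coeff r s) * monomial r)"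
    (is "_ = sum ?f ?J") for s :: "('n, 'k) mpoly"
  proof (rule poly_mapping_eqI)
    fix e
    obtain q r' where e: "reduced r'" "e = pullback_exp \<beta> w q + r'" using division_exists by blast
    have "Poly_Mapping.lookup (sum ?f ?J) e = (\<Sum>r\<in>?J. if r = r' then Poly_Mapping.lookup s e else 0)"
      unfolding lookup_sum by (rule sum.cong) (auto simp: e lookup lookup_remainder_coeff)
    also have "\<dots> = Poly_Mapping.lookup s e"
      using finite[of s] e lookup_remainder_coeff[OF e(1), of s q] by auto
    finally show "Poly_Mapping.lookup s e = Poly_Mapping.lookup (sum ?f ?J) e" ..
  qed
  show ?thesis
  proof (intro dual_basis.intro dual_basis_axioms.intro cring_mpoly_ring pullback_ring_hom)
    show "s = (\<Oplus>\<^bsub>mpoly_ring\<^esub>t\<in>{t \<in> {r. reduced r}. remainder_coeff t s \<noteq> \<zero>\<^bsub>mpoly_ring\<^esub>}.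
        pullback \<beta> w (remainder_coeff t s) \<otimes>\<^bsub>mpoly_ring\<^esub> monomial t)" for s :: "('n, 'k) mpoly"
      using expansion[of s] by simp
  qed (simp_all add: remainder_coeff_add hom finite)
qed

lemma pullback_irrelevant_ideal:
  "pullback \<beta> w ` (irrelevant_ideal :: ('s, 'k::field) mpoly set) \<subseteq> irrelevant_ideal"
proof -
  have ideal: "ideal (irrelevant_ideal :: ('v, 'k) mpoly set) mpoly_ring" for dummy :: 'v
    unfolding irrelevant_ideal_def by (rule mpoly.genideal_ideal) simp
  note I = mpoly_ideal[OF ideal]
  have var: "monomial (Poly_Mapping.single i 1) \<in> (irrelevant_ideal :: ('v, 'k) mpoly set)" for i :: 'v
    unfolding irrelevant_ideal_def by (intro subsetD[OF mpoly.genideal_self]) auto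
  have "(irrelevant_ideal :: ('s, 'k) mpoly set) \<subseteq> {p. pullback \<beta> w p \<in> irrelevant_ideal}"
    unfolding irrelevant_ideal_def[where 'v='s]
  proof (rule mpoly.genideal_minimal)
    show "ideal {p. pullback \<beta> w p \<in> (irrelevant_ideal :: ('n, 'k) mpoly set)} mpoly_ring"
      by (rule ideal_mpoly_ringI) (simp_all add: pullback_add pullback_mult I)
    show "range (\<lambda>b. monomial (Poly_Mapping.single b 1)) \<subseteq> {p. pullback \<beta> w p \<in> (irrelevant_ideal :: ('n, 'k) mpoly set)}"
    proof clarify
      fix b :: 's
      obtain i where i: "\<beta> i = b" using surj by (metis surjD)
      let ?e = "pullback_exp \<beta> w (Poly_Mapping.single b 1)"
      \<comment> \<open>subtraction of exponents truncates, but the exponent at \<open>i\<close> is \<open>w i > 0\<close>\<close>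
      have "?e = (?e - Poly_Mapping.single i 1) + Poly_Mapping.single i 1"
        using i weight_pos[of i]
        by (intro poly_mapping_eqI) (auto simp: lookup_add lookup_minus lookup_single when_def)
      then have "pullback \<beta> w (monomial (Poly_Mapping.single b 1)) =
          monomial (?e - Poly_Mapping.single i 1) * (monomial (Poly_Mapping.single i 1) :: ('n, 'k) mpoly)"
        by (simp add: monomial_def mult_single)
      then show "pullback \<beta> w (monomial (Poly_Mapping.single b 1)) \<in> (irrelevant_ideal :: ('n, 'k) mpoly set)"
        using I(3)[OF var] by simp
    qed
  qed
  then show ?thesis by blast
qed

end

section \<open>Pulling back toric ideals and their resolutions\<close>

text \<open>The relation between \<open>A\<close> and its bouquet matrix, here called \<open>C\<close>, as far as it matters for
  resolutions.\<close>

locale toric_pullback = exponent_pullback \<beta> w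
  for \<beta> :: "'n::finite \<Rightarrow> 's::finite" and w +
  fixes A :: "int^'n^'m" and C :: "int^'s^'m"
  assumes column_sum: "column b C = (\<Sum>i\<in>{i. \<beta> i = b}. int (w i) *s column i A)"
    and kernel_lift: "v \<in> integer_kernel A \<Longrightarrow> \<exists>u. \<forall>i. v $ i = u $ \<beta> i * int (w i)"
begin

lemma sum_columns: "(\<Sum>b\<in>UNIV. k b *s column b C) = (\<Sum>i\<in>UNIV. (k (\<beta> i) * int (w i)) *s column i A)"
proof -
  have "(\<Sum>b\<in>UNIV. k b *s column b C) = (\<Sum>b\<in>UNIV. \<Sum>i\<in>{i. \<beta> i = b}. (k b * int (w i)) *s column i A)"
    unfolding column_sum by (simp add: vec_eq_iff sum_distrib_left mult.assoc)
  also have "\<dots> = (\<Sum>b\<in>UNIV. \<Sum>i\<in>{i \<in> UNIV. \<beta> i = b}. (k (\<beta> i) * int (w i)) *s column i A)"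
    by (intro sum.cong) auto
  also have "\<dots> = (\<Sum>i\<in>UNIV. (k (\<beta> i) * int (w i)) *s column i A)"
    by (rule sum.group) auto
  finally show ?thesis .
qed

lemma exp_degree_pullback: "exp_degree A (pullback_exp \<beta> w e) = exp_degree C e"
  unfolding exp_degree_def sum_columns by simp

lemma semigroup_NA_incl: "semigroup_NA C \<subseteq> semigroup_NA A"
proof
  fix d assume "d \<in> semigroup_NA C"
  then obtain k where "d = (\<Sum>i\<in>UNIV. int (k (\<beta> i) * w i) *s column i A)"
    by (auto simp: semigroup_NA_def sum_columns)
  then show "d \<in> semigroup_NA A" unfolding semigroup_NA_def by (intro CollectI exI[of _ "\<lambda>i. k (\<beta> i) * w i"]) simp
qed

lemma keys_pullback: "Poly_Mapping.keys (pullback \<beta> w p) \<subseteq> pullback_exp \<beta> w ` Poly_Mapping.keys p"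
  unfolding pullback_def by (rule order_trans[OF keys_sum]) auto

lemma pullback_graded: "p \<in> mpoly_grading C d \<Longrightarrow> pullback \<beta> w p \<in> mpoly_grading A d"
  using keys_pullback[of p] by (auto simp: mpoly_grading_def exp_degree_pullback)

lemma matrix_vector_columns: "M *v u = (\<Sum>j\<in>UNIV. u $ j *s column j M)" for M :: "int^'j::finite^'m"
  by (simp add: vec_eq_iff matrix_vector_mult_def column_def mult.commute)

lemma pullback_kernel_iff:
  assumes "\<And>i. v $ i = u $ \<beta> i * int (w i)"
  shows "v \<in> integer_kernel A \<longleftrightarrow> u \<in> integer_kernel C"
  using sum_columns[of "\<lambda>b. u $ b"] by (simp add: integer_kernel_def matrix_vector_columns assms)

lemma pos_part_pullback:
  assumes "\<And>i. v $ i = u $ \<beta> i * int (w i)"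
  shows "pos_part v = pullback_exp \<beta> w (pos_part u)"
proof (intro poly_mapping_eqI)
  fix i
  have "nat (u $ \<beta> i * int (w i)) = nat (u $ \<beta> i) * w i"
    by (cases "0 \<le> u $ \<beta> i") (simp_all add: nat_mult_distrib mult_nonpos_nonneg)
  then show "Poly_Mapping.lookup (pos_part v) i = Poly_Mapping.lookup (pullback_exp \<beta> w (pos_part u)) i"
    by (simp add: assms)
qed

lemma pullback_binomial:
  assumes "\<And>i. v $ i = u $ \<beta> i * int (w i)"
  shows "pullback \<beta> w (monomial (pos_part u) - monomial (pos_part (- u))) =
    (monomial (pos_part v) - monomial (pos_part (- v)) :: ('n, 'k::field) mpoly)"
  using pos_part_pullback[of v u] pos_part_pullback[of "- v" "- u"] assms
  by (simp add: pullback_diff monomial_def)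

text \<open>Kernel vectors of \<open>A\<close> and of \<open>C\<close> correspond under \<open>u \<mapsto> (i \<mapsto> u (\<beta> i) * w i)\<close>. As the weights
  are positive, this is compatible with positive and negative parts, so generating binomials
  correspond as well.\<close>

theorem toric_ideal_pullback:
  "(toric_ideal A :: ('n, 'k::field) mpoly set) = Idl\<^bsub>mpoly_ring\<^esub> (pullback \<beta> w ` toric_ideal C)"
proof
  note I = mpoly_ideal[OF ideal_toric]
  have J: "ideal (Idl\<^bsub>mpoly_ring\<^esub> (pullback \<beta> w ` (toric_ideal C :: ('s, 'k) mpoly set))) mpoly_ring"
    by (rule mpoly.genideal_ideal) simp
  show "(toric_ideal A :: ('n, 'k) mpoly set) \<subseteq> Idl\<^bsub>mpoly_ring\<^esub> (pullback \<beta> w ` toric_ideal C)"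
  proof (rule toric_ideal_minimal[OF J])
    fix v assume v: "v \<in> integer_kernel A"
    then obtain u where u': "\<And>i. v $ i = u $ \<beta> i * int (w i)" using kernel_lift by blast
    note u = pullback_kernel_iff[OF u', THEN iffD1, OF v] u'
    have "pullback \<beta> w (monomial (pos_part u) - monomial (pos_part (- u))) \<in>
        Idl\<^bsub>mpoly_ring\<^esub> (pullback \<beta> w ` (toric_ideal C :: ('s, 'k) mpoly set))"
      using binomial_in_toric_ideal[OF u(1)] by (intro subsetD[OF mpoly.genideal_self]) auto
    then show "monomial (pos_part v) - monomial (pos_part (- v)) \<in>
        Idl\<^bsub>mpoly_ring\<^esub> (pullback \<beta> w ` (toric_ideal C :: ('s, 'k) mpoly set))"
      by (simp only: pullback_binomial[OF u(2)])
  qed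
  have "toric_ideal C \<subseteq> {p. pullback \<beta> w p \<in> (toric_ideal A :: ('n, 'k) mpoly set)}"
  proof (rule toric_ideal_minimal)
    show "ideal {p. pullback \<beta> w p \<in> (toric_ideal A :: ('n, 'k) mpoly set)} mpoly_ring"
      by (rule ideal_mpoly_ringI) (simp_all add: pullback_add pullback_mult I)
    fix u assume u: "u \<in> integer_kernel C"
    show "monomial (pos_part u) - monomial (pos_part (- u)) \<in> {p. pullback \<beta> w p \<in> (toric_ideal A :: ('n, 'k) mpoly set)}"
      unfolding mem_Collect_eq
      by (subst pullback_binomial[of "\<chi> i. u $ \<beta> i * int (w i)" u])
        (simp_all add: binomial_in_toric_ideal pullback_kernel_iff[of _ u] u)
  qed
  then show "Idl\<^bsub>mpoly_ring\<^esub> (pullback \<beta> w ` toric_ideal C) \<subseteq> (toric_ideal A :: ('n, 'k) mpoly set)"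
    by (intro mpoly.genideal_minimal ideal_toric) auto
qed

end

context toric_pullback
begin

lemma graded_free_module_base_change:
  fixes M :: "(('s, 'k::field) mpoly, 'a) module"
  assumes "graded_free_module mpoly_ring (semigroup_NA C) (mpoly_grading C) M Mg"
  shows "graded_free_module mpoly_ring (semigroup_NA A) (mpoly_grading A)
    (tensor_module mpoly_ring mpoly_ring (pullback \<beta> w :: ('s, 'k) mpoly \<Rightarrow> ('n, 'k) mpoly) M)
    (tensor_grading mpoly_ring mpoly_ring (pullback \<beta> w :: ('s, 'k) mpoly \<Rightarrow> ('n, 'k) mpoly) M (semigroup_NA C) Mg (semigroup_NA A) (mpoly_grading A))"
proof -
  obtain E where graded: "graded_module mpoly_ring (semigroup_NA C) (mpoly_grading C) M Mg"
    and E: "E \<subseteq> (\<Union>d\<in>semigroup_NA C. Mg d)" "module_basis mpoly_ring M E"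
    using assms by (auto simp: graded_free_module_def)
  obtain dg where dg: "\<And>e. e \<in> E \<Longrightarrow> dg e \<in> semigroup_NA C \<and> e \<in> Mg (dg e)"
    using E(1) by (metis UN_E subsetD)
  have M: "Module.module mpoly_ring M" using graded by (simp add: graded_module_def)
  interpret graded_free_tensor M "pullback \<beta> w" E C A Mg dg
    by (intro graded_free_tensor.intro free_tensor.intro graded_free_tensor_axioms.intro free_module.intro
        free_module_axioms.intro tensor_product.intro tensor_product_axioms.intro M cring_mpoly_ring
        pullback_ring_hom E(2) graded pullback_graded semigroup_NA_incl)
      (use dg in auto)
  show ?thesis by (rule graded_free_module_tensor)
qed

text \<open>The augmentation of the new resolution is \<open>\<pi> \<otimes> S\<close> followed by the isomorphism between
  \<open>(R / I) \<otimes> S\<close> and the quotient of \<open>S\<close> by the extended ideal.\<close>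

theorem toric_minimal_resolution_base_change:
  fixes F :: "nat \<Rightarrow> (('s, 'k::field) mpoly, 'f) module"
  defines "\<phi> \<equiv> pullback \<beta> w :: ('s, 'k) mpoly \<Rightarrow> ('n, 'k) mpoly"
  assumes "toric_minimal_resolution C F Fg D"
  shows "toric_minimal_resolution A
    (\<lambda>i. tensor_module mpoly_ring mpoly_ring \<phi> (F i))
    (\<lambda>i. tensor_grading mpoly_ring mpoly_ring \<phi> (F i) (semigroup_NA C) (Fg i) (semigroup_NA A) (mpoly_grading A))
    (\<lambda>i. tensor_map mpoly_ring mpoly_ring \<phi> (F i) (D i))"
proof -
  let ?R = "mpoly_ring :: ('s, 'k) mpoly ring" and ?S = "mpoly_ring :: ('n, 'k) mpoly ring"
  let ?I = "toric_ideal C :: ('s, 'k) mpoly set" and ?J = "toric_ideal A :: ('n, 'k) mpoly set"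
  let ?T = "\<lambda>M. tensor_module ?R ?S \<phi> M"
  let ?Tg = "\<lambda>M Mg. tensor_grading ?R ?S \<phi> M (semigroup_NA C) Mg (semigroup_NA A) (mpoly_grading A)"
  let ?QI = "quotient_module ?R ?I" and ?QJ = "quotient_module ?S ?J"
  let ?QIg = "\<lambda>d. (\<lambda>p. ?I +>\<^bsub>?R\<^esub> p) ` mpoly_grading C d" and ?QJg = "\<lambda>d. (\<lambda>p. ?J +>\<^bsub>?S\<^esub> p) ` mpoly_grading A d"
  note res = assms(2)[unfolded toric_minimal_resolution_def minimal_graded_free_resolution_def]
  have QI: "graded_module ?R (semigroup_NA C) (mpoly_grading C) ?QI ?QIg"
    and free: "\<And>i. graded_free_module ?R (semigroup_NA C) (mpoly_grading C) (F i) (Fg i)"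
    and D: "\<And>i. graded_hom ?R (semigroup_NA C) (F (Suc i)) (Fg (Suc i)) (F i) (Fg i) (D i)"
    and exact: "\<And>i. D (Suc i) ` carrier (F (Suc (Suc i))) = {x \<in> carrier (F (Suc i)). D i x = \<zero>\<^bsub>F i\<^esub>}"
    and minimal: "\<And>i. D i ` carrier (F (Suc i)) \<subseteq> ideal_times_module irrelevant_ideal (F i)"
    using res by simp_all
  obtain \<pi> where \<pi>: "graded_hom ?R (semigroup_NA C) (F 0) (Fg 0) ?QI ?QIg \<pi>" "\<pi> ` carrier (F 0) = carrier ?QI"
    "D 0 ` carrier (F (Suc 0)) = {x \<in> carrier (F 0). \<pi> x = \<zero>\<^bsub>?QI\<^esub>}"
    using res by (elim conjE exE) (rule that)
  interpret basis: dual_basis ?R ?S \<phi> "{r. reduced r}" monomial remainder_coeff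
    unfolding \<phi>_def by (rule dual_basis_pullback)
  have graded: "graded_module ?R (semigroup_NA C) (mpoly_grading C) (F i) (Fg i)" for i
    using free by (simp add: graded_free_module_def)
  have F: "Module.module ?R (F i)" for i using graded by (simp add: graded_module_def)
  have Q: "Module.module ?R ?QI" using QI by (simp add: graded_module_def)
  note Dl = graded_hom_linear[OF D] and \<pi>l = graded_hom_linear[OF \<pi>(1)]
  have TF: "graded_free_module ?S (semigroup_NA A) (mpoly_grading A) (?T (F i)) (?Tg (F i) (Fg i))" for i
    unfolding \<phi>_def by (rule graded_free_module_base_change[OF free])
  have TFg: "graded_module ?S (semigroup_NA A) (mpoly_grading A) (?T (F i)) (?Tg (F i) (Fg i))" for i
    using TF by (simp add: graded_free_module_def)
  have QJ: "graded_module ?S (semigroup_NA A) (mpoly_grading A) ?QJ ?QJg"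
    by (rule graded_module_quotient[OF ideal_toric toric_ideal_homogeneous])
  have J: "?J = Idl\<^bsub>?S\<^esub> (\<phi> ` ?I)" unfolding \<phi>_def by (rule toric_ideal_pullback)
  obtain \<theta> where \<theta>: "linear_map ?S (?T ?QI) ?QJ \<theta>" "\<theta> ` carrier (?T ?QI) = carrier ?QJ"
    and \<theta>_inj: "\<And>z. z \<in> carrier (?T ?QI) \<Longrightarrow> \<theta> z = \<zero>\<^bsub>?QJ\<^esub> \<Longrightarrow> z = \<zero>\<^bsub>?T ?QI\<^esub>"
    and \<theta>_pure: "\<And>r s. r \<in> carrier ?R \<Longrightarrow> s \<in> carrier ?S \<Longrightarrow>
        \<theta> (pure_tensor ?R ?S \<phi> ?QI (?I +>\<^bsub>?R\<^esub> r) s) = ?J +>\<^bsub>?S\<^esub> (\<phi> r \<otimes>\<^bsub>?S\<^esub> s)"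
    by (rule quotient_base_change[OF cring_mpoly_ring cring_mpoly_ring basis.hom ideal_toric[of C], folded J]) (rule that)
  interpret \<Pi>: tensor_linear_map ?R "F 0" ?QI ?S \<phi> \<pi> by (rule basis.tensor_linear_map[OF F Q \<pi>l])
  define \<rho> where "\<rho> z = \<theta> (\<Pi>.tmap z)" for z
  have \<theta>_closed: "\<theta> z \<in> carrier ?QJ" if "z \<in> carrier (?T ?QI)" for z using \<theta>(2) that by blast
  have \<rho>_linear: "linear_map ?S (?T (F 0)) ?QJ \<rho>"
    using \<Pi>.tmap_linear \<theta>(1) unfolding linear_map_def \<rho>_def by (auto simp: Pi_iff)
  have QJ_sub: "additive_subgroup (?QJg d) ?QJ" if "d \<in> semigroup_NA A" for d
    using QJ that by (simp add: graded_module_def)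
  interpret QJ: Module.module ?S ?QJ using QJ by (simp add: graded_module_def)
  have \<rho>_graded: "\<rho> z \<in> ?QJg d" if d: "d \<in> semigroup_NA A" and z: "z \<in> ?Tg (F 0) (Fg 0) d" for d z
    unfolding \<rho>_def
  proof (rule \<Pi>.tmap_graded[OF graded_module_component[OF graded] graded_module_component[OF QI] _ QJ_sub[OF d]
        QJ.M.abelian_group_axioms _ _ _ z])
    fix x c d' and s :: "('n, 'k) mpoly"
    assume a: "c \<in> semigroup_NA C" "x \<in> Fg 0 c" "d' \<in> semigroup_NA A" "s \<in> mpoly_grading A d'" "c + d' = d"
    have "\<pi> x \<in> ?QIg c" by (rule graded_hom_degree[OF \<pi>(1) a(1,2)])
    then obtain p where p: "p \<in> mpoly_grading C c" "\<pi> x = ?I +>\<^bsub>?R\<^esub> p" by blast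
    have "\<phi> p * s \<in> mpoly_grading A (c + d')"
      using pullback_graded[OF p(1)] a(4) unfolding \<phi>_def by (rule mpoly_grading_mult)
    then show "\<theta> (\<Pi>.N.pure (\<pi> x) s) \<in> ?QJg d" using \<theta>_pure[of p s] p(2) a(5) by simp
  qed (use \<theta>(1) in \<open>auto simp: linear_map_def\<close>)
  have \<rho>_zero: "\<rho> z = \<zero>\<^bsub>?QJ\<^esub> \<longleftrightarrow> \<Pi>.tmap z = \<zero>\<^bsub>?T ?QI\<^esub>" if "z \<in> carrier (?T (F 0))" for z
    using \<theta>_inj[OF \<Pi>.tmap_closed[OF that]] linear_map_zero[OF \<Pi>.N.module_T QJ.module_axioms \<theta>(1)] by (auto simp: \<rho>_def)
  show ?thesis
    unfolding toric_minimal_resolution_def minimal_graded_free_resolution_def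
  proof (intro conjI allI exI[of _ \<rho>])
    fix i
    interpret Di: tensor_linear_map ?R "F (Suc i)" "F i" ?S \<phi> "D i" by (rule basis.tensor_linear_map[OF F F Dl])
    show "graded_hom ?S (semigroup_NA A) (?T (F (Suc i))) (?Tg (F (Suc i)) (Fg (Suc i))) (?T (F i)) (?Tg (F i) (Fg i)) Di.tmap"
      unfolding graded_hom_def
    proof (intro conjI ballI)
      fix d assume d: "d \<in> semigroup_NA A"
      have sub: "additive_subgroup (?Tg (F i) (Fg i) d) (?T (F i))" using TFg[of i] d by (simp add: graded_module_def)
      have "Di.tmap z \<in> ?Tg (F i) (Fg i) d" if z: "z \<in> ?Tg (F (Suc i)) (Fg (Suc i)) d" for z
      proof (rule Di.tmap_graded[where h = "\<lambda>z. z", OF graded_module_component[OF graded]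
            graded_module_component[OF graded] _ sub Di.N.abelian_group_T _ _ _ z])
        fix x c d' and s :: "('n, 'k) mpoly"
        assume a: "c \<in> semigroup_NA C" "x \<in> Fg (Suc i) c" "d' \<in> semigroup_NA A" "s \<in> mpoly_grading A d'" "c + d' = d"
        have "D i x \<in> Fg i c" by (rule graded_hom_degree[OF D a(1,2)])
        then have "Di.N.pure (D i x) s \<in> ?Tg (F i) (Fg i) (c + d')"
          using a(1,3,4) by (intro tensor_grading_pure)
        then show "Di.N.pure (D i x) s \<in> ?Tg (F i) (Fg i) d" by (simp only: a(5))
      qed auto
      then show "Di.tmap ` ?Tg (F (Suc i)) (Fg (Suc i)) d \<subseteq> ?Tg (F i) (Fg i) d" by blast
    qed (use Di.tmap_linear in \<open>auto simp: linear_map_def\<close>)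
    show "tensor_map ?R ?S \<phi> (F (Suc i)) (D (Suc i)) ` carrier (?T (F (Suc (Suc i)))) =
        {x \<in> carrier (?T (F (Suc i))). Di.tmap x = \<zero>\<^bsub>?T (F i)\<^esub>}"
      by (rule basis.tensor_exact[OF F F F Dl Dl exact])
    show "Di.tmap ` carrier (?T (F (Suc i))) \<subseteq> ideal_times_module irrelevant_ideal (?T (F i))"
      using pullback_irrelevant_ideal minimal[of i] by (intro Di.tmap_ideal_times) (auto simp: \<phi>_def)
  next
    show "graded_hom ?S (semigroup_NA A) (?T (F 0)) (?Tg (F 0) (Fg 0)) ?QJ ?QJg \<rho>"
      using \<rho>_linear \<rho>_graded unfolding graded_hom_def linear_map_def by blast
    show "\<rho> ` carrier (?T (F 0)) = carrier ?QJ"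
      using \<Pi>.tmap_surj[OF \<pi>(2)] \<theta>(2) by (auto simp: \<rho>_def image_image[symmetric])
    have "tensor_map ?R ?S \<phi> (F 0) (D 0) ` carrier (?T (F (Suc 0))) = {x \<in> carrier (?T (F 0)). \<Pi>.tmap x = \<zero>\<^bsub>?T ?QI\<^esub>}"
      by (rule basis.tensor_exact[OF F F Q Dl \<pi>l \<pi>(3)])
    also have "\<dots> = {x \<in> carrier (?T (F 0)). \<rho> x = \<zero>\<^bsub>?QJ\<^esub>}"
      by (intro Collect_cong conj_cong refl) (simp only: \<rho>_zero)
    finally show "tensor_map ?R ?S \<phi> (F 0) (D 0) ` carrier (?T (F (Suc 0))) = {x \<in> carrier (?T (F 0)). \<rho> x = \<zero>\<^bsub>?QJ\<^esub>}" .
  qed (rule QJ TF)+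
qed

end

section \<open>Bouquets\<close>

lemma covector_orthogonal:
  assumes "covector A c" "u \<in> integer_kernel A"
  shows "(\<Sum>i\<in>UNIV. c $ i * u $ i) = 0"
proof -
  obtain v where v: "c = v v* A" using assms(1) by (auto simp: covector_def)
  have "(\<Sum>i\<in>UNIV. c $ i * u $ i) = (\<Sum>i\<in>UNIV. \<Sum>k\<in>UNIV. v $ k * (A $ k $ i * u $ i))"
    by (simp add: v vector_matrix_mult_def sum_distrib_left sum_distrib_right algebra_simps)
  also have "\<dots> = (\<Sum>k\<in>UNIV. \<Sum>i\<in>UNIV. v $ k * (A $ k $ i * u $ i))"
    by (rule sum.swap)
  also have "\<dots> = (\<Sum>k\<in>UNIV. v $ k * (A *v u) $ k)"
    by (simp add: matrix_vector_mult_def sum_distrib_left)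
  also have "\<dots> = 0" using assms(2) by (simp add: integer_kernel_def)
  finally show ?thesis .
qed

text \<open>A linear functional that vanishes on the kernel of \<open>M\<close> lies in the row space: precompose it with
  a linear section \<open>h\<close> of \<open>M\<close> over its range.\<close>

lemma functional_factors:
  fixes M :: "'f::field^'n^'m" and c :: "'f^'n"
  assumes "\<And>x. M *v x = 0 \<Longrightarrow> (\<Sum>i\<in>UNIV. c $ i * x $ i) = 0"
  shows "\<exists>y. c = y v* M"
proof -
  have lin: "Vector_Spaces.linear (*s) (*s) ((*v) M)"
    by (rule matrix_vector_mul_linear_gen)
  obtain h where h: "Vector_Spaces.linear (*s) (*s) h" "\<And>x. M *v h (M *v x) = M *v x"
    using vec.linear_exists_right_inverse_on[OF lin vec.subspace_UNIV] by blast
  define f where "f x = (\<Sum>i\<in>UNIV. c $ i * x $ i)" for x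
  have f_diff: "f (x - y) = f x - f y" for x y
    by (simp add: f_def algebra_simps sum_subtractf)
  have f_h: "f x = f (h (M *v x))" for x
    using assms[of "x - h (M *v x)"] f_diff[of x "h (M *v x)"] h(2)[of x]
    by (simp add: f_def matrix_vector_mult_diff_distrib)
  have h_sum: "h (\<Sum>k\<in>X. a k *s g k) = (\<Sum>k\<in>X. a k *s h (g k))" for X :: "'m set" and a and g :: "'m \<Rightarrow> 'f^'m"
  proof -
    interpret h: Vector_Spaces.linear "(*s)" "(*s)" h by (rule h(1))
    show ?thesis by (simp add: h.sum h.scale)
  qed
  have f_sum: "f (\<Sum>k\<in>X. a k *s g k) = (\<Sum>k\<in>X. a k * f (g k))" for X :: "'m set" and a and g :: "'m \<Rightarrow> 'f^'n"
  proof -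
    have "f (\<Sum>k\<in>X. a k *s g k) = (\<Sum>i\<in>UNIV. \<Sum>k\<in>X. c $ i * (a k * g k $ i))"
      by (simp add: f_def sum_distrib_left)
    also have "\<dots> = (\<Sum>k\<in>X. \<Sum>i\<in>UNIV. c $ i * (a k * g k $ i))" by (rule sum.swap)
    also have "\<dots> = (\<Sum>k\<in>X. a k * f (g k))"
      by (simp add: f_def sum_distrib_left algebra_simps)
    finally show ?thesis .
  qed
  define y where "y = (\<chi> k. f (h (axis k 1)))"
  have "c $ j = (y v* M) $ j" for j
  proof -
    have "c $ j = f (axis j 1)" by (simp add: f_def axis_def if_distrib cong: if_cong)
    also have "\<dots> = f (h (M *v axis j 1))" by (rule f_h)
    also have "M *v axis j 1 = (\<Sum>k\<in>UNIV. M $ k $ j *s axis k 1)"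
      by (simp add: vec_eq_iff matrix_vector_mult_def axis_def if_distrib cong: if_cong)
    also have "f (h (\<Sum>k\<in>UNIV. M $ k $ j *s axis k 1)) = (\<Sum>k\<in>UNIV. M $ k $ j * y $ k)"
      by (simp add: h_sum f_sum y_def)
    also have "\<dots> = (y v* M) $ j" by (simp add: vector_matrix_mult_def mult.commute)
    finally show ?thesis .
  qed
  then show ?thesis by (metis vec_eq_iff)
qed

lemma common_denominator:
  fixes x :: "rat^'n"
  shows "\<exists>d>0. \<exists>z::int^'n. \<forall>i. of_int d * x $ i = of_int (z $ i)"
proof -
  define d where "d = (\<Prod>i\<in>UNIV. snd (quotient_of (x $ i)))"
  have pos: "snd (quotient_of (x $ i)) > 0" for i by (rule quotient_of_denom_pos')
  have "d > 0" unfolding d_def by (rule prod_pos) (use pos in auto)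
  moreover have "\<exists>z. of_int d * x $ i = of_int z" for i
  proof -
    have "x $ i = of_int (fst (quotient_of (x $ i))) / of_int (snd (quotient_of (x $ i)))"
      by (rule quotient_of_div) simp
    moreover have "d = snd (quotient_of (x $ i)) * (\<Prod>i\<in>UNIV - {i}. snd (quotient_of (x $ i)))"
      unfolding d_def by (subst prod.remove[of _ i]) auto
    ultimately have "of_int d * x $ i = of_int ((\<Prod>i\<in>UNIV - {i}. snd (quotient_of (x $ i))) * fst (quotient_of (x $ i)))"
      using pos[of i] by (simp add: field_simps)
    then show ?thesis by blast
  qed
  then obtain z where "\<And>i. of_int d * x $ i = of_int (z i)" by metis
  then have "\<forall>i. of_int d * x $ i = of_int ((\<chi> i. z i) $ i)" by simp
  ultimately show ?thesis by blast
qed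

text \<open>If all kernel vectors vanish at \<open>i\<close>, then the \<open>i\<close>-th coordinate functional is a rational
  combination of the rows; clearing denominators gives a co-circuit with support \<open>{i}\<close>. Denominators
  also have to be cleared to pass from rational to integer kernel vectors.\<close>

lemma kernel_nonzero_of_not_free:
  fixes A :: "int^'n^'m"
  assumes "\<not> free_index A i"
  shows "\<exists>u\<in>integer_kernel A. u $ i \<noteq> 0"
proof (rule ccontr)
  assume "\<not> (\<exists>u\<in>integer_kernel A. u $ i \<noteq> 0)"
  then have zero: "u $ i = 0" if "u \<in> integer_kernel A" for u using that by blast
  define M where "M = ((\<chi> k j. rat_of_int (A $ k $ j)) :: rat^'n^'m)"
  have "\<exists>y. axis i 1 = y v* M"
  proof (rule functional_factors)
    fix x assume x: "M *v x = 0"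
    obtain d z where d: "d > 0" and z: "\<And>j. of_int d * x $ j = rat_of_int (z $ j)"
      using common_denominator[of x] by blast
    have "z \<in> integer_kernel A"
      unfolding integer_kernel_def mem_Collect_eq vec_eq_iff
    proof
      fix k
      have "rat_of_int ((A *v z) $ k) = (\<Sum>j\<in>UNIV. rat_of_int (A $ k $ j) * rat_of_int (z $ j))"
        by (simp add: matrix_vector_mult_def)
      also have "\<dots> = of_int d * (M *v x) $ k"
        by (simp add: matrix_vector_mult_def M_def z[symmetric] sum_distrib_left algebra_simps)
      finally show "(A *v z) $ k = 0 $ k" using x by simp
    qed
    then have "x $ i = 0" using zero[of z] z[of i] d by simp
    then show "(\<Sum>j\<in>UNIV. axis i 1 $ j * x $ j) = 0"
      by (intro sum.neutral) (auto simp: axis_def)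
  qed
  then obtain y where y: "axis i 1 = y v* M" by blast
  obtain d z where d: "d > 0" and z: "\<And>k. of_int d * y $ k = rat_of_int (z $ k)"
    using common_denominator[of y] by blast
  have w: "(z v* A) $ j = (if j = i then d else 0)" for j
  proof -
    have "rat_of_int ((z v* A) $ j) = (\<Sum>k\<in>UNIV. rat_of_int (z $ k) * rat_of_int (A $ k $ j))"
      by (simp add: vector_matrix_mult_def mult.commute)
    also have "\<dots> = of_int d * (y v* M) $ j"
      by (simp add: vector_matrix_mult_def M_def z[symmetric] sum_distrib_left algebra_simps)
    also have "\<dots> = rat_of_int (if j = i then d else 0)"
      by (simp add: y[symmetric] axis_def)
    finally show ?thesis by (simp only: of_int_eq_iff)
  qed
  have supp: "vsupport (z v* A) = {i}" using d by (auto simp: vsupport_def w)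
  have "cocircuit A (z v* A)"
    unfolding cocircuit_def
  proof (intro conjI allI impI notI)
    show "covector A (z v* A)" by (auto simp: covector_def)
    show False if "z v* A = 0" using w[of i] d that by simp
    show False if "covector A w' \<and> w' \<noteq> 0" "vsupport w' \<subset> vsupport (z v* A)" for w'
    proof -
      have "vsupport w' = {}" using that(2) unfolding supp by auto
      then show False using that(1) by (auto simp: vsupport_def vec_eq_iff)
    qed
  qed
  then show False using assms supp by (auto simp: free_index_def)
qed

text \<open>The Gale vectors of \<open>i\<close> and \<open>j\<close> are positive multiples of each other.\<close>

definition positively_proportional :: "int^'n^'m \<Rightarrow> 'n \<Rightarrow> 'n \<Rightarrow> bool"
  where "positively_proportional A i j \<longleftrightarrow>
    (\<exists>a>0. \<exists>b>0. \<forall>u\<in>integer_kernel A. a * u $ i = b * u $ j)"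

lemma positively_proportional_trans:
  assumes "positively_proportional A i j" "positively_proportional A j k"
  shows "positively_proportional A i k"
proof -
  obtain a b where ab: "a > 0" "b > 0" "\<And>u. u \<in> integer_kernel A \<Longrightarrow> a * u $ i = b * u $ j"
    using assms(1) by (auto simp: positively_proportional_def)
  obtain c d where cd: "c > 0" "d > 0" "\<And>u. u \<in> integer_kernel A \<Longrightarrow> c * u $ j = d * u $ k"
    using assms(2) by (auto simp: positively_proportional_def)
  have "(c * a) * u $ i = (b * d) * u $ k" if "u \<in> integer_kernel A" for u
    using ab(3)[OF that] cd(3)[OF that] by (metis mult.assoc mult.left_commute)
  moreover have "c * a > 0" "b * d > 0" using ab cd by auto
  ultimately show ?thesis unfolding positively_proportional_def by blast
qed

text \<open>The co-vector of the edge is orthogonal to the kernel, and its two entries have opposite signs.\<close>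

lemma positively_proportional_edge:
  assumes "bouquet_edge_plus A i j"
  shows "positively_proportional A i j"
proof -
  obtain c where c: "i \<noteq> j" "covector A c" "vsupport c = {i, j}" "sgn (c $ i) \<noteq> sgn (c $ j)"
    using assms by (auto simp: bouquet_edge_plus_def)
  have ne: "c $ i \<noteq> 0" "c $ j \<noteq> 0" using c(3) by (auto simp: vsupport_def)
  have rel: "c $ i * u $ i + c $ j * u $ j = 0" if "u \<in> integer_kernel A" for u
  proof -
    have "(\<Sum>k\<in>UNIV. c $ k * u $ k) = (\<Sum>k\<in>{i, j}. c $ k * u $ k)"
      by (rule sum.mono_neutral_right) (use c(3) in \<open>auto simp: vsupport_def\<close>)
    then show ?thesis using covector_orthogonal[OF c(2) that] c(1) by simp
  qed
  show ?thesis
  proof (cases "c $ i > 0")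
    case True
    then have "c $ j < 0" using c(4) ne by (cases "c $ j > 0") auto
    then show ?thesis unfolding positively_proportional_def using True rel
      by (intro exI[of _ "c $ i"] conjI exI[of _ "- c $ j"]) (auto simp: eq_neg_iff_add_eq_0)
  next
    case False
    then have "c $ i < 0" "c $ j > 0" using c(4) ne by (cases "c $ j > 0"; auto)+
    then show ?thesis unfolding positively_proportional_def using rel
      by (intro exI[of _ "- c $ i"] conjI exI[of _ "c $ j"]) (auto simp: minus_equation_iff[of "_ * _"] eq_neg_iff_add_eq_0 neg_eq_iff_add_eq_0)
  qed
qed

lemma equiv_bouquets: "equiv UNIV ({(i, j). bouquet_edge A i j}\<^sup>*)"
proof (rule equivI)
  have "sym {(i, j). bouquet_edge A i j}" by (auto simp: sym_def bouquet_edge_def insert_commute)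
  then show "sym ({(i, j). bouquet_edge A i j}\<^sup>*)" by (rule sym_rtrancl)
qed (auto simp: refl_on_def trans_rtrancl)

lemma positively_proportional_bouquet:
  assumes stable: "stable_toric A" and C: "X \<in> bouquets A" and ij: "i \<in> X" "j \<in> X"
  shows "positively_proportional A i j"
proof -
  let ?r = "{(i, j). bouquet_edge A i j}"
  have edge: "positively_proportional A k l" if "bouquet_edge A k l" "k \<in> X" for k l
  proof -
    have "(k, l) \<in> ?r\<^sup>*" using that(1) by auto
    then have l: "l \<in> X" using C that(2) equiv_bouquets[of A] unfolding bouquets_def
      by (metis in_quotient_imp_closed)
    have "k \<noteq> l" using that(1) by (simp add: bouquet_edge_def)
    moreover have "non_mixed A X" using stable C by (auto simp: stable_toric_def)
    ultimately have "bouquet_edge_plus A k l"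
      using that l unfolding non_mixed_def by blast
    then show ?thesis by (rule positively_proportional_edge)
  qed
  have "(i, j) \<in> ?r\<^sup>*"
    using C ij equiv_bouquets[of A] unfolding bouquets_def by (meson in_quotient_imp_in_rel bot_least insert_subset)
  then have "positively_proportional A i j \<and> j \<in> X"
  proof (induction rule: rtrancl_induct)
    case base
    have "positively_proportional A i i" unfolding positively_proportional_def
      by (rule exI[of _ 1], simp, rule exI[of _ 1], simp)
    then show ?case using ij by simp
  next
    case (step k l)
    have "l \<in> X" using step(2,3) C equiv_bouquets[of A] unfolding bouquets_def
      by (meson in_quotient_imp_closed r_into_rtrancl)
    moreover have "positively_proportional A k l" using step(2,3) by (intro edge) auto
    ultimately show ?case using step(3) positively_proportional_trans by blast
  qed
  then show ?thesis ..
qed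

lemma gale_basis_nonzero:
  assumes G: "gale_basis A G" and u: "u \<in> integer_kernel A" "u $ i \<noteq> 0"
  shows "\<exists>j<kernel_rank A. G j $ i \<noteq> 0"
proof (rule ccontr)
  assume "\<not> ?thesis"
  moreover obtain c where "u = (\<Sum>j<kernel_rank A. c j *s G j)"
    using G u(1) unfolding gale_basis_def by blast
  ultimately have "u $ i = 0" by simp
  then show False using u(2) by simp
qed

text \<open>On a bouquet all kernel vectors are proportional to one another, and the entries of each have a
  common sign. Dividing \<open>G j\<close> there by its sign and by the gcd of its entries makes \<open>c\<close> positive
  and primitive, and primitivity makes the factor between \<open>c\<close> and an integer kernel vector an
  integer.\<close>

lemma bouquet_cvec:
  fixes A :: "int^('n::{finite,linorder})^'m"
  assumes G: "gale_basis A G" and nofree: "no_free_bouquet A" and stable: "stable_toric A"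
    and X: "X \<in> bouquets A"
  shows "i \<in> X \<Longrightarrow> bouquet_cvec A G X $ i > 0"
    and "i \<notin> X \<Longrightarrow> bouquet_cvec A G X $ i = 0"
    and "v \<in> integer_kernel A \<Longrightarrow> \<exists>k. \<forall>i\<in>X. v $ i = k * bouquet_cvec A G X $ i"
proof -
  have "X \<noteq> {}" using in_quotient_imp_non_empty[OF equiv_bouquets] X by (auto simp: bouquets_def)
  then have Min: "Min X \<in> X" by simp
  note proportional = positively_proportional_bouquet[OF stable X]
  have sign: "sgn (u $ i) = sgn (u $ i')" if u: "u \<in> integer_kernel A" and i: "i \<in> X" "i' \<in> X" for u i i'
  proof -
    obtain a b where "a > 0" "b > 0" "a * u $ i = b * u $ i'"
      using proportional[OF i] u by (auto simp: positively_proportional_def)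
    then show ?thesis by (metis mult_1 sgn_mult sgn_pos)
  qed
  define j where "j = (SOME j. j < kernel_rank A \<and> (\<forall>i\<in>X. G j $ i \<noteq> 0))"
  obtain u where u: "u \<in> integer_kernel A" "u $ Min X \<noteq> 0"
    using kernel_nonzero_of_not_free nofree by (metis no_free_bouquet_def)
  obtain j' where j': "j' < kernel_rank A" "G j' $ Min X \<noteq> 0" using gale_basis_nonzero[OF G u] by blast
  have "G j' $ i \<noteq> 0" if "i \<in> X" for i
    using sign[OF _ that Min, of "G j'"] j' G by (auto simp: gale_basis_def sgn_0_0)
  then have "j' < kernel_rank A \<and> (\<forall>i\<in>X. G j' $ i \<noteq> 0)" using j'(1) by blast
  then have j: "j < kernel_rank A \<and> (\<forall>i\<in>X. G j $ i \<noteq> 0)"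
    unfolding j_def by (rule someI)
  have Gj: "G j \<in> integer_kernel A" using j G by (simp add: gale_basis_def)
  define g where "g = (GCD i\<in>X. G j $ i)"
  define e where "e = sgn (G j $ Min X)"
  have abs_e: "\<bar>e\<bar> = 1" using j Min by (simp add: e_def abs_sgn_eq)
  have g_dvd: "g dvd G j $ i" if "i \<in> X" for i unfolding g_def using that by (rule Gcd_dvd[OF imageI])
  have "g \<noteq> 0" using g_dvd[OF Min] j Min by auto
  moreover have "g \<ge> 0" unfolding g_def by (rule Gcd_int_greater_eq_0)
  ultimately have g_pos: "g > 0" by simp
  let ?c = "bouquet_cvec A G X"
  have c: "?c $ i = (if i \<in> X then e * G j $ i div g else 0)" for i
    unfolding bouquet_cvec_def Let_def j_def[symmetric] by (simp add: e_def g_def)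
  have gc: "g * ?c $ i = e * G j $ i" if "i \<in> X" for i
    using g_dvd[OF that] that by (simp add: c)
  have e_pos: "e * G j $ i > 0" if "i \<in> X" for i
    using sign[OF Gj Min that] j that unfolding e_def by (simp add: sgn_mult_self_eq[symmetric] abs_sgn[symmetric] mult.commute)
  show c_pos: "?c $ i > 0" if "i \<in> X" for i
    using gc[OF that] e_pos[OF that] g_pos by (metis zero_less_mult_pos)
  show "?c $ i = 0" if "i \<notin> X" for i using that by (simp add: c)
  show "\<exists>k. \<forall>i\<in>X. v $ i = k * ?c $ i" if v: "v \<in> integer_kernel A" for v
  proof -
    have cross: "v $ i * ?c $ i' = v $ i' * ?c $ i" if i: "i \<in> X" "i' \<in> X" for i i'
    proof -
      obtain a b where ab: "a > 0" "b > 0" "\<And>u. u \<in> integer_kernel A \<Longrightarrow> a * u $ i = b * u $ i'"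
        using proportional[OF i] by (auto simp: positively_proportional_def)
      have "(b * g) * (v $ i * ?c $ i') = v $ i * (b * (e * G j $ i'))" using gc[OF i(2)] by (simp add: algebra_simps)
      also have "\<dots> = v $ i * e * (a * G j $ i)" using ab(3)[OF Gj] by (simp add: algebra_simps)
      also have "\<dots> = (b * v $ i') * (e * G j $ i)" using ab(3)[OF v] by (simp add: algebra_simps)
      also have "\<dots> = (b * g) * (v $ i' * ?c $ i)" using gc[OF i(1)] by (simp add: algebra_simps)
      finally show ?thesis using ab(2) g_pos by simp
    qed
    have "g * (GCD i\<in>X. ?c $ i) = (GCD i\<in>X. g * ?c $ i)"
      using Gcd_mult[of g "(\<lambda>i. ?c $ i) ` X"] g_pos by (simp add: image_image abs_mult)
    also have "\<dots> = (GCD i\<in>X. e * G j $ i)" using gc by (metis (mono_tags, lifting) image_cong)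
    also have "\<dots> = g"
      using Gcd_mult[of e "(\<lambda>i. G j $ i) ` X"] abs_e g_pos by (simp add: image_image g_def abs_mult)
    finally have primitive: "(GCD i\<in>X. ?c $ i) = 1" using g_pos by simp
    let ?m = "Min X"
    \<comment> \<open>Primitivity of \<open>c\<close> turns divisibility of all \<open>v $ ?m * c $ i\<close> into divisibility of \<open>v $ ?m\<close>.\<close>
    have "?c $ ?m dvd v $ ?m * ?c $ i" if "i \<in> X" for i
      using cross[OF Min that] by simp
    then have "?c $ ?m dvd (GCD i\<in>X. v $ ?m * ?c $ i)" by (intro Gcd_greatest) auto
    also have "(GCD i\<in>X. v $ ?m * ?c $ i) = \<bar>v $ ?m\<bar>"
      using Gcd_mult[of "v $ ?m" "(\<lambda>i. ?c $ i) ` X"] primitive by (simp add: image_image)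
    finally obtain k where k: "v $ ?m = ?c $ ?m * k" by (auto elim: dvdE)
    have "v $ i = k * ?c $ i" if "i \<in> X" for i
      using cross[OF Min that] k c_pos[OF Min] by (simp add: algebra_simps)
    then show ?thesis by blast
  qed
qed

text \<open>The bouquets partition the columns: \<open>\<beta> i\<close> is the bouquet of \<open>i\<close>, and \<open>w i\<close> is the entry at \<open>i\<close>
  of its vector.\<close>

lemma toric_pullback_of_bouquets:
  fixes A :: "int^('n::{finite,linorder})^'m" and B :: "'s::finite \<Rightarrow> 'n set"
  assumes G: "gale_basis A G" and nofree: "no_free_bouquet A" and stable: "stable_toric A"
    and B: "bij_betw B UNIV (bouquets A)"
  obtains \<beta> w where "toric_pullback \<beta> w A (bouquet_matrix A G B)"
    and "bouquet_hom A G B = (pullback \<beta> w :: ('s, 'k::field) mpoly \<Rightarrow> ('n, 'k) mpoly)"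
proof -
  have BA: "B b \<in> bouquets A" for b using B by (auto simp: bij_betw_def)
  have "\<Union>(bouquets A) = UNIV" unfolding bouquets_def by (rule Union_quotient[OF equiv_bouquets])
  then have "\<exists>b. i \<in> B b" for i using B by (metis UNIV_I UnionE bij_betw_imp_surj_on imageE)
  then obtain \<beta> where \<beta>: "\<And>i. i \<in> B (\<beta> i)" by metis
  have B_iff: "i \<in> B b \<longleftrightarrow> \<beta> i = b" for i b
  proof
    assume "i \<in> B b"
    then have "B b = B (\<beta> i)"
      using quotient_disj[OF equiv_bouquets[of A]] BA[of b] BA[of "\<beta> i"] \<beta>[of i] unfolding bouquets_def by blast
    then show "\<beta> i = b" using B by (metis UNIV_I bij_betw_imp_inj_on inj_onD)
  qed (use \<beta> in blast)
  note c = bouquet_cvec[OF G nofree stable BA]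
  define w where "w i = nat (bouquet_cvec A G (B (\<beta> i)) $ i)" for i
  have c_eq: "bouquet_cvec A G (B b) $ i = (if \<beta> i = b then int (w i) else 0)" for b i
    using c(1)[of i b] c(2)[of i b] B_iff by (auto simp: w_def)
  show ?thesis
  proof
    show "toric_pullback \<beta> w A (bouquet_matrix A G B)"
    proof
      show "surj \<beta>"
        unfolding surj_def
      proof
        fix b
        have "B b \<noteq> {}" using in_quotient_imp_non_empty[OF equiv_bouquets] BA[of b] by (auto simp: bouquets_def)
        then obtain i where "i \<in> B b" by blast
        then have "b = \<beta> i" by (simp add: B_iff)
        then show "\<exists>i. b = \<beta> i" ..
      qed
      show "w i > 0" for i using c(1)[OF \<beta>] by (simp add: w_def)
      show "column b (bouquet_matrix A G B) = (\<Sum>i\<in>{i. \<beta> i = b}. int (w i) *s column i A)" for b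
      proof -
        have "column b (bouquet_matrix A G B) = bouquet_avec A G (B b)"
          by (simp add: column_def bouquet_matrix_def vec_eq_iff)
        also have "\<dots> = (\<Sum>i\<in>{i. \<beta> i = b}. int (w i) *s column i A)"
          unfolding bouquet_avec_def c_eq by (rule sum.mono_neutral_cong_right) auto
        finally show ?thesis .
      qed
      show "\<exists>u. \<forall>i. v $ i = u $ \<beta> i * int (w i)" if v: "v \<in> integer_kernel A" for v
      proof -
        obtain k where "\<And>b i. i \<in> B b \<Longrightarrow> v $ i = k b * bouquet_cvec A G (B b) $ i" using c(3)[OF v] by metis
        then have "\<forall>i. v $ i = (\<chi> b. k b) $ \<beta> i * int (w i)" using B_iff by (simp add: c_eq)
        then show ?thesis by blast
      qed
    qed
    show "bouquet_hom A G B = (pullback \<beta> w :: ('s, 'k) mpoly \<Rightarrow> ('n, 'k) mpoly)"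
      unfolding bouquet_hom_def by (rule substitution_monomials) (simp add: c_eq)
  qed
qed

theorem theorem3p11:
  fixes A :: "int^('n::{finite,linorder})^('m::finite)"
    and G :: "nat \<Rightarrow> int^('n::{finite,linorder})"
    and B :: "'s::finite \<Rightarrow> 'n set"
    and F :: "nat \<Rightarrow> (('s, 'k::field) mpoly, 'f) module"
    and Fg :: "nat \<Rightarrow> int^'m \<Rightarrow> 'f set"
    and D :: "nat \<Rightarrow> 'f \<Rightarrow> 'f"
  defines "AB \<equiv> bouquet_matrix A G B"
    and "R \<equiv> mpoly_ring :: ('s, 'k) mpoly ring"
    and "S \<equiv> mpoly_ring :: ('n, 'k) mpoly ring"
    and "\<phi> \<equiv> bouquet_hom A G B"
  assumes "gale_basis A G"
    and "no_free_bouquet A"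
    and "stable_toric A"
    and "positively_graded A"
    and "bij_betw B UNIV (bouquets A)"
    and "toric_minimal_resolution AB F Fg D"
  shows "toric_minimal_resolution A
    (\<lambda>i. tensor_module R S \<phi> (F i))
    (\<lambda>i. tensor_grading R S \<phi> (F i) (semigroup_NA AB) (Fg i) (semigroup_NA A) (mpoly_grading A))
    (\<lambda>i. tensor_map R S \<phi> (F i) (D i))"
proof -
  obtain \<beta> w where \<beta>w: "toric_pullback \<beta> w A AB"
    and \<phi>: "\<phi> = (pullback \<beta> w :: ('s, 'k) mpoly \<Rightarrow> ('n, 'k) mpoly)"
    using toric_pullback_of_bouquets[OF assms(5,6,7,9)] unfolding AB_def \<phi>_def by blast
  show ?thesis
    unfolding R_def S_def \<phi> using toric_pullback.toric_minimal_resolution_base_change[OF \<beta>w assms(10)] .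
qed

end
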